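(* Let $\lambda$ be a regular cardinal, let $\mathcal K$ be a locally $\lambda$-presentable category, and let $E$ be a $\lambda$-ary equational theory over $\mathcal K$. Then the category $\mathbf{Alg}(E)$ of $E$-algebras is locally $\lambda$-presentable, and the forgetful functor $U_E:\mathbf{Alg}(E)\to\mathcal K$ is monadic and preserves $\lambda$-filtered colimits.
   Context: For objects $X,A$ of $\mathcal K$ write $A^X$ for the set $\mathcal K(X,A)$; for $f:Y\to X$ write $A^f=\mathcal K(f,A):A^X\to A^Y$, and for $h:A\to B$ write $h^X=\mathcal K(X,h):A^X\to B^X$. Let $\mathcal A$ be a full subcategory of $\mathcal K$. An $\mathcal A$-ary type $t$ over $\mathcal K$ is a class $\Omega$ with a mapping $t:\Omega\to\mathrm{ob}(\mathcal A)\times\mathrm{ob}(\mathcal A)$ such that $\Omega^{X,Y}=t^{-1}(X,Y)$ is a set for all $X,Y$. Elements of $\Omega^{X,Y}$ are $(X,Y)$-ary operation symbols. Terms are defined inductively: every $\omega\in\Omega^{X,Y}$ is an $(X,Y)$-ary term; every morphism $f:Y\to X$ of $\mathcal A$ determines an $(X,Y)$-ary term $x_f$; if $p$ is an $(X,Y)$-ary term and $q$ a $(Y,Z)$-ary term then $qp$ is an $(X,Z)$-ary term; terms are identified according to $x_{fg}=x_gx_f$, $(pq)r=p(qr)$ and $x_{\mathrm{id}_Y}p=p=px_{\mathrm{id}_X}$ for $p$ an $(X,Y)$-ary term. An equation $p=q$ is a pair of terms of the same arity $(X,Y)$, and an equational theory $E$ of type $t$ is a class of equations. An algebra of type $t$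 is an object $A$ of $\mathcal K$ with mappings $\omega_A:A^X\to A^Y$ for all $\omega\in\Omega^{X,Y}$. Terms are interpreted by $(x_f)_A=A^f$ and $(qp)_A=q_Ap_A$. $A$ satisfies $p=q$ if $p_A=q_A$; an $E$-algebra is an algebra satisfying all equations of $E$. A homomorphism $A\to B$ is a morphism $h:A\to B$ of $\mathcal K$ with $h^Y\omega_A=\omega_Bh^X$ for every $\omega\in\Omega^{X,Y}$. This gives the category $\mathbf{Alg}(E)$ and the forgetful functor $U_E:\mathbf{Alg}(E)\to\mathcal K$. A type over a locally $\lambda$-presentable category $\mathcal K$ is $\lambda$-ary if it is $\mathcal K_\lambda$-ary, where $\mathcal K_\lambda$ is a (representative) small full subcategory of the $\lambda$-presentable objects of $\mathcal K$. An equational theory is $\lambda$-ary if its type is. *)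

theory Defs
  imports "HOL-Library.FuncSet"
begin

unbundle cardinal_syntax

section \<open>Smallness\<close>

text \<open>
  The set/class distinction is rendered by a Grothendieck universe, given by a
  type \<open>'u\<close> whose cardinality is an uncountable strongly inaccessible cardinal. A set over any
  type is small if it has fewer elements than \<open>'u\<close>; arbitrary sets play the role of classes.
  Every small set is in bijection with a set over \<open>'u\<close>, so a quantifier over small
  objects may be bounded to small objects whose elements come from \<open>'u\<close>.
\<close>

definition small :: "'u itself \<Rightarrow> 'a set \<Rightarrow> bool" where
  "small U A \<longleftrightarrow> |A| <o |UNIV :: 'u set|"

definition universe :: "'u itself \<Rightarrow> bool" where
  "universe U \<longleftrightarrow> natLeq <o |UNIV :: 'u set| \<and> regularCard |UNIV :: 'u set| \<and>
     (\<forall>A :: 'u set. small U A \<longrightarrow> small U (Pow A))"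

definition regular_cardinal :: "'l rel \<Rightarrow> bool" where
  "regular_cardinal r \<longleftrightarrow> Cinfinite r \<and> regularCard r"


section \<open>Categories, functors, natural transformations\<close>

record ('o, 'm) cat =
  Ob :: "'o set"
  Arr :: "'m set"
  Dom :: "'m \<Rightarrow> 'o"
  Cod :: "'m \<Rightarrow> 'o"
  Id :: "'o \<Rightarrow> 'm"
  Comp :: "'m \<Rightarrow> 'm \<Rightarrow> 'm"  \<comment> \<open>\<open>Comp C g f\<close> is \<open>g\<close> after \<open>f\<close>\<close>

definition hom :: "('o, 'm) cat \<Rightarrow> 'o \<Rightarrow> 'o \<Rightarrow> 'm set" where
  "hom C X Y = {f \<in> Arr C. Dom C f = X \<and> Cod C f = Y}"

definition category :: "('o, 'm) cat \<Rightarrow> bool" where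
  "category C \<longleftrightarrow>
     (\<forall>f\<in>Arr C. Dom C f \<in> Ob C \<and> Cod C f \<in> Ob C) \<and>
     (\<forall>X\<in>Ob C. Id C X \<in> hom C X X) \<and>
     (\<forall>f\<in>Arr C. \<forall>g\<in>Arr C. Dom C g = Cod C f \<longrightarrow> Comp C g f \<in> hom C (Dom C f) (Cod C g)) \<and>
     (\<forall>f\<in>Arr C. Comp C f (Id C (Dom C f)) = f \<and> Comp C (Id C (Cod C f)) f = f) \<and>
     (\<forall>f\<in>Arr C. \<forall>g\<in>Arr C. \<forall>h\<in>Arr C. Dom C g = Cod C f \<longrightarrow> Dom C h = Cod C g \<longrightarrow>
        Comp C h (Comp C g f) = Comp C (Comp C h g) f)"

definition locally_small :: "'u itself \<Rightarrow> ('o, 'm) cat \<Rightarrow> bool" where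
  "locally_small U C \<longleftrightarrow> (\<forall>X\<in>Ob C. \<forall>Y\<in>Ob C. small U (hom C X Y))"

definition small_category :: "'u itself \<Rightarrow> ('o, 'm) cat \<Rightarrow> bool" where
  "small_category U C \<longleftrightarrow> category C \<and> small U (Ob C) \<and> small U (Arr C)"

definition isomorphic :: "('o, 'm) cat \<Rightarrow> 'o \<Rightarrow> 'o \<Rightarrow> bool" where
  "isomorphic C X Y \<longleftrightarrow>
     (\<exists>f\<in>hom C X Y. \<exists>g\<in>hom C Y X. Comp C g f = Id C X \<and> Comp C f g = Id C Y)"

record ('o, 'm, 'p, 'n) fctr =
  omap :: "'o \<Rightarrow> 'p"
  amap :: "'m \<Rightarrow> 'n"

definition is_functor ::
  "('o, 'm) cat \<Rightarrow> ('p, 'n) cat \<Rightarrow> ('o, 'm, 'p, 'n) fctr \<Rightarrow> bool" where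
  "is_functor C D F \<longleftrightarrow>
     (\<forall>X\<in>Ob C. omap F X \<in> Ob D) \<and>
     (\<forall>f\<in>Arr C. amap F f \<in> hom D (omap F (Dom C f)) (omap F (Cod C f))) \<and>
     (\<forall>X\<in>Ob C. amap F (Id C X) = Id D (omap F X)) \<and>
     (\<forall>f\<in>Arr C. \<forall>g\<in>Arr C. Dom C g = Cod C f \<longrightarrow>
        amap F (Comp C g f) = Comp D (amap F g) (amap F f))"

definition id_functor :: "('o, 'm, 'o, 'm) fctr" where
  "id_functor = \<lparr>omap = (\<lambda>X. X), amap = (\<lambda>f. f)\<rparr>"

definition comp_functor ::
  "('p, 'n, 'q, 'k) fctr \<Rightarrow> ('o, 'm, 'p, 'n) fctr \<Rightarrow> ('o, 'm, 'q, 'k) fctr" where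
  "comp_functor G F = \<lparr>omap = (\<lambda>X. omap G (omap F X)), amap = (\<lambda>f. amap G (amap F f))\<rparr>"

definition nat_trans :: "('o, 'm) cat \<Rightarrow> ('p, 'n) cat \<Rightarrow> ('o, 'm, 'p, 'n) fctr \<Rightarrow>
    ('o, 'm, 'p, 'n) fctr \<Rightarrow> ('o \<Rightarrow> 'n) \<Rightarrow> bool" where
  "nat_trans C D F G \<alpha> \<longleftrightarrow>
     (\<forall>X\<in>Ob C. \<alpha> X \<in> hom D (omap F X) (omap G X)) \<and>
     (\<forall>f\<in>Arr C. Comp D (\<alpha> (Cod C f)) (amap F f) = Comp D (amap G f) (\<alpha> (Dom C f)))"

definition naturally_isomorphic :: "('o, 'm) cat \<Rightarrow> ('p, 'n) cat \<Rightarrow> ('o, 'm, 'p, 'n) fctr \<Rightarrow>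
    ('o, 'm, 'p, 'n) fctr \<Rightarrow> bool" where
  "naturally_isomorphic C D F G \<longleftrightarrow>
     (\<exists>\<alpha> \<beta>. nat_trans C D F G \<alpha> \<and> nat_trans C D G F \<beta> \<and>
        (\<forall>X\<in>Ob C. Comp D (\<beta> X) (\<alpha> X) = Id D (omap F X) \<and>
                   Comp D (\<alpha> X) (\<beta> X) = Id D (omap G X)))"

definition equivalence ::
  "('o, 'm) cat \<Rightarrow> ('p, 'n) cat \<Rightarrow> ('o, 'm, 'p, 'n) fctr \<Rightarrow> bool" where
  "equivalence C D F \<longleftrightarrow> is_functor C D F \<and>
     (\<exists>G. is_functor D C G \<and>
        naturally_isomorphic C C id_functor (comp_functor G F) \<and>
        naturally_isomorphic D D (comp_functor F G) id_functor)"


section \<open>Colimits\<close>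

definition cocone :: "('o, 'm) cat \<Rightarrow> ('i, 'j) cat \<Rightarrow> ('i, 'j, 'o, 'm) fctr \<Rightarrow>
    'o \<Rightarrow> ('i \<Rightarrow> 'm) \<Rightarrow> bool" where
  "cocone C J D c \<tau> \<longleftrightarrow> c \<in> Ob C \<and>
     (\<forall>i\<in>Ob J. \<tau> i \<in> hom C (omap D i) c) \<and>
     (\<forall>a\<in>Arr J. Comp C (\<tau> (Cod J a)) (amap D a) = \<tau> (Dom J a))"

definition colimit :: "('o, 'm) cat \<Rightarrow> ('i, 'j) cat \<Rightarrow> ('i, 'j, 'o, 'm) fctr \<Rightarrow>
    'o \<Rightarrow> ('i \<Rightarrow> 'm) \<Rightarrow> bool" where
  "colimit C J D c \<tau> \<longleftrightarrow> cocone C J D c \<tau> \<and>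
     (\<forall>c' \<tau>'. cocone C J D c' \<tau>' \<longrightarrow>
        (\<exists>!h. h \<in> hom C c c' \<and> (\<forall>i\<in>Ob J. Comp C h (\<tau> i) = \<tau>' i)))"

definition cocomplete :: "'u itself \<Rightarrow> ('o, 'm) cat \<Rightarrow> bool" where
  "cocomplete U C \<longleftrightarrow>
     (\<forall>(J :: ('u, 'u) cat) D. small_category U J \<longrightarrow> is_functor J C D \<longrightarrow> (\<exists>c \<tau>. colimit C J D c \<tau>))"

text \<open>A category is \<open>r\<close>-filtered if every diagram in it with fewer than \<open>r\<close> arrows has a cocone.\<close>

definition filtered :: "'l rel \<Rightarrow> ('u, 'u) cat \<Rightarrow> bool" where
  "filtered r J \<longleftrightarrow> category J \<and>
     (\<forall>(S :: ('u, 'u) cat) D. category S \<longrightarrow> |Arr S| <o r \<longrightarrow> is_functor S J D \<longrightarrow>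
        (\<exists>c \<tau>. cocone J S D c \<tau>))"

definition preserves_filtered_colimits :: "'u itself \<Rightarrow> 'l rel \<Rightarrow> ('o, 'm) cat \<Rightarrow> ('p, 'n) cat \<Rightarrow>
    ('o, 'm, 'p, 'n) fctr \<Rightarrow> bool" where
  "preserves_filtered_colimits U r C C' F \<longleftrightarrow>
     (\<forall>(J :: ('u, 'u) cat) D c \<tau>.
        small_category U J \<longrightarrow> filtered r J \<longrightarrow> is_functor J C D \<longrightarrow> colimit C J D c \<tau> \<longrightarrow>
        colimit C' J (comp_functor F D) (omap F c) (\<lambda>i. amap F (\<tau> i)))"


section \<open>Locally presentable categories\<close>

definition set_cat :: "'u itself \<Rightarrow> ('a set, 'a set \<times> ('a \<Rightarrow> 'a) \<times> 'a set) cat" where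
  "set_cat U = \<lparr>
     Ob = {A. small U A},
     Arr = {(A, f, B). small U A \<and> small U B \<and> f \<in> A \<rightarrow>\<^sub>E B},
     Dom = (\<lambda>(A, f, B). A),
     Cod = (\<lambda>(A, f, B). B),
     Id = (\<lambda>A. (A, \<lambda>x\<in>A. x, A)),
     Comp = (\<lambda>(B, g, C) (A, f, B'). (A, compose A g f, C))\<rparr>"

text \<open>
  The target of the hom-functor consists of the small sets over the sum type \<open>'m + 'u\<close>: the hom-sets
  lie in the left summand, and the right summand makes sure that every small set occurs up to
  bijection, whatever the size of \<open>'m\<close>.
\<close>

definition hom_functor :: "('o, 'm) cat \<Rightarrow> 'o \<Rightarrow>
    ('o, 'm, ('m + 'u) set, ('m + 'u) set \<times> ('m + 'u \<Rightarrow> 'm + 'u) \<times> ('m + 'u) set) fctr" where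
  "hom_functor C X = \<lparr>
     omap = (\<lambda>Y. Inl ` hom C X Y),
     amap = (\<lambda>f. (Inl ` hom C X (Dom C f),
                  \<lambda>s\<in>Inl ` hom C X (Dom C f). map_sum (\<lambda>g. Comp C f g) id s,
                  Inl ` hom C X (Cod C f)))\<rparr>"

definition presentable :: "'u itself \<Rightarrow> 'l rel \<Rightarrow> ('o, 'm) cat \<Rightarrow> 'o \<Rightarrow> bool" where
  "presentable U r C X \<longleftrightarrow> X \<in> Ob C \<and>
     preserves_filtered_colimits U r C (set_cat U)
       (hom_functor C X :: ('o, 'm, ('m + 'u) set, _) fctr)"

definition locally_presentable :: "'u itself \<Rightarrow> 'l rel \<Rightarrow> ('o, 'm) cat \<Rightarrow> bool" where
  "locally_presentable U r C \<longleftrightarrow> category C \<and> locally_small U C \<and> cocomplete U C \<and>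
     (\<exists>G. small U G \<and> (\<forall>X\<in>G. presentable U r C X) \<and>
        (\<forall>X\<in>Ob C. \<exists>(J :: ('u, 'u) cat) D \<tau>. small_category U J \<and> filtered r J \<and>
           is_functor J C D \<and> (\<forall>i\<in>Ob J. omap D i \<in> G) \<and> colimit C J D X \<tau>))"

text \<open>A small full subcategory is given by its set of objects.\<close>

definition representative_presentables ::
  "'u itself \<Rightarrow> 'l rel \<Rightarrow> ('o, 'm) cat \<Rightarrow> 'o set \<Rightarrow> bool" where
  "representative_presentables U r C P \<longleftrightarrow> small U P \<and> (\<forall>X\<in>P. presentable U r C X) \<and>
     (\<forall>X. presentable U r C X \<longrightarrow> (\<exists>Y\<in>P. isomorphic C X Y))"


section \<open>Monadic functors\<close>

definition adjunction :: "('o, 'm) cat \<Rightarrow> ('p, 'n) cat \<Rightarrow> ('o, 'm, 'p, 'n) fctr \<Rightarrow>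
    ('p, 'n, 'o, 'm) fctr \<Rightarrow> ('o \<Rightarrow> 'm) \<Rightarrow> ('p \<Rightarrow> 'n) \<Rightarrow> bool" where
  "adjunction C D F R \<eta> \<epsilon> \<longleftrightarrow> is_functor C D F \<and> is_functor D C R \<and>
     nat_trans C C id_functor (comp_functor R F) \<eta> \<and>
     nat_trans D D (comp_functor F R) id_functor \<epsilon> \<and>
     (\<forall>X\<in>Ob C. Comp D (\<epsilon> (omap F X)) (amap F (\<eta> X)) = Id D (omap F X)) \<and>
     (\<forall>B\<in>Ob D. Comp C (amap R (\<epsilon> B)) (\<eta> (omap R B)) = Id C (omap R B))"

text \<open>
  The Eilenberg--Moore category of the monad \<open>(T, \<eta>, \<mu>)\<close> on \<open>C\<close>. Arrows carry their domain
  and codomain.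
\<close>

definition em_objects :: "('o, 'm) cat \<Rightarrow> ('o, 'm, 'o, 'm) fctr \<Rightarrow> ('o \<Rightarrow> 'm) \<Rightarrow> ('o \<Rightarrow> 'm) \<Rightarrow>
    ('o \<times> 'm) set" where
  "em_objects C T \<eta> \<mu> = {(X, a). X \<in> Ob C \<and> a \<in> hom C (omap T X) X \<and>
     Comp C a (\<eta> X) = Id C X \<and> Comp C a (\<mu> X) = Comp C a (amap T a)}"

definition em_cat :: "('o, 'm) cat \<Rightarrow> ('o, 'm, 'o, 'm) fctr \<Rightarrow> ('o \<Rightarrow> 'm) \<Rightarrow> ('o \<Rightarrow> 'm) \<Rightarrow>
    ('o \<times> 'm, ('o \<times> 'm) \<times> 'm \<times> ('o \<times> 'm)) cat" where
  "em_cat C T \<eta> \<mu> = \<lparr>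
     Ob = em_objects C T \<eta> \<mu>,
     Arr = {((X, a), h, (Y, b)). (X, a) \<in> em_objects C T \<eta> \<mu> \<and> (Y, b) \<in> em_objects C T \<eta> \<mu> \<and>
              h \<in> hom C X Y \<and> Comp C h a = Comp C b (amap T h)},
     Dom = (\<lambda>(x, h, y). x),
     Cod = (\<lambda>(x, h, y). y),
     Id = (\<lambda>x. (x, Id C (fst x), x)),
     Comp = (\<lambda>(y, k, z) (x, h, y'). (x, Comp C k h, z))\<rparr>"

definition comparison_functor :: "('p, 'n) cat \<Rightarrow> ('p, 'n, 'o, 'm) fctr \<Rightarrow> ('p \<Rightarrow> 'n) \<Rightarrow>
    ('p, 'n, 'o \<times> 'm, ('o \<times> 'm) \<times> 'm \<times> ('o \<times> 'm)) fctr" where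
  "comparison_functor D R \<epsilon> = \<lparr>
     omap = (\<lambda>B. (omap R B, amap R (\<epsilon> B))),
     amap = (\<lambda>f. ((omap R (Dom D f), amap R (\<epsilon> (Dom D f))), amap R f,
                  (omap R (Cod D f), amap R (\<epsilon> (Cod D f)))))\<rparr>"

definition monadic :: "('p, 'n) cat \<Rightarrow> ('o, 'm) cat \<Rightarrow> ('p, 'n, 'o, 'm) fctr \<Rightarrow> bool" where
  "monadic D C R \<longleftrightarrow> (\<exists>F \<eta> \<epsilon>. adjunction C D F R \<eta> \<epsilon> \<and>
     equivalence D (em_cat C (comp_functor R F) \<eta> (\<lambda>X. amap R (\<epsilon> (omap F X))))
       (comparison_functor D R \<epsilon>))"


section \<open>Equational theories and their algebras\<close>

text \<open>
  Raw terms are terms before the identifications. \<open>Cmp q p\<close> stands for the composite \<open>qp\<close>, in which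
  \<open>p\<close> is applied first.
\<close>

datatype ('m, 'w) raw_term = Opn 'w | Var 'm | Cmp "('m, 'w) raw_term" "('m, 'w) raw_term"

record ('o, 'm, 'w) eq_theory =
  ops :: "'w set"
  ar :: "'w \<Rightarrow> 'o \<times> 'o"
  eqs :: "(('m, 'w) raw_term set \<times> ('m, 'w) raw_term set) set"

inductive has_arity :: "('o, 'm) cat \<Rightarrow> 'o set \<Rightarrow> ('o, 'm, 'w) eq_theory \<Rightarrow>
    ('m, 'w) raw_term \<Rightarrow> 'o \<Rightarrow> 'o \<Rightarrow> bool" for K A T where
  opn: "w \<in> ops T \<Longrightarrow> ar T w = (X, Y) \<Longrightarrow> has_arity K A T (Opn w) X Y"
| var: "X \<in> A \<Longrightarrow> Y \<in> A \<Longrightarrow> f \<in> hom K Y X \<Longrightarrow> has_arity K A T (Var f) X Y"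
| cmp: "has_arity K A T p X Y \<Longrightarrow> has_arity K A T q Y Z \<Longrightarrow> has_arity K A T (Cmp q p) X Z"

inductive term_cong :: "('o, 'm) cat \<Rightarrow> 'o set \<Rightarrow> ('o, 'm, 'w) eq_theory \<Rightarrow>
    'o \<Rightarrow> 'o \<Rightarrow> ('m, 'w) raw_term \<Rightarrow> ('m, 'w) raw_term \<Rightarrow> bool" for K A T where
  refl: "has_arity K A T p X Y \<Longrightarrow> term_cong K A T X Y p p"
| sym: "term_cong K A T X Y p q \<Longrightarrow> term_cong K A T X Y q p"
| trans: "term_cong K A T X Y p q \<Longrightarrow> term_cong K A T X Y q r \<Longrightarrow> term_cong K A T X Y p r"
| cong: "term_cong K A T X Y p p' \<Longrightarrow> term_cong K A T Y Z q q' \<Longrightarrow>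
    term_cong K A T X Z (Cmp q p) (Cmp q' p')"
| var_comp: "X \<in> A \<Longrightarrow> Y \<in> A \<Longrightarrow> Z \<in> A \<Longrightarrow> f \<in> hom K Y X \<Longrightarrow> g \<in> hom K Z Y \<Longrightarrow>
    term_cong K A T X Z (Var (Comp K f g)) (Cmp (Var g) (Var f))"
| assoc: "has_arity K A T r X Y \<Longrightarrow> has_arity K A T q Y Z \<Longrightarrow> has_arity K A T p Z W \<Longrightarrow>
    term_cong K A T X W (Cmp (Cmp p q) r) (Cmp p (Cmp q r))"
| id_left: "has_arity K A T p X Y \<Longrightarrow> term_cong K A T X Y (Cmp (Var (Id K Y)) p) p"
| id_right: "has_arity K A T p X Y \<Longrightarrow> term_cong K A T X Y (Cmp p (Var (Id K X))) p"

definition terms_of :: "('o, 'm) cat \<Rightarrow> 'o set \<Rightarrow> ('o, 'm, 'w) eq_theory \<Rightarrow> 'o \<Rightarrow> 'o \<Rightarrow>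
    ('m, 'w) raw_term set set" where
  "terms_of K A T X Y = {p. has_arity K A T p X Y} // {(p, q). term_cong K A T X Y p q}"

text \<open>\<open>A\<close> is the set of objects of the full subcategory of \<open>K\<close> from which the arities are taken.\<close>

definition equational_theory ::
  "'u itself \<Rightarrow> ('o, 'm) cat \<Rightarrow> 'o set \<Rightarrow> ('o, 'm, 'w) eq_theory \<Rightarrow> bool" where
  "equational_theory U K A T \<longleftrightarrow> A \<subseteq> Ob K \<and> ar T \<in> ops T \<rightarrow> A \<times> A \<and>
     (\<forall>X\<in>A. \<forall>Y\<in>A. small U {w \<in> ops T. ar T w = (X, Y)}) \<and>
     (\<forall>(P, Q) \<in> eqs T. \<exists>X\<in>A. \<exists>Y\<in>A. P \<in> terms_of K A T X Y \<and> Q \<in> terms_of K A T X Y)"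

text \<open>An algebra is a pair of an object of \<open>K\<close> and an interpretation of the operation symbols.\<close>

type_synonym ('o, 'm, 'w) alg = "'o \<times> ('w \<Rightarrow> 'm \<Rightarrow> 'm)"

definition type_algebras :: "('o, 'm) cat \<Rightarrow> ('o, 'm, 'w) eq_theory \<Rightarrow> ('o, 'm, 'w) alg set" where
  "type_algebras K T = {(B, i). B \<in> Ob K \<and>
     i \<in> (\<Pi>\<^sub>E w\<in>ops T. hom K (fst (ar T w)) B \<rightarrow>\<^sub>E hom K (snd (ar T w)) B)}"

primrec raw_interp :: "('o, 'm) cat \<Rightarrow> ('w \<Rightarrow> 'm \<Rightarrow> 'm) \<Rightarrow> ('m, 'w) raw_term \<Rightarrow> 'm \<Rightarrow> 'm" where
  "raw_interp K i (Opn w) = i w"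
| "raw_interp K i (Var f) = (\<lambda>g. Comp K g f)"
| "raw_interp K i (Cmp q p) = raw_interp K i q \<circ> raw_interp K i p"

text \<open>
  The interpretation of a term \<open>P\<close> with source arity \<open>X\<close>, as a function on \<open>hom K X B\<close>. All raw
  terms in \<open>P\<close> yield the same function, see the lemma \<open>term_interp_eq\<close> below.
\<close>

definition term_interp :: "('o, 'm) cat \<Rightarrow> ('o, 'm, 'w) alg \<Rightarrow> 'o \<Rightarrow>
    ('m, 'w) raw_term set \<Rightarrow> 'm \<Rightarrow> 'm" where
  "term_interp K B X P = the_elem ((\<lambda>p. restrict (raw_interp K (snd B) p) (hom K X (fst B))) ` P)"

definition satisfies :: "('o, 'm) cat \<Rightarrow> 'o set \<Rightarrow> ('o, 'm, 'w) eq_theory \<Rightarrow> ('o, 'm, 'w) alg \<Rightarrow>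
    ('m, 'w) raw_term set \<times> ('m, 'w) raw_term set \<Rightarrow> bool" where
  "satisfies K A T B e \<longleftrightarrow>
     (\<forall>X Y. fst e \<in> terms_of K A T X Y \<longrightarrow> snd e \<in> terms_of K A T X Y \<longrightarrow>
        term_interp K B X (fst e) = term_interp K B X (snd e))"

definition algebras ::
  "('o, 'm) cat \<Rightarrow> 'o set \<Rightarrow> ('o, 'm, 'w) eq_theory \<Rightarrow> ('o, 'm, 'w) alg set" where
  "algebras K A T = {B \<in> type_algebras K T. \<forall>e\<in>eqs T. satisfies K A T B e}"

definition homomorphism :: "('o, 'm) cat \<Rightarrow> ('o, 'm, 'w) eq_theory \<Rightarrow> ('o, 'm, 'w) alg \<Rightarrow>
    'm \<Rightarrow> ('o, 'm, 'w) alg \<Rightarrow> bool" where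
  "homomorphism K T B h C \<longleftrightarrow> h \<in> hom K (fst B) (fst C) \<and>
     (\<forall>w\<in>ops T. \<forall>g\<in>hom K (fst (ar T w)) (fst B). Comp K h (snd B w g) = snd C w (Comp K h g))"

definition alg_cat :: "('o, 'm) cat \<Rightarrow> 'o set \<Rightarrow> ('o, 'm, 'w) eq_theory \<Rightarrow>
    (('o, 'm, 'w) alg, ('o, 'm, 'w) alg \<times> 'm \<times> ('o, 'm, 'w) alg) cat" where
  "alg_cat K A T = \<lparr>
     Ob = algebras K A T,
     Arr = {(B, h, C). B \<in> algebras K A T \<and> C \<in> algebras K A T \<and> homomorphism K T B h C},
     Dom = (\<lambda>(B, h, C). B),
     Cod = (\<lambda>(B, h, C). C),
     Id = (\<lambda>B. (B, Id K (fst B), B)),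
     Comp = (\<lambda>(C, k, D) (B, h, C'). (B, Comp K k h, D))\<rparr>"

definition alg_forget ::
  "(('o, 'm, 'w) alg, ('o, 'm, 'w) alg \<times> 'm \<times> ('o, 'm, 'w) alg, 'o, 'm) fctr" where
  "alg_forget = \<lparr>omap = fst, amap = (\<lambda>(B, h, C). h)\<rparr>"


subsection \<open>Interpretation of terms is well defined\<close>

lemma has_arity_objects:
  assumes "equational_theory U K A T" "has_arity K A T p X Y"
  shows "X \<in> A \<and> Y \<in> A"
  using assms(2)
proof induction
  case (opn w X Y)
  then have "ar T w \<in> A \<times> A"
    using assms(1) unfolding equational_theory_def by (blast dest: funcset_mem)
  with opn show ?case by simp
qed simp_all

lemma raw_interp_in_hom:
  assumes "category K" "B \<in> type_algebras K T" "has_arity K A T p X Y" "g \<in> hom K X (fst B)"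
  shows "raw_interp K (snd B) p g \<in> hom K Y (fst B)"
  using assms(3,4)
proof (induction arbitrary: g)
  case (opn w X Y)
  have "snd B \<in> (\<Pi>\<^sub>E w\<in>ops T. hom K (fst (ar T w)) (fst B) \<rightarrow>\<^sub>E hom K (snd (ar T w)) (fst B))"
    using assms(2) by (simp add: type_algebras_def split_beta)
  from PiE_mem[OF this opn(1)] have "snd B w \<in> hom K X (fst B) \<rightarrow>\<^sub>E hom K Y (fst B)"
    using opn(2) by simp
  from PiE_mem[OF this opn(3)] show ?case by simp
next
  case (var X Y f)
  then show ?case using assms(1) by (simp add: category_def hom_def)
qed simp

lemma raw_interp_cong:
  assumes K: "category K" and B: "B \<in> type_algebras K T" and T: "equational_theory U K A T"
    and "term_cong K A T X Y p q"
  shows "has_arity K A T p X Y \<and> has_arity K A T q X Y \<and>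
    (\<forall>g\<in>hom K X (fst B). raw_interp K (snd B) p g = raw_interp K (snd B) q g)"
  using assms(4)
proof induction
  case (trans X Y p q r)
  then show ?case by simp
next
  case (cong X Y p p' Z q q')
  then have "raw_interp K (snd B) p g \<in> hom K Y (fst B)" if "g \<in> hom K X (fst B)" for g
    using raw_interp_in_hom[OF K B] that by blast
  with cong show ?case by (simp add: has_arity.cmp[of _ _ _ _ X Y])
next
  case (var_comp X Y Z f g)
  then have "Comp K f g \<in> hom K Z X" using K by (auto simp: category_def hom_def)
  moreover have "Comp K h (Comp K f g) = Comp K (Comp K h f) g" if "h \<in> hom K X (fst B)" for h
    using that var_comp K by (auto simp: category_def hom_def)
  ultimately show ?case using var_comp
    by (simp add: has_arity.var has_arity.cmp[of _ _ _ _ X Y])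
next
  case (assoc r X Y q Z p W)
  have "has_arity K A T (Cmp (Cmp p q) r) X W" "has_arity K A T (Cmp p (Cmp q r)) X W"
    by (rule has_arity.cmp assoc)+
  then show ?case by simp
next
  case (id_left p X Y)
  have Y: "Y \<in> A" using has_arity_objects[OF T id_left] by simp
  then have "Y \<in> Ob K" using T unfolding equational_theory_def by blast
  then have "Id K Y \<in> hom K Y Y" using K by (simp add: category_def)
  with id_left Y have "has_arity K A T (Cmp (Var (Id K Y)) p) X Y"
    by (blast intro: has_arity.cmp has_arity.var)
  moreover have "Comp K h (Id K Y) = h" if "h \<in> hom K Y (fst B)" for h
    using that K by (auto simp: category_def hom_def)
  ultimately show ?case using id_left raw_interp_in_hom[OF K B] by simp
next
  case (id_right p X Y)
  have X: "X \<in> A" using has_arity_objects[OF T id_right] by simp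
  then have "X \<in> Ob K" using T unfolding equational_theory_def by blast
  then have "Id K X \<in> hom K X X" using K by (simp add: category_def)
  with id_right X have "has_arity K A T (Cmp p (Var (Id K X))) X Y"
    by (blast intro: has_arity.cmp has_arity.var)
  moreover have "Comp K h (Id K X) = h" if "h \<in> hom K X (fst B)" for h
    using that K by (auto simp: category_def hom_def)
  ultimately show ?case using id_right by simp
qed simp_all

lemma term_interp_eq:
  assumes "category K" "B \<in> type_algebras K T" "equational_theory U K A T"
    and P: "P \<in> terms_of K A T X Y" and p: "p \<in> P"
  shows "term_interp K B X P = restrict (raw_interp K (snd B) p) (hom K X (fst B))"
proof -
  obtain r where r: "P = {q. term_cong K A T X Y r q}"
    using P unfolding terms_of_def by (blast elim: quotientE)
  have "restrict (raw_interp K (snd B) q) (hom K X (fst B)) =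
    restrict (raw_interp K (snd B) p) (hom K X (fst B))" if "q \<in> P" for q
  proof (rule restrict_ext)
    fix g assume g: "g \<in> hom K X (fst B)"
    have "term_cong K A T X Y r p" "term_cong K A T X Y r q" using p that by (simp_all add: r)
    then have "term_cong K A T X Y p q" by (rule term_cong.trans[OF term_cong.sym])
    from raw_interp_cong[OF assms(1-3) this] g
    show "raw_interp K (snd B) q g = raw_interp K (snd B) p g" by simp
  qed
  then have "(\<lambda>q. restrict (raw_interp K (snd B) q) (hom K X (fst B))) ` P =
      (\<lambda>_. restrict (raw_interp K (snd B) p) (hom K X (fst B))) ` P"
    by (rule image_cong[OF HOL.refl])
  also have "\<dots> = {restrict (raw_interp K (snd B) p) (hom K X (fst B))}"
    by (rule image_constant[OF p])
  finally show ?thesis by (simp add: term_interp_def)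
qed

end

theory Submission
  imports Defs
begin

text \<open>
  Free algebras and colimits of algebras are both initial objects among \<open>structures\<close>: algebras
  with a given kind of family of morphisms into them. The initial structure is cut out of the
  (large) product of all structures. The \<open>X\<close>-elements of that product, for \<open>X \<in> P\<close>, that are
  generated from the given family by the operations, by precomposition, by copairing along
  coproducts of fewer than \<open>r\<close> objects of \<open>P\<close>, and by factoring through coequalizers of fewer than
  \<open>r\<close> arrows of \<open>P\<close> form a small set, and their category of elements is \<open>r\<close>-filtered. Its colimit in
  \<open>K\<close> therefore has exactly these elements; it inherits the operations and the equations, and
  uniqueness of the morphisms out of it follows by induction on the generation. So limits, the
  adjoint functor theorem and transfinite chains are avoided.

  Filtered colimits of algebras are computed in \<open>K\<close> because arities are presentable, and an
  algebra structure is recovered from an Eilenberg--Moore algebra \<open>a : TX \<rightarrow> X\<close> by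
  \<open>\<omega>(g) = a \<cdot> \<omega>\<^bsub>FX\<^esub>(\<eta> \<cdot> g)\<close>. The closure of the free algebras on \<open>P\<close> under coproducts
  and coequalizers of size below \<open>r\<close> is a small set of presentable algebras, and every algebra is
  the filtered colimit of its canonical diagram over that set.
\<close>

section \<open>Cardinality\<close>

text \<open>The product of all structures is indexed by what may be a proper class and need not
  exist in \<open>K\<close>, so its elements are kept as families with one morphism per structure,
  and only generated families are ever collected. They form a small set because each rule has fewer
  than \<open>r\<close> premises and, for given premises, only a small set of conclusions. An
  operation of arity \<open>X\<close> acts on all morphisms from \<open>X\<close> into the colimit,
  so the colimit must not acquire \<open>X\<close>-elements beyond the generated ones; copairing and
  coequalizer factoring are among the rules to prevent this, since a filtered category of elements
  lets presentability of \<open>X\<close> apply. No relations are imposed on generators: two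
  elements are equal when all structures say so, which makes the morphisms to the structures jointly
  monic and lets equations be checked there. Presentability is defined by a colimit of hom-sets, but
  is used through two elementwise statements, \<open>factors\<close> and \<open>separates\<close>.
  Most schemes that occur do not live on the universe type, hence the renaming of schemes and the
  second form \<open>filt\<close> of filteredness.\<close>

lemma regular_cardinalD:
  assumes "regular_cardinal r"
  shows "Cinfinite r" "regularCard r" "Card_order r" "infinite (Field r)"
  using assms by (auto simp: regular_cardinal_def cinfinite_def)

lemma lt_mono: "|A| <o r \<Longrightarrow> B \<subseteq> A \<Longrightarrow> |B| <o r"
  using card_of_mono1 ordLeq_ordLess_trans by blast

lemma lt_image: "|A| <o r \<Longrightarrow> |f ` A| <o r"
  using card_of_image ordLeq_ordLess_trans by blast

lemma lt_inj_on: "|B| <o r \<Longrightarrow> inj_on f A \<Longrightarrow> f ` A \<subseteq> B \<Longrightarrow> |A| <o r"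
  using card_of_ordLeqI[of f A B] ordLeq_ordLess_trans by blast

lemma lt_surj: "|A| <o r \<Longrightarrow> B \<subseteq> f ` A \<Longrightarrow> |B| <o r"
  using lt_image lt_mono by blast

lemma lt_UNION:
  "regular_cardinal r \<Longrightarrow> |I| <o r \<Longrightarrow> (\<And>i. i \<in> I \<Longrightarrow> |A i| <o r) \<Longrightarrow> |\<Union>i\<in>I. A i| <o r"
  using card_of_UNION_ordLess_infinite_Field_regularCard[of r I A]
  by (auto simp: regular_cardinal_def)

lemma lt_finite:
  assumes r: "regular_cardinal r" and A: "finite A"
  shows "|A| <o r"
proof (rule finite_ordLess_infinite)
  show "Well_order |A|" "Well_order r"
    using regular_cardinalD(3)[OF r] by (simp_all add: card_order_on_well_order_on card_of_Well_order)
  show "finite (Field |A| )" "infinite (Field r)"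
    using A regular_cardinalD(4)[OF r] by (simp_all add: Field_card_of)
qed

lemma lt_Un: "regular_cardinal r \<Longrightarrow> |A| <o r \<Longrightarrow> |B| <o r \<Longrightarrow> |A \<union> B| <o r"
  using card_of_Un_ordLess_infinite_Field[of r A B] by (auto simp: regular_cardinal_def cinfinite_def)

lemma lt_Sigma:
  assumes "regular_cardinal r" "|I| <o r" "\<And>i. i \<in> I \<Longrightarrow> |A i| <o r"
  shows "|Sigma I A| <o r"
proof -
  have "Sigma I A = (\<Union>i\<in>I. Pair i ` A i)" by auto
  then show ?thesis using assms by (simp add: lt_UNION lt_image)
qed

text \<open>Being small means being smaller than this cardinal, so its regularity turns the
  \<open>lt_\<close> lemmas into the corresponding \<open>small_\<close> lemmas.\<close>

lemma universe_regular: "universe (U :: 'u itself) \<Longrightarrow> regular_cardinal |UNIV :: 'u set|"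
  unfolding universe_def regular_cardinal_def cinfinite_def
  by (metis Card_order_iff_ordLeq_card_of card_of_Card_order cinfinite_def ordLess_imp_ordLeq natLeq_cinfinite cinfinite_mono)

lemma small_lt:
  assumes "small U (Field r)" "regular_cardinal r" "|A| <o r"
  shows "small U A"
proof -
  have "|A| <o |Field r|"
    using assms(2,3) card_of_Field_ordIso regular_cardinalD(3) ordLess_ordIso_trans ordIso_symmetric
    by blast
  then show ?thesis using assms(1) ordLess_transitive unfolding small_def by blast
qed

lemma small_mono: "small U A \<Longrightarrow> B \<subseteq> A \<Longrightarrow> small U B"
  and small_image: "small U A \<Longrightarrow> small U (f ` A)"
  and small_inj_on: "small U D \<Longrightarrow> inj_on g C \<Longrightarrow> g ` C \<subseteq> D \<Longrightarrow> small U C"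
  and small_surj: "small U A \<Longrightarrow> B' \<subseteq> f' ` A \<Longrightarrow> small U B'"
  unfolding small_def by (blast intro: lt_mono lt_image lt_inj_on lt_surj)+

lemma small_UNION:
    "universe U \<Longrightarrow> small U I \<Longrightarrow> (\<And>i. i \<in> I \<Longrightarrow> small U (A i)) \<Longrightarrow> small U (\<Union>i\<in>I. A i)"
  and small_finite: "universe U \<Longrightarrow> finite B \<Longrightarrow> small U B"
  and small_Un: "universe U \<Longrightarrow> small U B \<Longrightarrow> small U B' \<Longrightarrow> small U (B \<union> B')"
  and small_Sigma:
    "universe U \<Longrightarrow> small U I \<Longrightarrow> (\<And>i. i \<in> I \<Longrightarrow> small U (A' i)) \<Longrightarrow> small U (Sigma I A')"
  unfolding small_def by (simp_all add: universe_regular lt_UNION lt_finite lt_Un lt_Sigma)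

lemma small_embed:
  assumes "small (U :: 'u itself) A"
  obtains f :: "'a \<Rightarrow> 'u" where "inj_on f A"
  using assms ordLess_imp_ordLeq card_of_ordLeq[of A "UNIV :: 'u set"] unfolding small_def by blast

lemma small_Pow:
  assumes U: "universe (U :: 'u itself)" and A: "small U A"
  shows "small U (Pow A)"
proof -
  obtain f :: "'a \<Rightarrow> 'u" where f: "inj_on f A" using small_embed[OF A] .
  have "small U (Pow (f ` A))" using U small_image[OF A] unfolding universe_def by blast
  moreover have "inj_on ((`) f) (Pow A)" using f by (simp add: inj_on_image_Pow)
  ultimately show ?thesis by (rule small_inj_on) auto
qed

text \<open>Functions are coded by their graphs inside \<open>Pow (Sigma A B)\<close>; the default
  value outside \<open>A\<close> makes the coding injective.\<close>

lemma small_PiE: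
  assumes U: "universe U" and A: "small U A" and B: "\<And>a. a \<in> A \<Longrightarrow> small U (B a)"
  shows "small U (PiE A B)"
proof (rule small_inj_on[where g = "\<lambda>f. {(a, f a) | a. a \<in> A}"])
  show "small U (Pow (Sigma A B))" using assms by (simp add: small_Pow small_Sigma)
  show "inj_on (\<lambda>f. {(a, f a) |a. a \<in> A}) (PiE A B)"
  proof (rule inj_onI)
    fix f g assume f: "f \<in> PiE A B" and g: "g \<in> PiE A B"
      and eq: "{(a, f a) |a. a \<in> A} = {(a, g a) |a. a \<in> A}"
    then have "f a = g a" if "a \<in> A" for a using that by blast
    then show "f = g" using PiE_ext[OF f g] by blast
  qed
qed auto

section \<open>Closure under rules \<open>(T, z)\<close> with premise set \<open>T\<close> and
  conclusion \<open>z\<close>\<close>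

inductive_set closure :: "('z set \<times> 'z) set \<Rightarrow> 'z set" for R where
  step: "(T, z) \<in> R \<Longrightarrow> (\<And>t. t \<in> T \<Longrightarrow> t \<in> closure R) \<Longrightarrow> z \<in> closure R"

text \<open>A rank for derivations, with positions in the well-order \<open>r\<close> as ranks: a
  conclusion sits at \<open>a\<close> if each premise has some rank strictly below \<open>a\<close>,
  and that rank may vary with the premise.\<close>

inductive_set stage :: "'l rel \<Rightarrow> ('z set \<times> 'z) set \<Rightarrow> ('l \<times> 'z) set" for r R where
  stage: "(T, z) \<in> R \<Longrightarrow> a \<in> Field r \<Longrightarrow>
    (\<And>t. t \<in> T \<Longrightarrow> \<exists>b. b \<noteq> a \<and> (b, a) \<in> r \<and> (b, t) \<in> stage r R) \<Longrightarrow> (a, z) \<in> stage r R"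

text \<open>The closure is exhausted by stages indexed by \<open>r\<close>, as no set of fewer than \<open>r\<close> premises is
  cofinal in them.\<close>

lemma small_closure:
  fixes r :: "'l rel" and R :: "('z set \<times> 'z) set"
  assumes U: "universe U" and r: "regular_cardinal r" "small U (Field r)"
    and R: "\<And>T. small U T \<Longrightarrow> small U {z. (T, z) \<in> R}" "\<And>T z. (T, z) \<in> R \<Longrightarrow> |T| <o r"
  shows "small U (closure R)"
proof -
  define S where "S a = {z. (a, z) \<in> stage r R}" for a
  have wo: "Well_order r" using regular_cardinalD(3)[OF r(1)] by (simp add: card_order_on_well_order_on)
  then have wf: "wf (r - Relation.Id)" by (simp add: well_order_on_def)
  have tr: "trans r" and anti: "antisym r"
    using wo by (auto simp: well_order_on_def linear_order_on_def partial_order_on_def preorder_on_def)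
  have small: "small U (S a)" for a
  proof (induction a rule: wf_induct_rule[OF wf])
    case (1 a)
    \<comment> \<open>\<open>V\<close> collects all strictly earlier stages and is small by
      induction and by smallness of \<open>Field r\<close>. A rule used at stage \<open>a\<close>
      has its premises in \<open>V\<close>, so the stage is covered by the conclusions of the small
      set of subsets of \<open>V\<close>.\<close>
    define V where "V = (\<Union>b\<in>underS r a. S b)"
    have "underS r a \<subseteq> Field r" by (auto simp: underS_def Field_def)
    then have V: "small U V" unfolding V_def
      using 1 by (intro small_UNION[OF U] small_mono[OF r(2)]) (auto simp: underS_def)
    have "S a \<subseteq> (\<Union>T\<in>Pow V. {z. (T, z) \<in> R})"
    proof
      fix z assume "z \<in> S a"
      then have "(a, z) \<in> stage r R" by (simp add: S_def)
      then show "z \<in> (\<Union>T\<in>Pow V. {z. (T, z) \<in> R})"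
        by cases (auto simp: V_def S_def underS_def)
    qed
    moreover have "small U (\<Union>T\<in>Pow V. {z. (T, z) \<in> R})"
      by (intro small_UNION[OF U] small_Pow[OF U V] R(1)) (auto intro: small_mono[OF V])
    ultimately show ?case by (rule small_mono[rotated])
  qed
  \<comment> \<open>Monotonicity of the stages is what lets regularity of \<open>r\<close> be
    applied: fewer than \<open>r\<close> premises inside the union of a chain lie in one of its
    members.\<close>
  have chain: "relChain r S"
    unfolding relChain_def
  proof (intro allI impI subsetI)
    fix a b z assume ab: "(a, b) \<in> r" and "z \<in> S a"
    then have "(a, z) \<in> stage r R" by (simp add: S_def)
    then have "(b, z) \<in> stage r R"
    proof cases
      case (stage T)
      have "\<exists>c. c \<noteq> b \<and> (c, b) \<in> r \<and> (c, t) \<in> stage r R" if t: "t \<in> T" for t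
      proof -
        obtain c where c: "c \<noteq> a" "(c, a) \<in> r" "(c, t) \<in> stage r R"
          using stage(3)[OF t] by blast
        then have "(c, b) \<in> r" using transD[OF tr _ ab] by blast
        moreover have "c \<noteq> b" using antisymD[OF anti _ ab] c by blast
        ultimately show ?thesis using c(3) by blast
      qed
      then show ?thesis using stage.stage[OF stage(1) FieldI2[OF ab]] by simp
    qed
    then show "z \<in> S b" by (simp add: S_def)
  qed
  have "closure R \<subseteq> (\<Union>a\<in>Field r. S a)"
  proof
    fix z assume "z \<in> closure R"
    then show "z \<in> (\<Union>a\<in>Field r. S a)"
    proof induction
      case (step T z)
      then have "T \<subseteq> (\<Union>a\<in>Field r. S a)" by blast
      from regularCard_UNION[OF regular_cardinalD(3,2)[OF r(1)] chain this R(2)[OF step(1)]]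
      obtain a where a: "a \<in> Field r" "T \<subseteq> S a" by blast
      \<comment> \<open>The premises share the stage \<open>a\<close> but must be strictly earlier
        than the conclusion; an infinite cardinal has no last element, which supplies
        \<open>b\<close>.\<close>
      obtain b where "b \<in> Field r" "a \<noteq> b" "(a, b) \<in> r"
        using infinite_Card_order_limit[OF regular_cardinalD(3,4)[OF r(1)] a(1)] by blast
      then have "(b, z) \<in> stage r R" using a(2)
        by (intro stage.stage[OF step(1)]) (auto simp: S_def)
      then show ?case using \<open>b \<in> Field r\<close> by (auto simp: S_def)
    qed
  qed
  moreover have "small U (\<Union>a\<in>Field r. S a)" by (intro small_UNION[OF U] r small)
  ultimately show ?thesis by (rule small_mono[rotated])
qed


section \<open>Categories, functors and colimits\<close>

lemma categoryI:
  assumes "\<And>f. f \<in> Arr C \<Longrightarrow> Dom C f \<in> Ob C \<and> Cod C f \<in> Ob C"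
    and "\<And>X. X \<in> Ob C \<Longrightarrow> Id C X \<in> hom C X X"
    and "\<And>X Y Z f g. f \<in> hom C X Y \<Longrightarrow> g \<in> hom C Y Z \<Longrightarrow> Comp C g f \<in> hom C X Z"
    and "\<And>X Y f. f \<in> hom C X Y \<Longrightarrow> Comp C f (Id C X) = f \<and> Comp C (Id C Y) f = f"
    and "\<And>W X Y Z f g h. f \<in> hom C W X \<Longrightarrow> g \<in> hom C X Y \<Longrightarrow> h \<in> hom C Y Z \<Longrightarrow>
      Comp C h (Comp C g f) = Comp C (Comp C h g) f"
  shows "category C"
  using assms unfolding category_def hom_def by auto

context
  fixes C :: "('o, 'm) cat"
  assumes C: "category C"
begin

lemma hom_ob: "f \<in> hom C X Y \<Longrightarrow> X \<in> Ob C \<and> Y \<in> Ob C"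
  using C by (auto simp: category_def hom_def)

lemma id_in: "X \<in> Ob C \<Longrightarrow> Id C X \<in> hom C X X"
  using C by (auto simp: category_def)

lemma comp_in: "f \<in> hom C X Y \<Longrightarrow> g \<in> hom C Y Z \<Longrightarrow> Comp C g f \<in> hom C X Z"
  using C by (auto simp: category_def hom_def)

lemma comp_id: "f \<in> hom C X Y \<Longrightarrow> Comp C f (Id C X) = f"
  and id_comp: "f \<in> hom C X Y \<Longrightarrow> Comp C (Id C Y) f = f"
  using C by (auto simp: category_def hom_def)

lemma id_id: "X \<in> Ob C \<Longrightarrow> Comp C (Id C X) (Id C X) = Id C X"
  by (rule comp_id[OF id_in])

lemma comp_assoc: "f \<in> hom C W X \<Longrightarrow> g \<in> hom C X Y \<Longrightarrow> h \<in> hom C Y Z \<Longrightarrow>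
    Comp C (Comp C h g) f = Comp C h (Comp C g f)"
  using C by (auto simp: category_def hom_def)

text \<open>Identities embed the objects into the arrows, so a bound on the arrows of a scheme, as
  in \<open>filtered\<close>, also bounds its objects.\<close>

lemma card_Ob: "|Arr C| <o r \<Longrightarrow> |Ob C| <o r"
  by (rule lt_inj_on[where f = "Id C"], assumption)
    (use id_in in \<open>force simp: hom_def intro: inj_on_inverseI[where g = "Dom C"]\<close>)+

end

lemma is_functorI:
  assumes "\<And>X. X \<in> Ob C \<Longrightarrow> omap F X \<in> Ob D"
    and "\<And>X Y f. f \<in> hom C X Y \<Longrightarrow> amap F f \<in> hom D (omap F X) (omap F Y)"
    and "\<And>X. X \<in> Ob C \<Longrightarrow> amap F (Id C X) = Id D (omap F X)"
    and "\<And>X Y Z f g. f \<in> hom C X Y \<Longrightarrow> g \<in> hom C Y Z \<Longrightarrow>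
      amap F (Comp C g f) = Comp D (amap F g) (amap F f)"
  shows "is_functor C D F"
  using assms unfolding is_functor_def hom_def by auto

context
  fixes C :: "('o, 'm) cat" and D :: "('p, 'n) cat" and F
  assumes F: "is_functor C D F"
begin

lemma functor_ob: "X \<in> Ob C \<Longrightarrow> omap F X \<in> Ob D"
  using F by (auto simp: is_functor_def)

lemma functor_hom: "f \<in> hom C X Y \<Longrightarrow> amap F f \<in> hom D (omap F X) (omap F Y)"
  using F by (auto simp: is_functor_def hom_def)

lemma functor_id: "X \<in> Ob C \<Longrightarrow> amap F (Id C X) = Id D (omap F X)"
  using F by (auto simp: is_functor_def)

lemma functor_comp: "f \<in> hom C X Y \<Longrightarrow> g \<in> hom C Y Z \<Longrightarrow>
    amap F (Comp C g f) = Comp D (amap F g) (amap F f)"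
  using F by (auto simp: is_functor_def hom_def)

end

lemma comp_functor_functor:
  assumes F: "is_functor C D F" and G: "is_functor D E G"
  shows "is_functor C E (comp_functor G F)"
proof (rule is_functorI)
  show "amap (comp_functor G F) (Comp C g f) =
      Comp E (amap (comp_functor G F) g) (amap (comp_functor G F) f)"
    if "f \<in> hom C X Y" "g \<in> hom C Y Z" for X Y Z f g
    using functor_comp[OF F that] functor_comp[OF G functor_hom[OF F that(1)] functor_hom[OF F that(2)]]
    by (simp add: comp_functor_def)
qed (simp_all add: comp_functor_def functor_ob[OF F] functor_ob[OF G] functor_hom[OF F]
    functor_hom[OF G] functor_id[OF F] functor_id[OF G])

text \<open>Functors are records of total functions with arbitrary values off the category, so
  functors that agree on the category may still be different records. The identities form an
  isomorphism between them.\<close>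

lemma naturally_isomorphic_eqI:
  assumes C: "category C" and D: "category D" and F: "is_functor C D F"
    and ob: "\<And>X. X \<in> Ob C \<Longrightarrow> omap G X = omap F X"
    and arr: "\<And>X Y f. f \<in> hom C X Y \<Longrightarrow> amap G f = amap F f"
  shows "naturally_isomorphic C D F G" "naturally_isomorphic C D G F"
proof -
  let ?\<alpha> = "\<lambda>X. Id D (omap F X)"
  have fg: "amap G f = amap F f" if "f \<in> Arr C" for f
    using arr[of f "Dom C f" "Cod C f"] that by (simp add: hom_def)
  have dc: "Dom C f \<in> Ob C" "Cod C f \<in> Ob C" if "f \<in> Arr C" for f
    using C that by (simp_all add: category_def)
  have Ff: "amap F f \<in> hom D (omap F (Dom C f)) (omap F (Cod C f))" if "f \<in> Arr C" for f
    by (rule functor_hom[OF F]) (use that in \<open>simp add: hom_def\<close>)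
  have 1: "nat_trans C D F G ?\<alpha>" "nat_trans C D G F ?\<alpha>"
    unfolding nat_trans_def
    by (simp_all add: ob id_in[OF D functor_ob[OF F]] fg comp_id[OF D Ff] id_comp[OF D Ff])
  have 2: "\<forall>X\<in>Ob C. Comp D (?\<alpha> X) (?\<alpha> X) = Id D (omap F X)"
    by (simp add: id_id[OF D functor_ob[OF F]])
  show "naturally_isomorphic C D F G" "naturally_isomorphic C D G F"
    unfolding naturally_isomorphic_def
    by (rule exI[of _ ?\<alpha>], rule exI[of _ ?\<alpha>], use 1 2 ob in simp)+
qed

lemma id_functor_functor: "category D \<Longrightarrow> is_functor D D id_functor"
  by (rule is_functorI) (simp_all add: id_functor_def)

lemma coconeI:
  assumes "c \<in> Ob C" "\<And>i. i \<in> Ob J \<Longrightarrow> \<tau> i \<in> hom C (omap D i) c"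
    and "\<And>i j a. a \<in> hom J i j \<Longrightarrow> Comp C (\<tau> j) (amap D a) = \<tau> i"
  shows "cocone C J D c \<tau>"
  using assms by (simp add: cocone_def hom_def)

lemma cocone_ob: "cocone C J D c \<tau> \<Longrightarrow> c \<in> Ob C"
  and cocone_hom: "cocone C J D c \<tau> \<Longrightarrow> i \<in> Ob J \<Longrightarrow> \<tau> i \<in> hom C (omap D i) c"
  and cocone_comp: "cocone C J D c \<tau> \<Longrightarrow> a \<in> hom J i j \<Longrightarrow> Comp C (\<tau> j) (amap D a) = \<tau> i"
  by (auto simp: cocone_def hom_def)

lemma cocone_after:
  assumes C: "category C" and D: "is_functor J C D" and J: "category J"
    and \<tau>: "cocone C J D c \<tau>" and h: "h \<in> hom C c c'"
  shows "cocone C J D c' (\<lambda>i. Comp C h (\<tau> i))"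
proof (rule coconeI)
  show "c' \<in> Ob C" using hom_ob[OF C h] by simp
  show "Comp C h (\<tau> i) \<in> hom C (omap D i) c'" if "i \<in> Ob J" for i
    using comp_in[OF C cocone_hom[OF \<tau> that] h] .
  show "Comp C (Comp C h (\<tau> j)) (amap D a) = Comp C h (\<tau> i)" if a: "a \<in> hom J i j" for i j a
    using comp_assoc[OF C functor_hom[OF D a] cocone_hom[OF \<tau>] h] hom_ob[OF J a]
      cocone_comp[OF \<tau> a] by simp
qed

lemma colimitI:
  assumes "cocone C J D c \<tau>"
    and "\<And>c' \<tau>'. cocone C J D c' \<tau>' \<Longrightarrow> \<exists>h\<in>hom C c c'. \<forall>i\<in>Ob J. Comp C h (\<tau> i) = \<tau>' i"
    and "\<And>c' h k. h \<in> hom C c c' \<Longrightarrow> k \<in> hom C c c' \<Longrightarrow>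
      (\<And>i. i \<in> Ob J \<Longrightarrow> Comp C h (\<tau> i) = Comp C k (\<tau> i)) \<Longrightarrow> h = k"
  shows "colimit C J D c \<tau>"
  unfolding colimit_def
proof (intro conjI allI impI)
  fix c' \<tau>' assume "cocone C J D c' \<tau>'"
  from assms(2)[OF this] obtain h where h: "h \<in> hom C c c'" "\<forall>i\<in>Ob J. Comp C h (\<tau> i) = \<tau>' i" by blast
  show "\<exists>!h. h \<in> hom C c c' \<and> (\<forall>i\<in>Ob J. Comp C h (\<tau> i) = \<tau>' i)"
  proof (rule ex1I[of _ h])
    fix k assume "k \<in> hom C c c' \<and> (\<forall>i\<in>Ob J. Comp C k (\<tau> i) = \<tau>' i)"
    then show "k = h" by (intro assms(3)[OF _ h(1)]) (simp_all add: h(2))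
  qed (use h in simp)
qed fact

lemma colimit_cocone: "colimit C J D c \<tau> \<Longrightarrow> cocone C J D c \<tau>"
  by (simp add: colimit_def)

lemma colimit_factor:
  assumes "colimit C J D c \<tau>" "cocone C J D c' \<tau>'"
  obtains h where "h \<in> hom C c c'" "\<And>i. i \<in> Ob J \<Longrightarrow> Comp C h (\<tau> i) = \<tau>' i"
  using assms unfolding colimit_def by blast

lemma colimit_eq:
  assumes C: "category C" and J: "category J" and D: "is_functor J C D" and c: "colimit C J D c \<tau>"
    and h: "h \<in> hom C c c'" and k: "k \<in> hom C c c'"
    and eq: "\<And>i. i \<in> Ob J \<Longrightarrow> Comp C h (\<tau> i) = Comp C k (\<tau> i)"
  shows "h = k"
proof -
  have "cocone C J D c' (\<lambda>i. Comp C h (\<tau> i))" by (rule cocone_after[OF C D J colimit_cocone[OF c] h])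
  then show ?thesis using c h k eq unfolding colimit_def by metis
qed

text \<open>In contrast to \<open>colimit_eq\<close>, the common composite is supplied as a cocone
  and category laws are not invoked, so this form applies directly to colimits in
  \<open>set_cat\<close>.\<close>

lemma colimit_eq':
  assumes "colimit C J D c \<tau>" "cocone C J D c' \<tau>'"
    and "h \<in> hom C c c'" "\<forall>i\<in>Ob J. Comp C h (\<tau> i) = \<tau>' i"
    and "k \<in> hom C c c'" "\<forall>i\<in>Ob J. Comp C k (\<tau> i) = \<tau>' i"
  shows "h = k"
proof -
  have "\<exists>!x. x \<in> hom C c c' \<and> (\<forall>i\<in>Ob J. Comp C x (\<tau> i) = \<tau>' i)"
    using assms(1,2) by (simp add: colimit_def)
  then obtain x where "\<And>y. y \<in> hom C c c' \<and> (\<forall>i\<in>Ob J. Comp C y (\<tau> i) = \<tau>' i) \<Longrightarrow> y = x"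
    by (elim ex1E) metis
  from this[of h] this[of k] show ?thesis using assms(3-6) by simp
qed

lemma colimit_cong:
  assumes J: "category J" and c: "colimit C J D c \<tau>" and eq: "\<And>i. i \<in> Ob J \<Longrightarrow> \<tau>' i = \<tau> i"
  shows "colimit C J D c \<tau>'"
proof -
  have "Dom J a \<in> Ob J \<and> Cod J a \<in> Ob J" if "a \<in> Arr J" for a
    using J that by (simp add: category_def)
  then show ?thesis using c by (simp add: colimit_def cocone_def eq cong: ball_cong)
qed

lemma colimit_unique:
  assumes C: "category C" and J: "category J" and D: "is_functor J C D"
    and c: "colimit C J D c \<tau>" and c': "colimit C J D c' \<tau>'"
  obtains h k where "h \<in> hom C c c'" "k \<in> hom C c' c" "Comp C k h = Id C c" "Comp C h k = Id C c'"
    "\<And>i. i \<in> Ob J \<Longrightarrow> Comp C h (\<tau> i) = \<tau>' i"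
proof -
  note cc = colimit_cocone[OF c] and cc' = colimit_cocone[OF c']
  obtain h where h: "h \<in> hom C c c'" "\<And>i. i \<in> Ob J \<Longrightarrow> Comp C h (\<tau> i) = \<tau>' i"
    using colimit_factor[OF c cc'] by blast
  obtain k where k: "k \<in> hom C c' c" "\<And>i. i \<in> Ob J \<Longrightarrow> Comp C k (\<tau>' i) = \<tau> i"
    using colimit_factor[OF c' cc] by blast
  have 1: "Comp C (Comp C k h) (\<tau> i) = Comp C (Id C c) (\<tau> i)" if "i \<in> Ob J" for i
    using comp_assoc[OF C cocone_hom[OF cc that] h(1) k(1)] h(2) k(2) that
      id_comp[OF C cocone_hom[OF cc that]] by simp
  have 2: "Comp C (Comp C h k) (\<tau>' i) = Comp C (Id C c') (\<tau>' i)" if "i \<in> Ob J" for i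
    using comp_assoc[OF C cocone_hom[OF cc' that] k(1) h(1)] h(2) k(2) that
      id_comp[OF C cocone_hom[OF cc' that]] by simp
  have "Comp C k h = Id C c"
    by (rule colimit_eq[OF C J D c comp_in[OF C h(1) k(1)] id_in[OF C cocone_ob[OF cc]] 1])
  moreover have "Comp C h k = Id C c'"
    by (rule colimit_eq[OF C J D c' comp_in[OF C k(1) h(1)] id_in[OF C cocone_ob[OF cc']] 2])
  ultimately show thesis using that h k by blast
qed

lemma colimit_iso:
  assumes C: "category C" and J: "category J" and D: "is_functor J C D"
    and c: "colimit C J D c \<tau>" and h: "h \<in> hom C c c'" and k: "k \<in> hom C c' c"
    and kh: "Comp C k h = Id C c" and hk: "Comp C h k = Id C c'"
  shows "colimit C J D c' (\<lambda>i. Comp C h (\<tau> i))"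
proof (rule colimitI)
  note cc = colimit_cocone[OF c]
  show "cocone C J D c' (\<lambda>i. Comp C h (\<tau> i))" by (rule cocone_after[OF C D J cc h])
  fix d assume "cocone C J D d \<sigma>" for \<sigma>
next
  fix d \<sigma> assume "cocone C J D d \<sigma>"
  then obtain x where x: "x \<in> hom C c d" "\<And>i. i \<in> Ob J \<Longrightarrow> Comp C x (\<tau> i) = \<sigma> i"
    using colimit_factor[OF c] by blast
  have "Comp C (Comp C x k) (Comp C h (\<tau> i)) = \<sigma> i" if i: "i \<in> Ob J" for i
  proof -
    note t = cocone_hom[OF colimit_cocone[OF c] i]
    have "Comp C (Comp C x k) (Comp C h (\<tau> i)) = Comp C x (Comp C (Comp C k h) (\<tau> i))"
      by (simp add: comp_assoc[OF C comp_in[OF C t h] k x(1)] comp_assoc[OF C t h k])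
    then show ?thesis by (simp add: kh id_comp[OF C t] x(2)[OF i])
  qed
  then show "\<exists>y\<in>hom C c' d. \<forall>i\<in>Ob J. Comp C y (Comp C h (\<tau> i)) = \<sigma> i"
    using comp_in[OF C k x(1)] by blast
next
  fix d x y assume x: "x \<in> hom C c' d" and y: "y \<in> hom C c' d"
    and eq: "\<And>i. i \<in> Ob J \<Longrightarrow> Comp C x (Comp C h (\<tau> i)) = Comp C y (Comp C h (\<tau> i))"
  have "Comp C x h = Comp C y h"
  proof (rule colimit_eq[OF C J D c comp_in[OF C h x] comp_in[OF C h y]])
    fix i assume i: "i \<in> Ob J"
    note t = cocone_hom[OF colimit_cocone[OF c] i]
    show "Comp C (Comp C x h) (\<tau> i) = Comp C (Comp C y h) (\<tau> i)"
      using eq[OF i] by (simp add: comp_assoc[OF C t h x] comp_assoc[OF C t h y])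
  qed
  then have "Comp C (Comp C x h) k = Comp C (Comp C y h) k" by simp
  then show "x = y"
    by (simp add: comp_assoc[OF C k h x] comp_assoc[OF C k h y] hk comp_id[OF C x] comp_id[OF C y])
qed


subsection \<open>Renaming the objects and arrows of a diagram scheme\<close>

text \<open>Cocompleteness, \<open>filtered\<close> and \<open>presentable\<close> quantify over
  schemes on the universe type only. Small schemes on other types are moved there along injections;
  the inverses below are meaningful only on the image.\<close>

definition transport_cat :: "('i \<Rightarrow> 'u) \<Rightarrow> ('j \<Rightarrow> 'v) \<Rightarrow> ('i, 'j) cat \<Rightarrow> ('u, 'v) cat" where
  "transport_cat e e' S = \<lparr>Ob = e ` Ob S, Arr = e' ` Arr S,
     Dom = (\<lambda>a. e (Dom S (inv_into (Arr S) e' a))),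
     Cod = (\<lambda>a. e (Cod S (inv_into (Arr S) e' a))),
     Id = (\<lambda>x. e' (Id S (inv_into (Ob S) e x))),
     Comp = (\<lambda>b a. e' (Comp S (inv_into (Arr S) e' b) (inv_into (Arr S) e' a)))\<rparr>"

definition transport_functor ::
  "('i \<Rightarrow> 'u) \<Rightarrow> ('j \<Rightarrow> 'v) \<Rightarrow> ('i, 'j) cat \<Rightarrow> ('i, 'j, 'o, 'm) fctr \<Rightarrow> ('u, 'v, 'o, 'm) fctr" where
  "transport_functor e e' S D =
     \<lparr>omap = (\<lambda>x. omap D (inv_into (Ob S) e x)), amap = (\<lambda>a. amap D (inv_into (Arr S) e' a))\<rparr>"

context
  fixes e :: "'i \<Rightarrow> 'u" and e' :: "'j \<Rightarrow> 'v" and S :: "('i, 'j) cat"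
  assumes S: "category S" and e: "inj_on e (Ob S)" and e': "inj_on e' (Arr S)"
begin

private abbreviation "S' \<equiv> transport_cat e e' S"

lemma transport_sel:
  "Ob S' = e ` Ob S" "Arr S' = e' ` Arr S"
  "a \<in> Arr S \<Longrightarrow> Dom S' (e' a) = e (Dom S a)"
  "a \<in> Arr S \<Longrightarrow> Cod S' (e' a) = e (Cod S a)"
  "x \<in> Ob S \<Longrightarrow> Id S' (e x) = e' (Id S x)"
  "a \<in> Arr S \<Longrightarrow> b \<in> Arr S \<Longrightarrow> Comp S' (e' b) (e' a) = e' (Comp S b a)"
  "x \<in> Ob S \<Longrightarrow> omap (transport_functor e e' S D) (e x) = omap D x"
  "a \<in> Arr S \<Longrightarrow> amap (transport_functor e e' S D) (e' a) = amap D a"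
  using e e' by (simp_all add: transport_cat_def transport_functor_def)

lemma transport_hom_in: "a \<in> hom S x y \<Longrightarrow> e' a \<in> hom S' (e x) (e y)"
  by (auto simp: hom_def transport_sel)

lemma transport_homE:
  assumes "b \<in> hom S' x' y'"
  obtains a x y where "x \<in> Ob S" "y \<in> Ob S" "a \<in> hom S x y" "x' = e x" "y' = e y" "b = e' a"
  using assms S by (auto simp: hom_def transport_sel category_def)

lemma transport_homE':
  assumes "b \<in> hom S' (e x) (e y)" "x \<in> Ob S" "y \<in> Ob S"
  obtains a where "a \<in> hom S x y" "b = e' a"
  using assms e by (elim transport_homE) (auto dest: inj_onD)

lemma transport_category: "category S'"
proof (rule categoryI)
  fix f assume "f \<in> Arr S'"
  then show "Dom S' f \<in> Ob S' \<and> Cod S' f \<in> Ob S'"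
    using S by (auto simp: transport_sel category_def)
next
  fix X assume "X \<in> Ob S'"
  then obtain x where x: "X = e x" "x \<in> Ob S" by (auto simp: transport_sel)
  then show "Id S' X \<in> hom S' X X"
    using transport_hom_in[OF id_in[OF S x(2)]] by (simp add: transport_sel)
next
  fix X Y Z f g assume "f \<in> hom S' X Y" "g \<in> hom S' Y Z"
  then obtain x y f0 where f: "x \<in> Ob S" "y \<in> Ob S" "f0 \<in> hom S x y" "X = e x" "Y = e y" "f = e' f0"
    and g: "g \<in> hom S' (e y) Z" by (elim transport_homE[of f]) simp
  from g obtain z g0 where g: "z \<in> Ob S" "g0 \<in> hom S y z" "Z = e z" "g = e' g0"
    using f(2) e by (elim transport_homE[of g]) (auto dest: inj_onD)
  have "f0 \<in> Arr S" "g0 \<in> Arr S" using f g by (simp_all add: hom_def)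
  then show "Comp S' g f \<in> hom S' X Z"
    using transport_hom_in[OF comp_in[OF S f(3) g(2)]] by (simp add: f g transport_sel)
next
  fix X Y f assume "f \<in> hom S' X Y"
  then obtain x y f0 where f: "x \<in> Ob S" "y \<in> Ob S" "f0 \<in> hom S x y" "X = e x" "Y = e y" "f = e' f0"
    by (elim transport_homE[of f]) simp
  have "f0 \<in> Arr S" "Id S x \<in> Arr S" "Id S y \<in> Arr S"
    using f id_in[OF S f(1)] id_in[OF S f(2)] by (simp_all add: hom_def)
  then show "Comp S' f (Id S' X) = f \<and> Comp S' (Id S' Y) f = f"
    using comp_id[OF S f(3)] id_comp[OF S f(3)] by (simp add: f transport_sel)
next
  fix W X Y Z f g h assume "f \<in> hom S' W X" and g: "g \<in> hom S' X Y" and h: "h \<in> hom S' Y Z"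
  then obtain w x f0 where f: "w \<in> Ob S" "x \<in> Ob S" "f0 \<in> hom S w x" "W = e w" "X = e x" "f = e' f0"
    by (elim transport_homE[of f]) simp
  from g obtain y g0 where g: "y \<in> Ob S" "g0 \<in> hom S x y" "Y = e y" "g = e' g0"
    using f(2,5) e by (elim transport_homE[of g]) (auto dest: inj_onD)
  from h obtain z h0 where h: "z \<in> Ob S" "h0 \<in> hom S y z" "Z = e z" "h = e' h0"
    using g(1,3) e by (elim transport_homE[of h]) (auto dest: inj_onD)
  have "f0 \<in> Arr S" "g0 \<in> Arr S" "h0 \<in> Arr S" "Comp S g0 f0 \<in> Arr S" "Comp S h0 g0 \<in> Arr S"
    using f g h comp_in[OF S f(3) g(2)] comp_in[OF S g(2) h(2)] by (simp_all add: hom_def)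
  then show "Comp S' h (Comp S' g f) = Comp S' (Comp S' h g) f"
    using comp_assoc[OF S f(3) g(2) h(2)] by (simp add: f g h transport_sel)
qed

lemma transport_is_functor:
  assumes D: "is_functor S C D"
  shows "is_functor S' C (transport_functor e e' S D)" (is "is_functor _ _ ?D")
proof (rule is_functorI)
  show "omap ?D X \<in> Ob C" if "X \<in> Ob S'" for X
    using that functor_ob[OF D] by (auto simp: transport_sel)
  show "amap ?D f \<in> hom C (omap ?D X) (omap ?D Y)" if f: "f \<in> hom S' X Y" for X Y f
    using f functor_hom[OF D] by (elim transport_homE) (auto simp: transport_sel hom_def)
  show "amap ?D (Id S' X) = Id C (omap ?D X)" if "X \<in> Ob S'" for X
    using that functor_id[OF D] id_in[OF S] by (auto simp: transport_sel hom_def)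
  fix X Y Z f g assume "f \<in> hom S' X Y" "g \<in> hom S' Y Z"
  then obtain x y f0 where f: "x \<in> Ob S" "y \<in> Ob S" "f0 \<in> hom S x y" "X = e x" "Y = e y" "f = e' f0"
    and g: "g \<in> hom S' (e y) Z" by (elim transport_homE[of f]) simp
  from g obtain z g0 where g: "z \<in> Ob S" "g0 \<in> hom S y z" "Z = e z" "g = e' g0"
    using f(2) e by (elim transport_homE[of g]) (auto dest: inj_onD)
  have "f0 \<in> Arr S" "g0 \<in> Arr S" "Comp S g0 f0 \<in> Arr S"
    using f g comp_in[OF S f(3) g(2)] by (simp_all add: hom_def)
  then show "amap ?D (Comp S' g f) = Comp C (amap ?D g) (amap ?D f)"
    using functor_comp[OF D f(3) g(2)] by (simp add: f g transport_sel)
qed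

lemma transport_cocone:
  "cocone C S' (transport_functor e e' S D) c \<tau> \<longleftrightarrow> cocone C S D c (\<lambda>x. \<tau> (e x))"
  using S unfolding cocone_def by (auto simp: transport_sel category_def)

lemma transport_cocone':
  "cocone C S D c \<tau> \<longleftrightarrow> cocone C S' (transport_functor e e' S D) c (\<lambda>x. \<tau> (inv_into (Ob S) e x))"
  using S unfolding cocone_def by (auto simp: transport_sel category_def e)

lemma transport_colimit:
  assumes c: "colimit C S' (transport_functor e e' S D) c \<tau>"
  shows "colimit C S D c (\<lambda>x. \<tau> (e x))"
  unfolding colimit_def
proof (intro conjI allI impI)
  show "cocone C S D c (\<lambda>x. \<tau> (e x))" using colimit_cocone[OF c] by (simp add: transport_cocone)
  fix c' \<tau>' assume "cocone C S D c' \<tau>'"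
  then have "cocone C S' (transport_functor e e' S D) c' (\<lambda>x. \<tau>' (inv_into (Ob S) e x))"
    by (simp add: transport_cocone'[symmetric])
  then have "\<exists>!h. h \<in> hom C c c' \<and> (\<forall>i\<in>Ob S'. Comp C h (\<tau> i) = \<tau>' (inv_into (Ob S) e i))"
    using c by (simp add: colimit_def)
  then show "\<exists>!h. h \<in> hom C c c' \<and> (\<forall>i\<in>Ob S. Comp C h (\<tau> (e i)) = \<tau>' i)"
    by (simp add: transport_sel e)
qed

lemma transport_colimit':
  assumes c: "colimit C S D c \<tau>"
  shows "colimit C S' (transport_functor e e' S D) c (\<lambda>x. \<tau> (inv_into (Ob S) e x))"
  unfolding colimit_def
proof (intro conjI allI impI)
  show "cocone C S' (transport_functor e e' S D) c (\<lambda>x. \<tau> (inv_into (Ob S) e x))"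
    using colimit_cocone[OF c] by (simp add: transport_cocone'[symmetric])
  fix c' \<tau>' assume "cocone C S' (transport_functor e e' S D) c' \<tau>'"
  then have "\<exists>!h. h \<in> hom C c c' \<and> (\<forall>i\<in>Ob S. Comp C h (\<tau> i) = \<tau>' (e i))"
    using c by (simp add: colimit_def transport_cocone)
  then show "\<exists>!h. h \<in> hom C c c' \<and> (\<forall>i\<in>Ob S'. Comp C h (\<tau> (inv_into (Ob S) e i)) = \<tau>' i)"
    by (simp add: transport_sel e)
qed

end

lemma cocomplete_colimit:
  assumes "cocomplete (U :: 'u itself) C" and S: "small_category U S" and D: "is_functor S C D"
  obtains c \<tau> where "colimit C S D c \<tau>"
proof -
  obtain e :: "_ \<Rightarrow> 'u" where e: "inj_on e (Ob S)"
    using S unfolding small_category_def by (blast elim: small_embed)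
  obtain e' :: "_ \<Rightarrow> 'u" where e': "inj_on e' (Arr S)"
    using S unfolding small_category_def by (blast elim: small_embed)
  have "category S" using S by (simp add: small_category_def)
  note tr = this e e'
  have "small_category U (transport_cat e e' S)"
    using S transport_category[OF tr] by (simp add: small_category_def transport_sel[OF tr] small_image)
  then obtain c \<tau> where "colimit C (transport_cat e e' S) (transport_functor e e' S D) c \<tau>"
    using assms(1) transport_is_functor[OF tr D] unfolding cocomplete_def by blast
  from transport_colimit[OF tr this] show thesis by (rule that)
qed


section \<open>Filtered categories\<close>

definition disc_cat :: "'i set \<Rightarrow> ('i, 'i) cat" where
  "disc_cat I = \<lparr>Ob = I, Arr = I, Dom = (\<lambda>i. i), Cod = (\<lambda>i. i), Id = (\<lambda>i. i), Comp = (\<lambda>g f. f)\<rparr>"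

definition disc_functor :: "('o, 'm) cat \<Rightarrow> ('i \<Rightarrow> 'o) \<Rightarrow> ('i, 'i, 'o, 'm) fctr" where
  "disc_functor C d = \<lparr>omap = d, amap = (\<lambda>i. Id C (d i))\<rparr>"

lemma disc_category: "category (disc_cat I)"
  by (rule categoryI) (auto simp: disc_cat_def hom_def)

lemma disc_is_functor: "category C \<Longrightarrow> d \<in> I \<rightarrow> Ob C \<Longrightarrow> is_functor (disc_cat I) C (disc_functor C d)"
  using id_in[of C] comp_id[of C, OF _ id_in]
  by (intro is_functorI) (auto simp: disc_cat_def disc_functor_def hom_def Pi_iff)

lemma disc_cocone:
  assumes "category C"
  shows "cocone C (disc_cat I) (disc_functor C d) c \<tau> \<longleftrightarrow> c \<in> Ob C \<and> (\<forall>i\<in>I. \<tau> i \<in> hom C (d i) c)"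
  using assms by (auto simp: cocone_def disc_cat_def disc_functor_def comp_id)

text \<open>A set \<open>H\<close> of arrows from \<open>False\<close> to \<open>True\<close>
  instead of a pair, because \<open>r\<close>-filteredness must make fewer than \<open>r\<close>
  parallel arrows equal at once. \<open>Inl\<close> gives the two identities.\<close>

definition par_cat :: "'h set \<Rightarrow> (bool, bool + 'h) cat" where
  "par_cat H = \<lparr>Ob = UNIV, Arr = range Inl \<union> Inr ` H,
     Dom = (\<lambda>a. case a of Inl b \<Rightarrow> b | Inr _ \<Rightarrow> False), Cod = (\<lambda>a. case a of Inl b \<Rightarrow> b | Inr _ \<Rightarrow> True),
     Id = Inl, Comp = (\<lambda>b a. case b of Inl _ \<Rightarrow> a | Inr _ \<Rightarrow> b)\<rparr>"

definition par_functor :: "('o, 'm) cat \<Rightarrow> 'o \<Rightarrow> 'o \<Rightarrow> (bool, bool + 'm, 'o, 'm) fctr" where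
  "par_functor C X Y = \<lparr>omap = (\<lambda>b. if b then Y else X),
     amap = (\<lambda>a. case a of Inl b \<Rightarrow> Id C (if b then Y else X) | Inr h \<Rightarrow> h)\<rparr>"

lemma par_category: "category (par_cat H)"
  by (rule categoryI) (auto simp: par_cat_def hom_def split: sum.splits)

lemma par_is_functor:
  assumes C: "category C" and XY: "X \<in> Ob C" "Y \<in> Ob C" "H \<subseteq> hom C X Y"
  shows "is_functor (par_cat H) C (par_functor C X Y)"
proof (rule is_functorI)
  show "amap (par_functor C X Y) f \<in> hom C (omap (par_functor C X Y) a) (omap (par_functor C X Y) b)"
    if "f \<in> hom (par_cat H) a b" for a b f
    using that XY id_in[OF C] by (auto simp: par_cat_def par_functor_def hom_def split: sum.splits if_splits)
  show "amap (par_functor C X Y) (Comp (par_cat H) g f) =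
      Comp C (amap (par_functor C X Y) g) (amap (par_functor C X Y) f)"
    if "f \<in> hom (par_cat H) a b" "g \<in> hom (par_cat H) b c" for a b c f g
    using that XY id_in[OF C] comp_id[OF C] id_comp[OF C]
    by (auto simp: id_id[OF C] par_cat_def par_functor_def hom_def split: sum.splits if_splits)
qed (use XY in \<open>simp_all add: par_cat_def par_functor_def\<close>)

lemma par_cocone:
  assumes C: "category C" and XY: "X \<in> Ob C" "Y \<in> Ob C" "H \<subseteq> hom C X Y"
  shows "cocone C (par_cat H) (par_functor C X Y) c \<tau> \<longleftrightarrow>
    \<tau> False \<in> hom C X c \<and> \<tau> True \<in> hom C Y c \<and> (\<forall>h\<in>H. Comp C (\<tau> True) h = \<tau> False)"
  using XY hom_ob[OF C] comp_id[OF C]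
  by (auto simp: cocone_def par_cat_def par_functor_def UNIV_bool)

text \<open>Equivalent to \<open>filtered\<close>, but also meaningful for schemes that do not live on the universe type.\<close>

definition filt :: "'l rel \<Rightarrow> ('i, 'j) cat \<Rightarrow> bool" where
  "filt r J \<longleftrightarrow> category J \<and>
     (\<forall>T\<subseteq>Ob J. |T| <o r \<longrightarrow> (\<exists>k\<in>Ob J. \<forall>i\<in>T. hom J i k \<noteq> {})) \<and>
     (\<forall>i j H. H \<subseteq> hom J i j \<longrightarrow> |H| <o r \<longrightarrow> j \<in> Ob J \<longrightarrow>
        (\<exists>k z. z \<in> hom J j k \<and> (\<forall>f\<in>H. \<forall>g\<in>H. Comp J z f = Comp J z g)))"

context
  fixes r :: "'l rel" and J :: "('i, 'j) cat"
  assumes J: "filt r J" and r: "regular_cardinal r"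
begin

lemma filt_category: "category J"
  using J by (simp add: filt_def)

lemma filt_bound:
  assumes "\<And>a. a \<in> A \<Longrightarrow> i a \<in> Ob J" "|A| <o r"
  obtains k u where "k \<in> Ob J" "\<And>a. a \<in> A \<Longrightarrow> u a \<in> hom J (i a) k"
proof -
  have "i ` A \<subseteq> Ob J" "|i ` A| <o r" using assms by (auto simp: lt_image)
  then obtain k where k: "k \<in> Ob J" "\<And>a. a \<in> A \<Longrightarrow> hom J (i a) k \<noteq> {}"
    using J unfolding filt_def by (metis imageI)
  then have "\<exists>u. \<forall>a\<in>A. u a \<in> hom J (i a) k" by (intro bchoice) blast
  then show thesis using that k(1) by blast
qed

lemma filt_bound2:
  assumes "i \<in> Ob J" "j \<in> Ob J"
  obtains k u v where "k \<in> Ob J" "u \<in> hom J i k" "v \<in> hom J j k"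
proof -
  have "|UNIV :: bool set| <o r" by (rule lt_finite[OF r]) simp
  note bd = filt_bound[OF _ this, where i = "\<lambda>b. if b then i else j"]
  obtain k u where k: "k \<in> Ob J" "\<And>a. a \<in> UNIV \<Longrightarrow> u a \<in> hom J (if a then i else j) k"
    by (rule bd) (simp add: assms, blast)
  then show thesis using that[OF k(1), of "u True" "u False"] k(2)[of True] k(2)[of False] by simp
qed

lemma filt_coeq:
  assumes "\<And>a. a \<in> A \<Longrightarrow> f a \<in> hom J i j" "|A| <o r" "j \<in> Ob J"
  obtains k z where "z \<in> hom J j k" "\<forall>a\<in>A. \<forall>b\<in>A. Comp J z (f a) = Comp J z (f b)"
proof -
  have coeq: "\<exists>k z. z \<in> hom J j k \<and> (\<forall>f\<in>H. \<forall>g\<in>H. Comp J z f = Comp J z g)"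
    if "H \<subseteq> hom J i j" "|H| <o r" for H
    using J assms(3) that by (simp add: filt_def)
  have "\<exists>k z. z \<in> hom J j k \<and> (\<forall>h\<in>f ` A. \<forall>g\<in>f ` A. Comp J z h = Comp J z g)"
    by (rule coeq) (use assms in \<open>auto simp: lt_image\<close>)
  then obtain k z where "z \<in> hom J j k" "\<forall>h\<in>f ` A. \<forall>g\<in>f ` A. Comp J z h = Comp J z g"
    by (elim exE conjE)
  then show thesis by (intro that[of z k]) blast+
qed

lemma filt_coeq2:
  assumes "f \<in> hom J i j" "g \<in> hom J i j"
  obtains k z where "z \<in> hom J j k" "Comp J z f = Comp J z g"
proof -
  have "|UNIV :: bool set| <o r" by (rule lt_finite[OF r]) simp
  note co = filt_coeq[OF _ this, where f = "\<lambda>b. if b then f else g" and i = i and j = j]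
  have j: "j \<in> Ob J" using hom_ob[OF filt_category assms(1)] by simp
  obtain k z where z: "z \<in> hom J j k" "\<forall>a\<in>UNIV. \<forall>b\<in>UNIV.
      Comp J z (if a then f else g) = Comp J z (if b then f else g)"
    by (rule co) (simp add: assms, rule j, rule that)
  then show thesis using that[OF z(1)] z(2)[rule_format, of True False] by simp
qed

text \<open>Typically each \<open>w a\<close> makes one equation true; \<open>t\<close> then makes
  all of them true, as it passes through every \<open>w a\<close>. The targets get a common bound
  and the composites into it are coequalized. An empty family offers no composite, so it takes the
  identity.\<close>

lemma filt_merge:
  assumes i: "i \<in> Ob J" and w: "\<And>a. a \<in> A \<Longrightarrow> w a \<in> hom J i (k a)" and A: "|A| <o r"
  obtains l t where "t \<in> hom J i l" "\<forall>a\<in>A. \<exists>y\<in>hom J (k a) l. t = Comp J y (w a)"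
proof (cases "A = {}")
  case True
  then show thesis using that[OF id_in[OF filt_category i]] by simp
next
  case False
  then obtain a0 where a0: "a0 \<in> A" by blast
  note C = filt_category
  have "k a \<in> Ob J" if "a \<in> A" for a using hom_ob[OF C w[OF that]] by simp
  from filt_bound[where i = k, OF this A] obtain m y where m: "m \<in> Ob J" and
    y: "\<And>a. a \<in> A \<Longrightarrow> y a \<in> hom J (k a) m" by blast
  have yw: "Comp J (y a) (w a) \<in> hom J i m" if "a \<in> A" for a using comp_in[OF C w[OF that] y[OF that]] .
  obtain l z where z: "z \<in> hom J m l"
    "\<forall>a\<in>A. \<forall>b\<in>A. Comp J z (Comp J (y a) (w a)) = Comp J z (Comp J (y b) (w b))"
    using filt_coeq[where f = "\<lambda>a. Comp J (y a) (w a)", OF yw A m] .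
  show thesis
  proof (rule that)
    show "Comp J z (Comp J (y a0) (w a0)) \<in> hom J i l" using comp_in[OF C yw[OF a0] z(1)] .
    show "\<forall>a\<in>A. \<exists>v\<in>hom J (k a) l. Comp J z (Comp J (y a0) (w a0)) = Comp J v (w a)"
    proof
      fix a assume a: "a \<in> A"
      then have "Comp J z (Comp J (y a0) (w a0)) = Comp J (Comp J z (y a)) (w a)"
        using z(2)[rule_format, OF a0 a] comp_assoc[OF C w[OF a] y[OF a] z(1)] by simp
      then show "\<exists>v\<in>hom J (k a) l. Comp J z (Comp J (y a0) (w a0)) = Comp J v (w a)"
        using comp_in[OF C y[OF a] z(1)] by blast
    qed
  qed
qed

text \<open>A common bound \<open>k\<close> of the objects gives legs that need not commute with the
  arrows. For each arrow the two ways to \<open>k\<close> are coequalized, and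
  \<open>filt_merge\<close> performs these fewer than \<open>r\<close> corrections at once.\<close>

lemma filt_cocone:
  assumes S: "category S" "|Arr S| <o r" and D: "is_functor S J D"
  shows "\<exists>c \<tau>. cocone J S D c \<tau>"
proof -
  note C = filt_category
  obtain k u where k: "k \<in> Ob J" "\<And>s. s \<in> Ob S \<Longrightarrow> u s \<in> hom J (omap D s) k"
    using filt_bound[where i = "omap D", OF functor_ob[OF D] card_Ob[OF S]] by blast
  define f g where "f a = Comp J (u (Cod S a)) (amap D a)" and "g a = u (Dom S a)" for a
  have fg: "f a \<in> hom J (omap D (Dom S a)) k" "g a \<in> hom J (omap D (Dom S a)) k"
    if "a \<in> Arr S" for a
  proof -
    have a: "a \<in> hom S (Dom S a) (Cod S a)" using that by (simp add: hom_def)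
    with hom_ob[OF S(1) a] show "f a \<in> hom J (omap D (Dom S a)) k" "g a \<in> hom J (omap D (Dom S a)) k"
      by (auto simp: f_def g_def intro: comp_in[OF C functor_hom[OF D a] k(2)] k(2))
  qed
  have "\<exists>l z. z \<in> hom J k l \<and> Comp J z (f a) = Comp J z (g a)" if "a \<in> Arr S" for a
    using filt_coeq2[OF fg[OF that]] by blast
  then obtain l z where z: "\<And>a. a \<in> Arr S \<Longrightarrow> z a \<in> hom J k (l a)"
    "\<And>a. a \<in> Arr S \<Longrightarrow> Comp J (z a) (f a) = Comp J (z a) (g a)"
    by metis
  from filt_merge[where w = z and k = l, OF k(1) z(1) S(2)] obtain m t where t: "t \<in> hom J k m"
    "\<forall>a\<in>Arr S. \<exists>y\<in>hom J (l a) m. t = Comp J y (z a)" .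
  have "cocone J S D m (\<lambda>s. Comp J t (u s))"
  proof (rule coconeI)
    show "m \<in> Ob J" using hom_ob[OF C t(1)] by simp
    show "Comp J t (u s) \<in> hom J (omap D s) m" if "s \<in> Ob S" for s using comp_in[OF C k(2)[OF that] t(1)] .
    fix i j a assume a: "a \<in> hom S i j"
    then have a': "a \<in> Arr S" "Dom S a = i" "Cod S a = j" by (simp_all add: hom_def)
    obtain y where y: "y \<in> hom J (l a) m" "t = Comp J y (z a)" using t(2) a'(1) by blast
    have "Comp J t (f a) = Comp J y (Comp J (z a) (f a))"
      unfolding y(2) by (rule comp_assoc[OF C fg(1)[OF a'(1)] z(1)[OF a'(1)] y(1)])
    also have "\<dots> = Comp J y (Comp J (z a) (g a))" using z(2)[OF a'(1)] by simp
    also have "\<dots> = Comp J t (g a)"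
      unfolding y(2) by (rule comp_assoc[OF C fg(2)[OF a'(1)] z(1)[OF a'(1)] y(1), symmetric])
    finally show "Comp J (Comp J t (u j)) (amap D a) = Comp J t (u i)"
      using comp_assoc[OF C functor_hom[OF D a] k(2) t(1)] hom_ob[OF S(1) a] by (simp add: f_def g_def a')
  qed
  then show ?thesis by blast
qed

lemma filt_transport:
  assumes e: "inj_on e (Ob J)" and e': "inj_on e' (Arr J)"
  shows "filt r (transport_cat e e' J)" (is "filt r ?J")
proof -
  note C = filt_category
  note tr = C e e'
  show ?thesis
    unfolding filt_def
  proof (intro conjI allI impI)
    show "category ?J" by (rule transport_category[OF tr])
    fix T assume T: "T \<subseteq> Ob ?J" "|T| <o r"
    have "inv_into (Ob J) e i \<in> Ob J" if "i \<in> T" for i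
      using T(1) that by (auto simp: transport_sel[OF tr] e)
    from filt_bound[where i = "inv_into (Ob J) e", OF this T(2)] obtain k u where
      k: "k \<in> Ob J" "\<And>i. i \<in> T \<Longrightarrow> u i \<in> hom J (inv_into (Ob J) e i) k" by blast
    have "e' (u i) \<in> hom ?J i (e k)" if "i \<in> T" for i
    proof -
      have "e (inv_into (Ob J) e i) = i" using T(1) that by (auto simp: transport_sel[OF tr] e)
      then show ?thesis using transport_hom_in[OF tr k(2)[OF that]] by simp
    qed
    then show "\<exists>k\<in>Ob ?J. \<forall>i\<in>T. hom ?J i k \<noteq> {}" using k(1) by (auto simp: transport_sel[OF tr])
  next
    fix i j H assume H: "H \<subseteq> hom ?J i j" "|H| <o r" and j: "j \<in> Ob ?J"
    obtain j0 where j0: "j0 \<in> Ob J" "j = e j0" using j by (auto simp: transport_sel[OF tr])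
    show "\<exists>k z. z \<in> hom ?J j k \<and> (\<forall>f\<in>H. \<forall>g\<in>H. Comp ?J z f = Comp ?J z g)"
    proof (cases "H = {}")
      case True
      then show ?thesis using id_in[OF transport_category[OF tr] j] by blast
    next
      case False
      then obtain i0 where i0: "i0 \<in> Ob J" "i = e i0"
        using H(1) by (metis equals0I subsetD transport_homE[OF tr])
      let ?f = "inv_into (Arr J) e'"
      have f: "?f h \<in> hom J i0 j0" "e' (?f h) = h" "?f h \<in> Arr J" if h: "h \<in> H" for h
      proof -
        have "h \<in> hom ?J (e i0) (e j0)" using H(1) h i0 j0 by blast
        then obtain a where a: "a \<in> hom J i0 j0" "h = e' a" using transport_homE'[OF tr] i0 j0 by blast
        moreover have "a \<in> Arr J" using a by (simp add: hom_def)
        ultimately show "?f h \<in> hom J i0 j0" "e' (?f h) = h" "?f h \<in> Arr J" by (simp_all add: e')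
      qed
      obtain k z where z: "z \<in> hom J j0 k"
        "\<forall>a\<in>H. \<forall>b\<in>H. Comp J z (?f a) = Comp J z (?f b)"
        using filt_coeq[where f = ?f, OF f(1) H(2) j0(1)] .
      have "Comp ?J (e' z) a = Comp ?J (e' z) b" if "a \<in> H" "b \<in> H" for a b
      proof -
        have "z \<in> Arr J" using z(1) by (simp add: hom_def)
        then have "Comp ?J (e' z) (e' (?f a)) = Comp ?J (e' z) (e' (?f b))"
          using f(3) that by (simp add: transport_sel[OF tr] z(2)[rule_format, OF that])
        then show ?thesis by (simp add: f(2) that)
      qed
      then show ?thesis using transport_hom_in[OF tr z(1)] j0 by blast
    qed
  qed
qed

end

lemma filt_filtered: "filt r J \<Longrightarrow> regular_cardinal r \<Longrightarrow> filtered r (J :: ('u, 'u) cat)"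
  unfolding filtered_def using filt_cocone[of r J] filt_category[of r J] by blast

lemma filtered_cocone:
  fixes J :: "('u, 'u) cat" and U :: "'u itself"
  assumes J: "filtered r J" and r: "regular_cardinal r" "small U (Field r)"
    and S: "category S" "|Arr S| <o r" and D: "is_functor S J D"
  obtains c \<tau> where "cocone J S D c \<tau>"
proof -
  obtain e :: "_ \<Rightarrow> 'u" where e: "inj_on e (Ob S)"
    using small_embed[OF small_lt[OF r(2,1) card_Ob[OF S]]] .
  obtain e' :: "_ \<Rightarrow> 'u" where e': "inj_on e' (Arr S)"
    using small_embed[OF small_lt[OF r(2,1) S(2)]] .
  note tr = S(1) e e'
  have "|Arr (transport_cat e e' S)| <o r" using S(2) by (simp add: transport_sel[OF tr] lt_image)
  then obtain c \<tau> where "cocone J (transport_cat e e' S) (transport_functor e e' S D) c \<tau>"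
    using J transport_category[OF tr] transport_is_functor[OF tr D] unfolding filtered_def by blast
  then show thesis using that by (simp add: transport_cocone[OF tr])
qed

text \<open>The two elementary conditions are cocones over a discrete scheme and over a scheme of
  parallel arrows.\<close>

lemma filtered_filt:
  fixes J :: "('u, 'u) cat" and U :: "'u itself"
  assumes J: "filtered r J" and r: "regular_cardinal r" "small U (Field r)"
  shows "filt r J"
  unfolding filt_def
proof (intro conjI allI impI)
  show C: "category J" using J by (simp add: filtered_def)
  fix T assume T: "T \<subseteq> Ob J" "|T| <o r"
  then have d: "(\<lambda>i. i) \<in> T \<rightarrow> Ob J" by blast
  have "|Arr (disc_cat T)| <o r" using T by (simp add: disc_cat_def)
  then obtain c \<tau> where "cocone J (disc_cat T) (disc_functor J (\<lambda>i. i)) c \<tau>"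
    using filtered_cocone[OF J r disc_category _ disc_is_functor[OF C d]] by blast
  then have "c \<in> Ob J" "\<And>i. i \<in> T \<Longrightarrow> \<tau> i \<in> hom J i c" by (simp_all add: disc_cocone[OF C])
  then show "\<exists>k\<in>Ob J. \<forall>i\<in>T. hom J i k \<noteq> {}" by blast
next
  have C: "category J" using J by (simp add: filtered_def)
  fix i j H assume H: "H \<subseteq> hom J i j" "|H| <o r" and j: "j \<in> Ob J"
  show "\<exists>k z. z \<in> hom J j k \<and> (\<forall>f\<in>H. \<forall>g\<in>H. Comp J z f = Comp J z g)"
  proof (cases "H = {}")
    case True
    then show ?thesis using id_in[OF C j] by blast
  next
    case False
    then have i: "i \<in> Ob J" using H(1) hom_ob[OF C] by blast
    have "|Arr (par_cat H)| <o r"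
      using H(2) by (simp add: par_cat_def lt_Un[OF r(1)] lt_image lt_finite[OF r(1)])
    then obtain c \<tau> where "cocone J (par_cat H) (par_functor J i j) c \<tau>"
      using filtered_cocone[OF J r par_category _ par_is_functor[OF C i j H(1)]] by blast
    then have "\<tau> True \<in> hom J j c" "\<And>h. h \<in> H \<Longrightarrow> Comp J (\<tau> True) h = \<tau> False"
      using par_cocone[OF C i j H(1)] by auto
    then show ?thesis by (metis (no_types))
  qed
qed


section \<open>Presentable objects\<close>

lemma set_cat_hom: "h \<in> hom (set_cat U) A B \<longleftrightarrow>
    (\<exists>f. h = (A, f, B) \<and> small U A \<and> small U B \<and> f \<in> A \<rightarrow>\<^sub>E B)"
  by (auto simp: hom_def set_cat_def)

text \<open>\<open>filt\<close> in place of \<open>filtered\<close> leaves the index types free, so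
  that the locale covers the category of elements as it stands.\<close>

locale diagram_in =
  fixes U :: "'u itself" and r :: "'l rel" and C :: "('o, 'm) cat"
    and J :: "('i, 'j) cat" and D :: "('i, 'j, 'o, 'm) fctr" and c \<tau>
  assumes U: "universe U" and r: "regular_cardinal r" and small_r: "small U (Field r)"
    and C: "category C" and C_small: "locally_small U C"
    and J_small: "small_category U J" and J: "filt r J"
    and D: "is_functor J C D" and c: "colimit C J D c \<tau>"
begin

lemma J_cat: "category J"
  using J by (rule filt_category[OF _ r])

lemma \<tau>_hom: "i \<in> Ob J \<Longrightarrow> \<tau> i \<in> hom C (omap D i) c"
  and \<tau>_comp: "a \<in> hom J i j \<Longrightarrow> Comp C (\<tau> j) (amap D a) = \<tau> i"
  by (simp_all only: cocone_hom[OF colimit_cocone[OF c]] cocone_comp[OF colimit_cocone[OF c]])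

lemma \<tau>_comp': "a \<in> hom J i j \<Longrightarrow> g \<in> hom C X (omap D i) \<Longrightarrow>
    Comp C (\<tau> j) (Comp C (amap D a) g) = Comp C (\<tau> i) g"
  using \<tau>_comp[of a i j] comp_assoc[OF C _ functor_hom[OF D] \<tau>_hom] hom_ob[OF J_cat] by metis

lemma D_comp': "a \<in> hom J i j \<Longrightarrow> b \<in> hom J j k \<Longrightarrow> g \<in> hom C X (omap D i) \<Longrightarrow>
    Comp C (amap D (Comp J b a)) g = Comp C (amap D b) (Comp C (amap D a) g)"
  using functor_comp[OF D, of a i j b k] comp_assoc[OF C _ functor_hom[OF D] functor_hom[OF D]] by metis

lemma D_in: "a \<in> hom J i j \<Longrightarrow> g \<in> hom C X (omap D i) \<Longrightarrow> Comp C (amap D a) g \<in> hom C X (omap D j)"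
  using comp_in[OF C] functor_hom[OF D] by blast

lemma \<tau>_in: "i \<in> Ob J \<Longrightarrow> g \<in> hom C X (omap D i) \<Longrightarrow> Comp C (\<tau> i) g \<in> hom C X c"
  using comp_in[OF C] \<tau>_hom by blast

text \<open>The properties of \<open>X\<close> that express that \<open>hom(X, -)\<close> preserves the colimit.\<close>

definition factors :: "'o \<Rightarrow> bool" where
  "factors X \<longleftrightarrow> (\<forall>x\<in>hom C X c. \<exists>i\<in>Ob J. \<exists>g\<in>hom C X (omap D i). Comp C (\<tau> i) g = x)"

definition separates :: "'o \<Rightarrow> bool" where
  "separates X \<longleftrightarrow> (\<forall>i\<in>Ob J. \<forall>g\<in>hom C X (omap D i). \<forall>g'\<in>hom C X (omap D i).
     Comp C (\<tau> i) g = Comp C (\<tau> i) g' \<longrightarrow>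
       (\<exists>k. \<exists>w\<in>hom J i k. Comp C (amap D w) g = Comp C (amap D w) g'))"

lemma factorsE:
  assumes "factors X" "x \<in> hom C X c"
  obtains i g where "i \<in> Ob J" "g \<in> hom C X (omap D i)" "Comp C (\<tau> i) g = x"
  using assms unfolding factors_def by blast

lemma separatesE:
  assumes "separates X" "i \<in> Ob J" "g \<in> hom C X (omap D i)" "g' \<in> hom C X (omap D i)"
    "Comp C (\<tau> i) g = Comp C (\<tau> i) g'"
  obtains k w where "w \<in> hom J i k" "Comp C (amap D w) g = Comp C (amap D w) g'"
  using assms unfolding separates_def by blast

text \<open>The two stages are first moved to a common later one, where \<open>separates\<close>
  applies.\<close>

lemma separatesE2:
  assumes X: "separates X" and i: "i \<in> Ob J" "g \<in> hom C X (omap D i)"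
    and j: "j \<in> Ob J" "g' \<in> hom C X (omap D j)" and eq: "Comp C (\<tau> i) g = Comp C (\<tau> j) g'"
  obtains k u v where "u \<in> hom J i k" "v \<in> hom J j k" "Comp C (amap D u) g = Comp C (amap D v) g'"
proof -
  obtain k u v where k: "k \<in> Ob J" "u \<in> hom J i k" "v \<in> hom J j k"
    using filt_bound2[OF J r i(1) j(1)] .
  have "Comp C (\<tau> k) (Comp C (amap D u) g) = Comp C (\<tau> k) (Comp C (amap D v) g')"
    using \<tau>_comp'[OF k(2) i(2)] \<tau>_comp'[OF k(3) j(2)] eq by simp
  then obtain l w where w: "w \<in> hom J k l"
      "Comp C (amap D w) (Comp C (amap D u) g) = Comp C (amap D w) (Comp C (amap D v) g')"
    using separatesE[OF X k(1) D_in[OF k(2) i(2)] D_in[OF k(3) j(2)]] by blast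
  then have "Comp C (amap D (Comp J w u)) g = Comp C (amap D (Comp J w v)) g'"
    using D_comp'[OF k(2) w(1) i(2)] D_comp'[OF k(3) w(1) j(2)] by simp
  then show thesis using that comp_in[OF J_cat k(2) w(1)] comp_in[OF J_cat k(3) w(1)] by blast
qed

abbreviation "hom_fun X \<equiv> hom_functor C X :: ('o, 'm, ('m + 'u) set, _) fctr"

abbreviation hom_colimit :: "'o \<Rightarrow> bool" where
  "hom_colimit X \<equiv> colimit (set_cat U) J (comp_functor (hom_fun X) D)
     (omap (hom_fun X) c) (\<lambda>i. amap (hom_fun X) (\<tau> i))"

lemma small_hom: "small U (Inl ` hom C X Y :: ('m + 'u) set)"
proof (cases "X \<in> Ob C \<and> Y \<in> Ob C")
  case True
  then show ?thesis using C_small by (simp add: locally_small_def small_image)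
next
  case False
  then have "hom C X Y = {}" using hom_ob[OF C] by blast
  then show ?thesis by (simp add: small_finite[OF U])
qed

lemma hom_fun_ob: "omap (hom_fun X) Y = Inl ` hom C X Y"
    "omap (comp_functor (hom_fun X) D) i = Inl ` hom C X (omap D i)"
  by (simp_all add: hom_functor_def comp_functor_def)

lemma hom_fun_\<tau>:
  assumes "i \<in> Ob J"
  shows "amap (hom_fun X) (\<tau> i) = (Inl ` hom C X (omap D i),
    \<lambda>s\<in>Inl ` hom C X (omap D i). Inl (Comp C (\<tau> i) (projl s)), Inl ` hom C X c)"
  using \<tau>_hom[OF assms] by (auto simp: hom_functor_def hom_def intro!: restrict_ext)

lemma set_cat_comp_hom:
  assumes "i \<in> Ob J"
  shows "Comp (set_cat U) (A, f, B) (amap (hom_fun X) (\<tau> i)) =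
    (Inl ` hom C X (omap D i), \<lambda>s\<in>Inl ` hom C X (omap D i). f (Inl (Comp C (\<tau> i) (projl s))), B)"
  using \<tau>_hom[OF assms] by (auto simp: set_cat_def hom_functor_def compose_def hom_def intro!: restrict_ext)

lemma set_cat_comp_hom':
  assumes "a \<in> hom J i j"
  shows "Comp (set_cat U) (A, f, B) (amap (comp_functor (hom_fun X) D) a) =
    (Inl ` hom C X (omap D i), \<lambda>s\<in>Inl ` hom C X (omap D i). f (Inl (Comp C (amap D a) (projl s))), B)"
  using functor_hom[OF D assms]
  by (auto simp: set_cat_def hom_functor_def comp_functor_def compose_def hom_def intro!: restrict_ext)

lemma set_cocone:
  fixes Q :: "('m + 'u) set"
  assumes Q: "small U Q"
    and \<phi>: "\<And>i g. i \<in> Ob J \<Longrightarrow> g \<in> hom C X (omap D i) \<Longrightarrow> \<phi> i g \<in> Q"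
    and nat: "\<And>i j a g. a \<in> hom J i j \<Longrightarrow> g \<in> hom C X (omap D i) \<Longrightarrow>
      \<phi> j (Comp C (amap D a) g) = \<phi> i g"
  shows "cocone (set_cat U) J (comp_functor (hom_fun X) D) Q
    (\<lambda>i. (Inl ` hom C X (omap D i), \<lambda>s\<in>Inl ` hom C X (omap D i). \<phi> i (projl s), Q))"
proof (rule coconeI)
  show "Q \<in> Ob (set_cat U)" using Q by (simp add: set_cat_def)
  fix i assume i: "i \<in> Ob J"
  show "(Inl ` hom C X (omap D i), \<lambda>s\<in>Inl ` hom C X (omap D i). \<phi> i (projl s), Q) \<in>
      hom (set_cat U) (omap (comp_functor (hom_fun X) D) i) Q"
    using Q small_hom[of X "omap D i"] \<phi>[OF i] by (auto simp: set_cat_hom hom_functor_def comp_functor_def)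
next
  fix i j a assume a: "a \<in> hom J i j"
  show "Comp (set_cat U) (Inl ` hom C X (omap D j),
        \<lambda>s\<in>Inl ` hom C X (omap D j). \<phi> j (projl s), Q) (amap (comp_functor (hom_fun X) D) a) =
      (Inl ` hom C X (omap D i), \<lambda>s\<in>Inl ` hom C X (omap D i). \<phi> i (projl s), Q)"
    using D_in[OF a] nat[OF a] by (auto simp: set_cat_comp_hom'[OF a] intro!: restrict_ext)
qed

lemma hom_colimit_factor:
  fixes Q :: "('m + 'u) set"
  assumes X: "hom_colimit X" and Q: "small U Q"
    and \<phi>: "\<And>i g. i \<in> Ob J \<Longrightarrow> g \<in> hom C X (omap D i) \<Longrightarrow> \<phi> i g \<in> Q"
    and nat: "\<And>i j a g. a \<in> hom J i j \<Longrightarrow> g \<in> hom C X (omap D i) \<Longrightarrow>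
      \<phi> j (Comp C (amap D a) g) = \<phi> i g"
  obtains f where "\<forall>i\<in>Ob J. \<forall>g\<in>hom C X (omap D i). f (Comp C (\<tau> i) g) = \<phi> i g"
proof -
  obtain h where h: "h \<in> hom (set_cat U) (omap (hom_fun X) c) Q"
    "\<And>i. i \<in> Ob J \<Longrightarrow> Comp (set_cat U) h (amap (hom_fun X) (\<tau> i)) =
      (Inl ` hom C X (omap D i), \<lambda>s\<in>Inl ` hom C X (omap D i). \<phi> i (projl s), Q)"
    using colimit_factor[OF X set_cocone[where \<phi> = \<phi>, OF Q \<phi> nat]] by blast
  then obtain f where f: "h = (omap (hom_fun X) c, f, Q)" by (auto simp: set_cat_hom)
  have "f (Inl (Comp C (\<tau> i) g)) = \<phi> i g" if i: "i \<in> Ob J" and g: "g \<in> hom C X (omap D i)" for i g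
  proof -
    let ?A = "Inl ` hom C X (omap D i) :: ('m + 'u) set"
    have "(\<lambda>s\<in>?A. f (Inl (Comp C (\<tau> i) (projl s)))) = (\<lambda>s\<in>?A. \<phi> i (projl s))"
      using h(2)[OF i] by (simp add: f set_cat_comp_hom[OF i])
    from fun_cong[OF this, of "Inl g"] g show ?thesis by simp
  qed
  then show thesis by (intro that[of "\<lambda>x. f (Inl x)"] ballI)
qed

text \<open>These serve as truth values: through \<open>Inr\<close> they form a two-element object
  of \<open>set_cat\<close>, the target of indicator functions on hom-sets.\<close>

lemma two_points: obtains u v :: 'u where "u \<noteq> v"
proof -
  have "infinite (UNIV :: 'u set)"
    using regular_cardinalD(4)[OF universe_regular[OF U]] by (simp add: Field_card_of)
  then have "\<exists>v. v \<notin> {undefined :: 'u}" by (intro ex_new_if_finite) auto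
  then show thesis using that by blast
qed

text \<open>The two maps from \<open>hom(X, c)\<close> to a two-element set which are constant, respectively the
  indicator of the elements that factor, agree on every stage of the colimit.\<close>

lemma hom_colimit_factors:
  assumes X: "hom_colimit X"
  shows "factors X"
proof (rule ccontr)
  assume "\<not> factors X"
  then obtain x where x: "x \<in> hom C X c"
    "\<And>i g. i \<in> Ob J \<Longrightarrow> g \<in> hom C X (omap D i) \<Longrightarrow> Comp C (\<tau> i) g \<noteq> x" by (auto simp: factors_def)
  obtain u v :: 'u where uv: "u \<noteq> v" by (rule two_points)
  let ?Q = "{Inr u, Inr v} :: ('m + 'u) set" and ?A = "Inl ` hom C X c :: ('m + 'u) set"
  let ?f = "\<lambda>s\<in>?A. if s = Inl x then Inr v else Inr u :: 'm + 'u" and ?g = "\<lambda>s\<in>?A. Inr u :: 'm + 'u"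
  have Q: "small U ?Q" by (simp add: small_finite[OF U])
  have fg: "(?A, ?f, ?Q) \<in> hom (set_cat U) (omap (hom_fun X) c) ?Q"
      "(?A, ?g, ?Q) \<in> hom (set_cat U) (omap (hom_fun X) c) ?Q"
    using Q small_hom[of X c] by (auto simp: set_cat_hom hom_functor_def)
  have co: "cocone (set_cat U) J (comp_functor (hom_fun X) D) ?Q
    (\<lambda>i. (Inl ` hom C X (omap D i), \<lambda>s\<in>Inl ` hom C X (omap D i). Inr u, ?Q))"
    by (rule set_cocone[OF Q, where \<phi> = "\<lambda>_ _. Inr u"]) auto
  have fg': "Comp (set_cat U) (?A, ?f, ?Q) (amap (hom_fun X) (\<tau> i)) =
      (Inl ` hom C X (omap D i), \<lambda>s\<in>Inl ` hom C X (omap D i). Inr u, ?Q)" (is "?L i = ?R i")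
    "Comp (set_cat U) (?A, ?g, ?Q) (amap (hom_fun X) (\<tau> i)) =
      (Inl ` hom C X (omap D i), \<lambda>s\<in>Inl ` hom C X (omap D i). Inr u, ?Q)" (is "?L' i = ?R i")
    if i: "i \<in> Ob J" for i
  proof -
    have *: "?f (Inl (Comp C (\<tau> i) (projl s))) = Inr u" "?g (Inl (Comp C (\<tau> i) (projl s))) = Inr u"
      if s: "s \<in> (Inl ` hom C X (omap D i) :: ('m + 'u) set)" for s
    proof -
      obtain g where g: "g \<in> hom C X (omap D i)" "s = Inl g" using s by blast
      then show "?f (Inl (Comp C (\<tau> i) (projl s))) = Inr u" "?g (Inl (Comp C (\<tau> i) (projl s))) = Inr u"
        using x(2)[OF i g(1)] \<tau>_in[OF i g(1)] by simp_all
    qed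
    show "?L i = ?R i" "?L' i = ?R i"
      unfolding set_cat_comp_hom[OF i] prod.inject
      by (intro conjI HOL.refl restrict_ext, rule *, assumption)+
  qed
  have "(?A, ?f, ?Q) = (?A, ?g, ?Q)"
    by (rule colimit_eq'[OF X co fg(1) ballI[OF fg'(1)] fg(2) ballI[OF fg'(2)]])
  then have "?f = ?g" by simp
  from fun_cong[OF this, of "Inl x"] x(1) uv show False by simp
qed

text \<open>For fixed \<open>g\<close>, the indicator of the elements that become equal to \<open>g\<close> at a later stage is a
  cocone into a two-element set.\<close>

lemma hom_colimit_separates:
  assumes X: "hom_colimit X"
  shows "separates X"
  unfolding separates_def
proof (intro ballI impI)
  fix i g g' assume i: "i \<in> Ob J" and g: "g \<in> hom C X (omap D i)" and g': "g' \<in> hom C X (omap D i)"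
    and eq: "Comp C (\<tau> i) g = Comp C (\<tau> i) g'"
  obtain u v :: 'u where uv: "u \<noteq> v" by (rule two_points)
  define rel where "rel j h \<longleftrightarrow>
    (\<exists>k. \<exists>a\<in>hom J i k. \<exists>b\<in>hom J j k. Comp C (amap D a) g = Comp C (amap D b) h)" for j h
  let ?Q = "{Inr u, Inr v} :: ('m + 'u) set"
  define \<phi> where "\<phi> j h = (if rel j h then Inr u else Inr v :: 'm + 'u)" for j h
  \<comment> \<open>Invariance of \<open>rel\<close> under the transition maps makes its indicator a
    cocone. To pass from \<open>rel j h\<close> to stage \<open>j'\<close>, the span of
    \<open>b\<close> and \<open>d\<close> is completed to a commuting square by a bound followed by
    a coequalizing arrow.\<close>
  have "rel j' (Comp C (amap D d) h) \<longleftrightarrow> rel j h"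
    if d: "d \<in> hom J j j'" and h: "h \<in> hom C X (omap D j)" for j j' d h
  proof
    assume "rel j' (Comp C (amap D d) h)"
    then obtain k a b where "a \<in> hom J i k" "b \<in> hom J j' k"
      "Comp C (amap D a) g = Comp C (amap D b) (Comp C (amap D d) h)" unfolding rel_def by blast
    then show "rel j h" unfolding rel_def using comp_in[OF J_cat d] D_comp'[OF d _ h] by metis
  next
    assume "rel j h"
    then obtain k a b where ab: "a \<in> hom J i k" "b \<in> hom J j k"
      "Comp C (amap D a) g = Comp C (amap D b) h" unfolding rel_def by blast
    obtain l p q where l: "l \<in> Ob J" "p \<in> hom J k l" "q \<in> hom J j' l"
      using filt_bound2[OF J r] hom_ob[OF J_cat ab(1)] hom_ob[OF J_cat d] by blast
    obtain m z where z: "z \<in> hom J l m" "Comp J z (Comp J p b) = Comp J z (Comp J q d)"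
      using filt_coeq2[OF J r comp_in[OF J_cat ab(2) l(2)] comp_in[OF J_cat d l(3)]] .
    note zp = comp_in[OF J_cat l(2) z(1)] and zq = comp_in[OF J_cat l(3) z(1)]
    have "Comp C (amap D (Comp J (Comp J z p) a)) g = Comp C (amap D (Comp J (Comp J z p) b)) h"
      using ab(3) D_comp'[OF ab(1) zp g] D_comp'[OF ab(2) zp h] by simp
    also have "Comp J (Comp J z p) b = Comp J (Comp J z q) d"
      using z(2) comp_assoc[OF J_cat ab(2) l(2) z(1)] comp_assoc[OF J_cat d l(3) z(1)] by simp
    also have "Comp C (amap D \<dots>) h = Comp C (amap D (Comp J z q)) (Comp C (amap D d) h)"
      by (rule D_comp'[OF d zq h])
    finally show "rel j' (Comp C (amap D d) h)"
      unfolding rel_def using comp_in[OF J_cat ab(1) zp] zq by blast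
  qed
  then have nat: "\<phi> j' (Comp C (amap D d) h) = \<phi> j h"
    if "d \<in> hom J j j'" "h \<in> hom C X (omap D j)" for j j' d h
    using that by (simp add: \<phi>_def)
  have Q: "small U ?Q" by (simp add: small_finite[OF U])
  have "\<phi> i g \<in> ?Q" for i g by (simp add: \<phi>_def)
  then obtain f where f: "\<forall>i\<in>Ob J. \<forall>g\<in>hom C X (omap D i). f (Comp C (\<tau> i) g) = \<phi> i g"
    using hom_colimit_factor[where \<phi> = \<phi>, OF X Q _ nat] by metis
  have "rel i g" unfolding rel_def using id_in[OF J_cat i] by blast
  moreover have "\<phi> i g = \<phi> i g'" using f i g g' eq by metis
  ultimately have "rel i g'" using uv by (simp add: \<phi>_def split: if_splits)
  then obtain k a b where ab: "a \<in> hom J i k" "b \<in> hom J i k"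
    "Comp C (amap D a) g = Comp C (amap D b) g'" unfolding rel_def by blast
  \<comment> \<open>\<open>rel\<close> yields possibly different arrows \<open>a\<close> and
    \<open>b\<close> from \<open>i\<close> to \<open>k\<close>, while \<open>separates\<close> asks
    for a single one; they are coequalized.\<close>
  obtain l z where z: "z \<in> hom J k l" "Comp J z a = Comp J z b" using filt_coeq2[OF J r ab(1,2)] .
  have "Comp C (amap D (Comp J z a)) g = Comp C (amap D (Comp J z a)) g'"
    using D_comp'[OF ab(1) z(1) g] D_comp'[OF ab(2) z(1) g'] ab(3) z(2) by simp
  then show "\<exists>k. \<exists>w\<in>hom J i k. Comp C (amap D w) g = Comp C (amap D w) g'"
    using comp_in[OF J_cat ab(1) z(1)] by (intro exI[of _ l] bexI[of _ "Comp J z a"])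
qed

text \<open>A mediating map must send \<open>\<tau> i\<close> after \<open>g\<close> to the value of
  the cocone at \<open>g\<close>. \<open>factors\<close> says that this reaches every element of the
  hom-set, which also gives uniqueness; \<open>separates\<close> makes the value independent of
  \<open>i\<close> and \<open>g\<close>.\<close>

lemma hom_colimitI:
  assumes fac: "factors X" and sep: "separates X"
  shows "hom_colimit X"
proof (rule colimitI)
  show "cocone (set_cat U) J (comp_functor (hom_fun X) D) (omap (hom_fun X) c)
      (\<lambda>i. amap (hom_fun X) (\<tau> i))"
  proof (rule coconeI)
    show "omap (hom_fun X) c \<in> Ob (set_cat U)" using small_hom[of X c] by (simp add: set_cat_def hom_functor_def)
    show "amap (hom_fun X) (\<tau> i) \<in> hom (set_cat U) (omap (comp_functor (hom_fun X) D) i) (omap (hom_fun X) c)"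
      if "i \<in> Ob J" for i
      using \<tau>_in[OF that] small_hom[of X c] small_hom[of X "omap D i"]
      by (auto simp: set_cat_hom hom_fun_ob hom_fun_\<tau>[OF that])
    fix i j a assume a: "a \<in> hom J i j"
    then have ij: "i \<in> Ob J" "j \<in> Ob J" using hom_ob[OF J_cat] by blast+
    show "Comp (set_cat U) (amap (hom_fun X) (\<tau> j)) (amap (comp_functor (hom_fun X) D) a) = amap (hom_fun X) (\<tau> i)"
      using D_in[OF a] \<tau>_comp'[OF a]
      by (auto simp: hom_fun_\<tau>[OF ij(1)] hom_fun_\<tau>[OF ij(2)] set_cat_comp_hom'[OF a] intro!: restrict_ext)
  qed
next
  fix Q \<sigma> assume co: "cocone (set_cat U) J (comp_functor (hom_fun X) D) Q \<sigma>"
  then have Q: "small U Q" by (simp add: cocone_def set_cat_def)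
  have "\<exists>f. \<sigma> i = (Inl ` hom C X (omap D i), f, Q) \<and> f \<in> Inl ` hom C X (omap D i) \<rightarrow>\<^sub>E Q"
    if "i \<in> Ob J" for i
    using cocone_hom[OF co that] by (auto simp: set_cat_hom hom_functor_def comp_functor_def)
  then obtain s where s: "\<And>i. i \<in> Ob J \<Longrightarrow> \<sigma> i = (Inl ` hom C X (omap D i), s i, Q)"
    "\<And>i. i \<in> Ob J \<Longrightarrow> s i \<in> Inl ` hom C X (omap D i) \<rightarrow>\<^sub>E Q" by metis
  have s_nat: "s j (Inl (Comp C (amap D a) g)) = s i (Inl g)"
    if a: "a \<in> hom J i j" and g: "g \<in> hom C X (omap D i)" for i j a g
  proof -
    have ij: "i \<in> Ob J" "j \<in> Ob J" using hom_ob[OF J_cat a] by auto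
    have "(\<lambda>t\<in>Inl ` hom C X (omap D i). s j (Inl (Comp C (amap D a) (projl t)))) = s i"
      using cocone_comp[OF co a] by (simp add: s(1) ij set_cat_comp_hom'[OF a])
    from fun_cong[OF this, of "Inl g"] g show ?thesis by simp
  qed
  have wd: "s i (Inl g) = s j (Inl g')" if ij: "i \<in> Ob J" "j \<in> Ob J" and
    g: "g \<in> hom C X (omap D i)" "g' \<in> hom C X (omap D j)" and eq: "Comp C (\<tau> i) g = Comp C (\<tau> j) g'"
    for i j g g'
  proof -
    obtain k u v where uv: "u \<in> hom J i k" "v \<in> hom J j k" "Comp C (amap D u) g = Comp C (amap D v) g'"
      using separatesE2[OF sep ij(1) g(1) ij(2) g(2) eq] .
    show ?thesis using s_nat[OF uv(1) g(1)] s_nat[OF uv(2) g(2)] uv(3) by simp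
  qed
  define f :: "'m + 'u \<Rightarrow> 'm + 'u" where "f = (\<lambda>x\<in>Inl ` hom C X c. SOME y. \<exists>i\<in>Ob J. \<exists>g\<in>hom C X (omap D i).
    Inl (Comp C (\<tau> i) g) = x \<and> y = s i (Inl g))"
  have f: "f (Inl (Comp C (\<tau> i) g)) = s i (Inl g)" if i: "i \<in> Ob J" and g: "g \<in> hom C X (omap D i)" for i g
  proof -
    have "(SOME y. \<exists>i'\<in>Ob J. \<exists>g'\<in>hom C X (omap D i'). Inl (Comp C (\<tau> i') g') = (Inl (Comp C (\<tau> i) g) :: 'm + 'u)
        \<and> y = s i' (Inl g')) = s i (Inl g)"
    proof (rule some_equality)
      show "\<exists>i'\<in>Ob J. \<exists>g'\<in>hom C X (omap D i'). Inl (Comp C (\<tau> i') g') = (Inl (Comp C (\<tau> i) g) :: 'm + 'u)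
          \<and> s i (Inl g) = s i' (Inl g')"
        by (rule bexI[OF _ i], rule bexI[OF _ g]) simp
      fix y assume "\<exists>i'\<in>Ob J. \<exists>g'\<in>hom C X (omap D i'). Inl (Comp C (\<tau> i') g') = (Inl (Comp C (\<tau> i) g) :: 'm + 'u)
          \<and> y = s i' (Inl g')"
      then obtain i' g' where "i' \<in> Ob J" "g' \<in> hom C X (omap D i')" "Comp C (\<tau> i') g' = Comp C (\<tau> i) g"
        "y = s i' (Inl g')" by (elim bexE conjE) simp
      then show "y = s i (Inl g)" using wd[OF _ i _ g] by simp
    qed
    then show ?thesis using \<tau>_in[OF i g] by (simp add: f_def)
  qed
  have "f x \<in> Q" if x: "x \<in> Inl ` hom C X c" for x
  proof -
    obtain y where "y \<in> hom C X c" "x = Inl y" using x by blast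
    then obtain i g where ig: "i \<in> Ob J" "g \<in> hom C X (omap D i)" "x = Inl (Comp C (\<tau> i) g)"
      using factorsE[OF fac] by metis
    then show ?thesis using f[OF ig(1,2)] s(2)[OF ig(1)] by (auto simp: PiE_iff)
  qed
  then have "f \<in> Inl ` hom C X c \<rightarrow>\<^sub>E Q" by (simp add: f_def PiE_iff)
  then have "(Inl ` hom C X c, f, Q) \<in> hom (set_cat U) (omap (hom_fun X) c) Q"
    using Q small_hom[of X c] by (simp add: set_cat_hom hom_functor_def)
  moreover have "Comp (set_cat U) (Inl ` hom C X c, f, Q) (amap (hom_fun X) (\<tau> i)) = \<sigma> i" if i: "i \<in> Ob J" for i
  proof -
    have "(\<lambda>t\<in>Inl ` hom C X (omap D i). f (Inl (Comp C (\<tau> i) (projl t)))) = s i"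
      by (rule extensionalityI[of _ "Inl ` hom C X (omap D i)"]) (use s(2)[OF i] f[OF i] in \<open>auto simp: PiE_iff\<close>)
    then show ?thesis using s(1)[OF i] by (simp add: set_cat_comp_hom[OF i])
  qed
  ultimately show "\<exists>h\<in>hom (set_cat U) (omap (hom_fun X) c) Q.
      \<forall>i\<in>Ob J. Comp (set_cat U) h (amap (hom_fun X) (\<tau> i)) = \<sigma> i" by blast
next
  fix Q h k assume hk: "h \<in> hom (set_cat U) (omap (hom_fun X) c) Q" "k \<in> hom (set_cat U) (omap (hom_fun X) c) Q"
    and eq: "\<And>i. i \<in> Ob J \<Longrightarrow> Comp (set_cat U) h (amap (hom_fun X) (\<tau> i)) = Comp (set_cat U) k (amap (hom_fun X) (\<tau> i))"
  let ?A = "Inl ` hom C X c :: ('m + 'u) set"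
  from hk obtain f g where f: "h = (?A, f, Q)" "f \<in> ?A \<rightarrow>\<^sub>E Q" and g: "k = (?A, g, Q)" "g \<in> ?A \<rightarrow>\<^sub>E Q"
    by (auto simp: set_cat_hom hom_functor_def)
  have "f = g"
  proof (rule PiE_ext[OF f(2) g(2)])
    fix x assume "x \<in> ?A"
    then obtain y where "y \<in> hom C X c" "x = Inl y" by blast
    then obtain i z where z: "i \<in> Ob J" "z \<in> hom C X (omap D i)" "x = Inl (Comp C (\<tau> i) z)"
      using factorsE[OF fac] by metis
    let ?B = "Inl ` hom C X (omap D i) :: ('m + 'u) set"
    have "(\<lambda>s\<in>?B. f (Inl (Comp C (\<tau> i) (projl s)))) = (\<lambda>s\<in>?B. g (Inl (Comp C (\<tau> i) (projl s))))"
      using eq[OF z(1)] by (simp add: f g set_cat_comp_hom[OF z(1)])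
    from fun_cong[OF this, of "Inl z"] z show "f x = g x" by simp
  qed
  then show "h = k" by (simp add: f g)
qed

end


locale base =
  fixes U :: "'u itself" and r :: "'l rel" and C :: "('o, 'm) cat"
  assumes U: "universe U" and r: "regular_cardinal r" and small_r: "small U (Field r)"
    and C: "category C" and C_small: "locally_small U C"
begin

lemma diagram_inI:
  "small_category U J \<Longrightarrow> filt r J \<Longrightarrow> is_functor J C D \<Longrightarrow> colimit C J D c \<tau> \<Longrightarrow> diagram_in U r C J D c \<tau>"
  using U r small_r C C_small by (simp add: diagram_in_def)

text \<open>The definition only speaks of schemes on the universe type. The diagram is renamed to
  such a scheme, both properties are read off there and carried back along the renaming.\<close>

lemma presentableD:
  fixes J :: "('i, 'j) cat"
  assumes X: "presentable U r C X" and J: "small_category U J" "filt r J"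
    and D: "is_functor J C D" and c: "colimit C J D c \<tau>"
  shows "diagram_in.factors C J D c \<tau> X \<and> diagram_in.separates C J D \<tau> X"
proof -
  obtain e :: "_ \<Rightarrow> 'u" where e: "inj_on e (Ob J)"
    using J unfolding small_category_def by (blast elim: small_embed)
  obtain e' :: "_ \<Rightarrow> 'u" where e': "inj_on e' (Arr J)"
    using J unfolding small_category_def by (blast elim: small_embed)
  have J_cat: "category J" using J by (simp add: small_category_def)
  note tr = this e e'
  let ?J = "transport_cat e e' J" and ?D = "transport_functor e e' J D"
    and ?\<tau> = "\<lambda>i. \<tau> (inv_into (Ob J) e i)"
  have sJ: "small_category U ?J"
    using J(1) transport_category[OF tr] by (simp add: small_category_def transport_sel[OF tr] small_image)
  have fJ: "filt r ?J" by (rule filt_transport[OF J(2) r e e'])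
  note D' = transport_is_functor[OF tr D] and c' = transport_colimit'[OF tr c]
  interpret d: diagram_in U r C J D c \<tau> by (rule diagram_inI[OF J D c])
  interpret d': diagram_in U r C ?J ?D c ?\<tau> by (rule diagram_inI[OF sJ fJ D' c'])
  have "d'.hom_colimit X"
    using X sJ filt_filtered[OF fJ r] D' c'
    unfolding presentable_def preserves_filtered_colimits_def by blast
  then have f': "d'.factors X" and s': "d'.separates X"
    by (rule d'.hom_colimit_factors d'.hom_colimit_separates)+
  have "d.factors X"
    unfolding d.factors_def
  proof
    fix x assume x: "x \<in> hom C X c"
    obtain i g where ig: "i \<in> Ob ?J" "g \<in> hom C X (omap ?D i)" "Comp C (?\<tau> i) g = x"
      using d'.factorsE[OF f' x] .
    then obtain j where "j \<in> Ob J" "i = e j" by (auto simp: transport_sel[OF tr])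
    then show "\<exists>i\<in>Ob J. \<exists>g\<in>hom C X (omap D i). Comp C (\<tau> i) g = x"
      using ig by (intro bexI[of _ j] bexI[of _ g]) (simp_all add: transport_sel[OF tr] e)
  qed
  moreover have "d.separates X"
    unfolding d.separates_def
  proof (intro ballI impI)
    fix i g g' assume i: "i \<in> Ob J" and g: "g \<in> hom C X (omap D i)" "g' \<in> hom C X (omap D i)"
      and eq: "Comp C (\<tau> i) g = Comp C (\<tau> i) g'"
    have i': "e i \<in> Ob ?J" and g': "g \<in> hom C X (omap ?D (e i))" "g' \<in> hom C X (omap ?D (e i))"
      and eq': "Comp C (?\<tau> (e i)) g = Comp C (?\<tau> (e i)) g'"
      using i g eq by (simp_all add: transport_sel[OF tr] e)
    obtain k w where w: "w \<in> hom ?J (e i) k" "Comp C (amap ?D w) g = Comp C (amap ?D w) g'"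
      using d'.separatesE[OF s' i' g' eq'] .
    from w(1) obtain a x y where a: "x \<in> Ob J" "y \<in> Ob J" "a \<in> hom J x y" "e i = e x" "k = e y" "w = e' a"
      by (rule transport_homE[OF tr])
    moreover have "i = x" using e a i by (simp add: inj_on_eq_iff)
    moreover have "a \<in> Arr J" using a(3) by (simp add: hom_def)
    ultimately show "\<exists>k. \<exists>w\<in>hom J i k. Comp C (amap D w) g = Comp C (amap D w) g'"
      using w(2) by (intro exI[of _ y] bexI[of _ a]) (simp_all add: transport_sel[OF tr])
  qed
  ultimately show ?thesis ..
qed

lemma presentableI:
  assumes X: "X \<in> Ob C"
    and "\<And>(J :: ('u, 'u) cat) D c \<tau>. diagram_in U r C J D c \<tau> \<Longrightarrow>
      diagram_in.factors C J D c \<tau> X \<and> diagram_in.separates C J D \<tau> X"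
  shows "presentable U r C X"
  unfolding presentable_def preserves_filtered_colimits_def
proof (intro conjI allI impI X)
  fix J :: "('u, 'u) cat" and D c \<tau>
  assume "small_category U J" "filtered r J" "is_functor J C D" "colimit C J D c \<tau>"
  then interpret d: diagram_in U r C J D c \<tau> by (intro diagram_inI filtered_filt[OF _ r small_r])
  show "d.hom_colimit X" using assms(2)[OF d.diagram_in_axioms] by (simp add: d.hom_colimitI)
qed

lemma presentable_ob: "presentable U r C X \<Longrightarrow> X \<in> Ob C"
  by (simp add: presentable_def)

text \<open>The elementwise form of the fact that limits over fewer than \<open>r\<close> arrows
  commute with \<open>r\<close>-filtered colimits of sets: a morphism out of \<open>c\<close> is a
  family over the objects of \<open>S\<close> subject to one equation per arrow of \<open>S\<close>,
  and each member and each equation already appears at some stage of the filtered diagram.\<close>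

lemma presentable_colimit:
  fixes S :: "('i, 'j) cat"
  assumes S: "category S" "|Arr S| <o r" and D: "is_functor S C D"
    and pr: "\<And>s. s \<in> Ob S \<Longrightarrow> presentable U r C (omap D s)" and c: "colimit C S D c \<kappa>"
  shows "presentable U r C c"
proof (rule presentableI)
  note cc = colimit_cocone[OF c]
  note S_ob = card_Ob[OF S]
  show "c \<in> Ob C" by (rule cocone_ob[OF cc])
  fix J :: "('u, 'u) cat" and E l \<tau>
  assume "diagram_in U r C J E l \<tau>"
  then interpret d: diagram_in U r C J E l \<tau> .
  have fac: "d.factors (omap D s)" and sep: "d.separates (omap D s)" if "s \<in> Ob S" for s
    using presentableD[OF pr[OF that] d.J_small d.J d.D d.c] by simp_all
  have "d.factors c"
    unfolding d.factors_def
  proof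
    fix x assume x: "x \<in> hom C c l"
    have "\<exists>i g. i \<in> Ob J \<and> g \<in> hom C (omap D s) (omap E i) \<and> Comp C (\<tau> i) g = Comp C x (\<kappa> s)"
      if s: "s \<in> Ob S" for s
      using d.factorsE[OF fac[OF s] comp_in[OF C cocone_hom[OF cc s] x]] by blast
    then obtain i g where ig: "\<And>s. s \<in> Ob S \<Longrightarrow> i s \<in> Ob J"
      "\<And>s. s \<in> Ob S \<Longrightarrow> g s \<in> hom C (omap D s) (omap E (i s))"
      "\<And>s. s \<in> Ob S \<Longrightarrow> Comp C (\<tau> (i s)) (g s) = Comp C x (\<kappa> s)" by metis
    from filt_bound[where i = i, OF d.J r ig(1) S_ob] obtain k u where
      k: "k \<in> Ob J" "\<And>s. s \<in> Ob S \<Longrightarrow> u s \<in> hom J (i s) k" by blast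
    define h where "h s = Comp C (amap E (u s)) (g s)" for s
    have h: "h s \<in> hom C (omap D s) (omap E k)" "Comp C (\<tau> k) (h s) = Comp C x (\<kappa> s)" if "s \<in> Ob S" for s
      using that d.D_in[OF k(2) ig(2)] d.\<tau>_comp'[OF k(2) ig(2)] ig(3) by (simp_all add: h_def)
    \<comment> \<open>The morphisms \<open>h s\<close> into stage \<open>k\<close> are compatible
      with the arrows of \<open>S\<close> only after \<open>\<tau> k\<close>. Separation gives for
      each arrow a later stage where compatibility holds, and these are merged into
      \<open>t\<close>.\<close>
    have "\<exists>m w. w \<in> hom J k m \<and>
        Comp C (amap E w) (Comp C (h (Cod S a)) (amap D a)) = Comp C (amap E w) (h (Dom S a))"
      if aS: "a \<in> Arr S" for a
    proof -
      have a: "a \<in> hom S (Dom S a) (Cod S a)" using aS by (simp add: hom_def)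
      then have ob: "Dom S a \<in> Ob S" "Cod S a \<in> Ob S" using hom_ob[OF S(1)] by blast+
      note Da = functor_hom[OF D a]
      have 1: "Comp C (h (Cod S a)) (amap D a) \<in> hom C (omap D (Dom S a)) (omap E k)"
        by (rule comp_in[OF C Da h(1)[OF ob(2)]])
      have "Comp C (\<tau> k) (Comp C (h (Cod S a)) (amap D a)) = Comp C (Comp C (\<tau> k) (h (Cod S a))) (amap D a)"
        by (rule comp_assoc[OF C Da h(1)[OF ob(2)] d.\<tau>_hom[OF k(1)], symmetric])
      also have "\<dots> = Comp C x (Comp C (\<kappa> (Cod S a)) (amap D a))"
        unfolding h(2)[OF ob(2)] by (rule comp_assoc[OF C Da cocone_hom[OF cc ob(2)] x])
      also have "\<dots> = Comp C (\<tau> k) (h (Dom S a))"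
        by (simp add: cocone_comp[OF cc a] h(2)[OF ob(1)])
      finally show ?thesis using d.separatesE[OF sep[OF ob(1)] k(1) 1 h(1)[OF ob(1)]] by metis
    qed
    then obtain m w where w: "\<And>a. a \<in> Arr S \<Longrightarrow> w a \<in> hom J k (m a)"
      "\<And>a. a \<in> Arr S \<Longrightarrow> Comp C (amap E (w a)) (Comp C (h (Cod S a)) (amap D a)) =
        Comp C (amap E (w a)) (h (Dom S a))" by metis
    obtain n t where t: "t \<in> hom J k n" "\<forall>a\<in>Arr S. \<exists>y\<in>hom J (m a) n. t = Comp J y (w a)"
      using filt_merge[where w = w and k = m, OF d.J r k(1) w(1) S(2)] .
    have n: "n \<in> Ob J" using hom_ob[OF d.J_cat t(1)] by simp
    have "cocone C S D (omap E n) (\<lambda>s. Comp C (amap E t) (h s))"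
    proof (rule coconeI)
      show "omap E n \<in> Ob C" by (rule functor_ob[OF d.D n])
      show "Comp C (amap E t) (h s) \<in> hom C (omap D s) (omap E n)" if "s \<in> Ob S" for s
        by (rule d.D_in[OF t(1) h(1)[OF that]])
      fix s s' a assume a: "a \<in> hom S s s'"
      then have a': "a \<in> Arr S" "Dom S a = s" "Cod S a = s'" by (simp_all add: hom_def)
      have ob: "s \<in> Ob S" "s' \<in> Ob S" using hom_ob[OF S(1) a] by auto
      obtain y where y: "y \<in> hom J (m a) n" "t = Comp J y (w a)" using t(2) a'(1) by blast
      note Da = functor_hom[OF D a]
      note ha = comp_in[OF C Da h(1)[OF ob(2)]]
      have "Comp C (Comp C (amap E t) (h s')) (amap D a) = Comp C (amap E t) (Comp C (h s') (amap D a))"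
        by (rule comp_assoc[OF C Da h(1)[OF ob(2)] functor_hom[OF d.D t(1)]])
      also have "\<dots> = Comp C (amap E y) (Comp C (amap E (w a)) (Comp C (h s') (amap D a)))"
        unfolding y(2) by (rule d.D_comp'[OF w(1)[OF a'(1)] y(1) ha])
      also have "\<dots> = Comp C (amap E y) (Comp C (amap E (w a)) (h s))"
        using w(2)[OF a'(1)] a' by simp
      also have "\<dots> = Comp C (amap E t) (h s)"
        unfolding y(2) by (rule d.D_comp'[OF w(1)[OF a'(1)] y(1) h(1)[OF ob(1)], symmetric])
      finally show "Comp C (Comp C (amap E t) (h s')) (amap D a) = Comp C (amap E t) (h s)" .
    qed
    from colimit_factor[OF c this] obtain f where f: "f \<in> hom C c (omap E n)"
      "\<And>s. s \<in> Ob S \<Longrightarrow> Comp C f (\<kappa> s) = Comp C (amap E t) (h s)" by blast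
    have "Comp C (\<tau> n) f = x"
    proof (rule colimit_eq[OF C S(1) D c comp_in[OF C f(1) d.\<tau>_hom[OF n]] x])
      fix s assume s: "s \<in> Ob S"
      show "Comp C (Comp C (\<tau> n) f) (\<kappa> s) = Comp C x (\<kappa> s)"
        using comp_assoc[OF C cocone_hom[OF cc s] f(1) d.\<tau>_hom[OF n]] f(2)[OF s]
          d.\<tau>_comp'[OF t(1) h(1)[OF s]] h(2)[OF s] by simp
    qed
    then show "\<exists>i\<in>Ob J. \<exists>g\<in>hom C c (omap E i). Comp C (\<tau> i) g = x" using n f(1) by blast
  qed
  moreover have "d.separates c"
    unfolding d.separates_def
  proof (intro ballI impI)
    fix i g g' assume i: "i \<in> Ob J" and g: "g \<in> hom C c (omap E i)" "g' \<in> hom C c (omap E i)"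
      and eq: "Comp C (\<tau> i) g = Comp C (\<tau> i) g'"
    \<comment> \<open>Equality is tested on the legs \<open>\<kappa> s\<close>, each of which needs
      its own later stage at first.\<close>
    have "\<exists>m w. w \<in> hom J i m \<and> Comp C (amap E w) (Comp C g (\<kappa> s)) = Comp C (amap E w) (Comp C g' (\<kappa> s))"
      if s: "s \<in> Ob S" for s
    proof -
      note ks = cocone_hom[OF cc s]
      have "Comp C (\<tau> i) (Comp C g (\<kappa> s)) = Comp C (\<tau> i) (Comp C g' (\<kappa> s))"
        using eq comp_assoc[OF C ks g(1) d.\<tau>_hom[OF i]] comp_assoc[OF C ks g(2) d.\<tau>_hom[OF i]] by simp
      from d.separatesE[OF sep[OF s] i comp_in[OF C ks g(1)] comp_in[OF C ks g(2)] this]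
      show ?thesis by metis
    qed
    then obtain m w where w: "\<And>s. s \<in> Ob S \<Longrightarrow> w s \<in> hom J i (m s)"
      "\<And>s. s \<in> Ob S \<Longrightarrow> Comp C (amap E (w s)) (Comp C g (\<kappa> s)) = Comp C (amap E (w s)) (Comp C g' (\<kappa> s))"
      by metis
    obtain n t where t: "t \<in> hom J i n" "\<forall>s\<in>Ob S. \<exists>y\<in>hom J (m s) n. t = Comp J y (w s)"
      using filt_merge[where w = w and k = m, OF d.J r i w(1) S_ob] .
    have "Comp C (amap E t) g = Comp C (amap E t) g'"
    proof (rule colimit_eq[OF C S(1) D c d.D_in[OF t(1) g(1)] d.D_in[OF t(1) g(2)]])
      fix s assume s: "s \<in> Ob S"
      note ks = cocone_hom[OF cc s]
      obtain y where y: "y \<in> hom J (m s) n" "t = Comp J y (w s)" using t(2) s by blast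
      have "Comp C (amap E t) (Comp C g (\<kappa> s)) = Comp C (amap E y) (Comp C (amap E (w s)) (Comp C g (\<kappa> s)))"
        unfolding y(2) by (rule d.D_comp'[OF w(1)[OF s] y(1) comp_in[OF C ks g(1)]])
      also have "\<dots> = Comp C (amap E t) (Comp C g' (\<kappa> s))"
        unfolding y(2) w(2)[OF s] by (rule d.D_comp'[OF w(1)[OF s] y(1) comp_in[OF C ks g(2)], symmetric])
      finally show "Comp C (Comp C (amap E t) g) (\<kappa> s) = Comp C (Comp C (amap E t) g') (\<kappa> s)"
        using comp_assoc[OF C ks g(1) functor_hom[OF d.D t(1)]]
          comp_assoc[OF C ks g(2) functor_hom[OF d.D t(1)]] by simp
    qed
    then show "\<exists>k. \<exists>w\<in>hom J i k. Comp C (amap E w) g = Comp C (amap E w) g'"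
      using t(1) by (intro exI[of _ n] bexI[of _ t])
  qed
  ultimately show "d.factors c \<and> d.separates c" ..
qed

end


section \<open>Coproducts, coequalizers and density\<close>

text \<open>Existence and uniqueness of mediating morphisms are separate clauses because they are
  used apart: existence to build new elements, uniqueness to compare them in the smallness and
  induction arguments.\<close>

definition coproduct :: "('o, 'm) cat \<Rightarrow> 'i set \<Rightarrow> ('i \<Rightarrow> 'o) \<Rightarrow> 'o \<Rightarrow> ('i \<Rightarrow> 'm) \<Rightarrow> bool" where
  "coproduct C N d c \<iota> \<longleftrightarrow> (\<forall>n\<in>N. \<iota> n \<in> hom C (d n) c) \<and>
     (\<forall>c' f. c' \<in> Ob C \<longrightarrow> (\<forall>n\<in>N. f n \<in> hom C (d n) c') \<longrightarrow>
        (\<exists>h\<in>hom C c c'. \<forall>n\<in>N. Comp C h (\<iota> n) = f n)) \<and>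
     (\<forall>c' h k. h \<in> hom C c c' \<longrightarrow> k \<in> hom C c c' \<longrightarrow>
        (\<forall>n\<in>N. Comp C h (\<iota> n) = Comp C k (\<iota> n)) \<longrightarrow> h = k)"

definition coequalizer :: "('o, 'm) cat \<Rightarrow> 'o \<Rightarrow> 'm set \<Rightarrow> 'o \<Rightarrow> 'm \<Rightarrow> bool" where
  "coequalizer C Y H c q \<longleftrightarrow> q \<in> hom C Y c \<and> (\<forall>h\<in>H. \<forall>h'\<in>H. Comp C q h = Comp C q h') \<and>
     (\<forall>c' f. f \<in> hom C Y c' \<longrightarrow> (\<forall>h\<in>H. \<forall>h'\<in>H. Comp C f h = Comp C f h') \<longrightarrow>
        (\<exists>k\<in>hom C c c'. Comp C k q = f)) \<and>
     (\<forall>c' k k'. k \<in> hom C c c' \<longrightarrow> k' \<in> hom C c c' \<longrightarrow> Comp C k q = Comp C k' q \<longrightarrow> k = k')"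

lemma coproductD:
  assumes "coproduct C N d c \<iota>"
  shows "n \<in> N \<Longrightarrow> \<iota> n \<in> hom C (d n) c"
    and "c' \<in> Ob C \<Longrightarrow> (\<And>n. n \<in> N \<Longrightarrow> f n \<in> hom C (d n) c') \<Longrightarrow>
      \<exists>h\<in>hom C c c'. \<forall>n\<in>N. Comp C h (\<iota> n) = f n"
    and "h \<in> hom C c c' \<Longrightarrow> k \<in> hom C c c' \<Longrightarrow>
      (\<And>n. n \<in> N \<Longrightarrow> Comp C h (\<iota> n) = Comp C k (\<iota> n)) \<Longrightarrow> h = k"
  using assms by (simp_all add: coproduct_def)

lemma coequalizerD:
  assumes "coequalizer C Y H c q"
  shows "q \<in> hom C Y c" and "h \<in> H \<Longrightarrow> h' \<in> H \<Longrightarrow> Comp C q h = Comp C q h'"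
    and "f \<in> hom C Y c' \<Longrightarrow> (\<And>h h'. h \<in> H \<Longrightarrow> h' \<in> H \<Longrightarrow> Comp C f h = Comp C f h') \<Longrightarrow>
      \<exists>k\<in>hom C c c'. Comp C k q = f"
    and "k \<in> hom C c c' \<Longrightarrow> k' \<in> hom C c c' \<Longrightarrow> Comp C k q = Comp C k' q \<Longrightarrow> k = k'"
proof -
  note A = assms[unfolded coequalizer_def]
  note ex = A[THEN conjunct2, THEN conjunct2, THEN conjunct1, THEN spec, THEN spec, THEN mp, THEN mp]
  note uniq = A[THEN conjunct2, THEN conjunct2, THEN conjunct2, THEN spec, THEN spec, THEN spec,
      THEN mp, THEN mp, THEN mp]
  show "q \<in> hom C Y c" by (rule A[THEN conjunct1])
  show "Comp C q h = Comp C q h'" if "h \<in> H" "h' \<in> H"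
    by (rule A[THEN conjunct2, THEN conjunct1, THEN bspec, THEN bspec, OF that])
  show "\<exists>k\<in>hom C c c'. Comp C k q = f"
    if "f \<in> hom C Y c'" "\<And>h h'. h \<in> H \<Longrightarrow> h' \<in> H \<Longrightarrow> Comp C f h = Comp C f h'"
    by (rule ex[OF that(1)]) (intro ballI that(2))
  show "k = k'" if "k \<in> hom C c c'" "k' \<in> hom C c c'" "Comp C k q = Comp C k' q"
    by (rule uniq[OF that])
qed

lemma coproduct_colimit:
  assumes C: "category C" and d: "\<And>n. n \<in> N \<Longrightarrow> d n \<in> Ob C"
    and c: "colimit C (disc_cat N) (disc_functor C d) c \<iota>"
  shows "coproduct C N d c \<iota>"
  unfolding coproduct_def
proof (intro conjI allI impI)
  have d': "d \<in> N \<rightarrow> Ob C" using d by blast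
  note co = colimit_cocone[OF c, unfolded disc_cocone[OF C]]
  show "\<forall>n\<in>N. \<iota> n \<in> hom C (d n) c" using co by simp
  show "\<exists>h\<in>hom C c c'. \<forall>n\<in>N. Comp C h (\<iota> n) = f n"
    if "c' \<in> Ob C" "\<forall>n\<in>N. f n \<in> hom C (d n) c'" for c' f
  proof -
    have "cocone C (disc_cat N) (disc_functor C d) c' f" using that by (simp add: disc_cocone[OF C])
    from colimit_factor[OF c this] obtain h where "h \<in> hom C c c'"
      "\<And>n. n \<in> Ob (disc_cat N) \<Longrightarrow> Comp C h (\<iota> n) = f n" by blast
    then show ?thesis by (intro bexI[of _ h] ballI) (simp_all add: disc_cat_def)
  qed
  show "h = k" if "h \<in> hom C c c'" "k \<in> hom C c c'" "\<forall>n\<in>N. Comp C h (\<iota> n) = Comp C k (\<iota> n)" for c' h k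
    by (rule colimit_eq[OF C disc_category disc_is_functor[OF C d'] c that(1,2)])
      (use that(3) in \<open>simp add: disc_cat_def\<close>)
qed

text \<open>For empty \<open>H\<close> the scheme has no arrow tying \<open>X\<close> to
  \<open>Y\<close> and its colimit is a coproduct; a member of \<open>H\<close> also provides the
  leg at \<open>X\<close>.\<close>

lemma coequalizer_colimit:
  assumes C: "category C" and XY: "X \<in> Ob C" "Y \<in> Ob C" "H \<subseteq> hom C X Y" "H \<noteq> {}"
    and c: "colimit C (par_cat H) (par_functor C X Y) c \<tau>"
  shows "coequalizer C Y H c (\<tau> True)"
proof -
  note par = par_cocone[OF C XY(1-3)]
  from colimit_cocone[OF c] have \<tau>: "\<tau> True \<in> hom C Y c" "\<And>h. h \<in> H \<Longrightarrow> Comp C (\<tau> True) h = \<tau> False"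
    by (simp_all add: par)
  have ex: "\<exists>k\<in>hom C c c'. Comp C k (\<tau> True) = f" if f: "f \<in> hom C Y c'"
    and eq: "\<forall>h\<in>H. \<forall>h'\<in>H. Comp C f h = Comp C f h'" for c' f
  proof -
    obtain h0 where h0: "h0 \<in> H" using XY(4) by blast
    have fh: "Comp C f h0 \<in> hom C X c'" using comp_in[OF C _ f] h0 XY(3) by blast
    have "\<forall>h\<in>H. Comp C f h = Comp C f h0" using eq h0 by blast
    then have "cocone C (par_cat H) (par_functor C X Y) c' (\<lambda>b. if b then f else Comp C f h0)"
      using f fh by (simp add: par)
    from colimit_factor[OF c this] obtain k where "k \<in> hom C c c'"
      "\<And>b. b \<in> Ob (par_cat H) \<Longrightarrow> Comp C k (\<tau> b) = (if b then f else Comp C f h0)" by blast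
    from this(1) this(2)[of True] show ?thesis by (intro bexI[of _ k]) (simp_all add: par_cat_def)
  qed
  have uniq: "k = k'" if k: "k \<in> hom C c c'" "k' \<in> hom C c c'" and
    eq: "Comp C k (\<tau> True) = Comp C k' (\<tau> True)" for c' k k'
  proof (rule colimit_eq[OF C par_category par_is_functor[OF C XY(1-3)] c k])
    fix b
    obtain h0 where h0: "h0 \<in> H" "h0 \<in> hom C X Y" using XY(3,4) by blast
    have "Comp C k (Comp C (\<tau> True) h0) = Comp C k' (Comp C (\<tau> True) h0)"
      using eq comp_assoc[OF C h0(2) \<tau>(1) k(1)] comp_assoc[OF C h0(2) \<tau>(1) k(2)] by simp
    then show "Comp C k (\<tau> b) = Comp C k' (\<tau> b)" using eq \<tau>(2)[OF h0(1)] by (cases b) simp_all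
  qed
  show ?thesis
    unfolding coequalizer_def
  proof (intro conjI ballI allI impI)
    show "\<tau> True \<in> hom C Y c" by (rule \<tau>)
    show "Comp C (\<tau> True) h = Comp C (\<tau> True) h'" if "h \<in> H" "h' \<in> H" for h h'
      using \<tau>(2)[OF that(1)] \<tau>(2)[OF that(2)] by simp
  qed (rule ex uniq; assumption)+
qed

locale cocomplete_base = base U r C
  for U :: "'u itself" and r :: "'l rel" and C :: "('o, 'm) cat" +
  assumes cocomp: "cocomplete U C"
begin

lemma coproduct_ex:
  assumes N: "|N| <o r" and d: "\<And>n. n \<in> N \<Longrightarrow> presentable U r C (d n)"
  obtains c \<iota> where "colimit C (disc_cat N) (disc_functor C d) c \<iota>" "presentable U r C c"
proof -
  have d': "d \<in> N \<rightarrow> Ob C" using presentable_ob[OF d] by blast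
  have "small_category U (disc_cat N)"
    using small_lt[OF small_r r N] disc_category[of N] by (simp add: small_category_def disc_cat_def)
  then obtain c \<iota> where c: "colimit C (disc_cat N) (disc_functor C d) c \<iota>"
    using cocomplete_colimit[OF cocomp _ disc_is_functor[OF C d']] by blast
  have "presentable U r C c"
    by (rule presentable_colimit[OF disc_category _ disc_is_functor[OF C d'] _ c])
      (use N d in \<open>simp_all add: disc_cat_def disc_functor_def\<close>)
  with c show thesis by (rule that)
qed

lemma coequalizer_ex:
  assumes H: "|H| <o r" "H \<subseteq> hom C X Y" and X: "presentable U r C X" and Y: "presentable U r C Y"
  obtains c \<tau> where "colimit C (par_cat H) (par_functor C X Y) c \<tau>" "presentable U r C c"
proof -
  note XY = presentable_ob[OF X] presentable_ob[OF Y]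
  have A: "|Arr (par_cat H)| <o r"
    using H(1) by (simp add: par_cat_def lt_Un[OF r(1)] lt_image lt_finite[OF r(1)])
  then have "small_category U (par_cat H)"
    using small_lt[OF small_r r A] small_lt[OF small_r r card_Ob[OF par_category A]] par_category[of H]
    by (simp add: small_category_def)
  then obtain c \<tau> where c: "colimit C (par_cat H) (par_functor C X Y) c \<tau>"
    using cocomplete_colimit[OF cocomp _ par_is_functor[OF C XY H(2)]] by blast
  have "presentable U r C c"
    by (rule presentable_colimit[OF par_category A par_is_functor[OF C XY H(2)] _ c])
      (use X Y in \<open>simp add: par_functor_def\<close>)
  with c show thesis by (rule that)
qed

end

text \<open>\<open>gen\<close> asks only for diagrams of presentable objects. The generating set of
  \<open>locally_presentable\<close> disappears, since \<open>P\<close> represents all presentable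
  objects up to isomorphism.\<close>

locale lp_cat = cocomplete_base U r K
  for U :: "'u itself" and r :: "'l rel" and K :: "('o, 'm) cat" +
  fixes P :: "'o set"
  assumes P_small: "small U P" and P_pres: "X \<in> P \<Longrightarrow> presentable U r K X"
    and P_rep: "presentable U r K X \<Longrightarrow> \<exists>Y\<in>P. isomorphic K X Y"
    and gen: "X \<in> Ob K \<Longrightarrow> \<exists>(J :: ('u, 'u) cat) D \<tau>. small_category U J \<and> filtered r J \<and>
      is_functor J K D \<and> (\<forall>i\<in>Ob J. presentable U r K (omap D i)) \<and> colimit K J D X \<tau>"
begin

lemma P_ob: "X \<in> P \<Longrightarrow> X \<in> Ob K"
  using presentable_ob[OF P_pres] .

lemma isoE:
  assumes "presentable U r K X"
  obtains Y a b where "Y \<in> P" "a \<in> hom K X Y" "b \<in> hom K Y X"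
    "Comp K b a = Id K X" "Comp K a b = Id K Y"
  using P_rep[OF assms] unfolding isomorphic_def by blast

text \<open>The colimit is presentable and may therefore be replaced by an isomorphic member of
  \<open>P\<close>, which keeps the arities of generated elements in a small set.\<close>

lemma P_coproduct:
  assumes N: "|N| <o r" and d: "\<And>n. n \<in> N \<Longrightarrow> d n \<in> P"
  shows "\<exists>c \<iota>. c \<in> P \<and> coproduct K N d c \<iota>"
proof -
  obtain c \<iota> where c: "colimit K (disc_cat N) (disc_functor K d) c \<iota>" "presentable U r K c"
    using coproduct_ex[OF N P_pres[OF d]] .
  obtain c' a b where c': "c' \<in> P" "a \<in> hom K c c'" "b \<in> hom K c' c" "Comp K b a = Id K c" "Comp K a b = Id K c'"
    using isoE[OF c(2)] .
  have d': "d \<in> N \<rightarrow> Ob K" using P_ob[OF d] by blast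
  from colimit_iso[OF C disc_category disc_is_functor[OF C d'] c(1) c'(2-5)]
  have "coproduct K N d c' (\<lambda>n. Comp K a (\<iota> n))" by (intro coproduct_colimit[OF C] P_ob d)
  with c'(1) show ?thesis by blast
qed

lemma P_coequalizer:
  assumes H: "|H| <o r" "H \<subseteq> hom K X Y" "H \<noteq> {}" and X: "X \<in> P" and Y: "Y \<in> P"
  shows "\<exists>c q. c \<in> P \<and> coequalizer K Y H c q"
proof -
  obtain c \<tau> where c: "colimit K (par_cat H) (par_functor K X Y) c \<tau>" "presentable U r K c"
    using coequalizer_ex[OF H(1,2) P_pres[OF X] P_pres[OF Y]] .
  obtain c' a b where c': "c' \<in> P" "a \<in> hom K c c'" "b \<in> hom K c' c" "Comp K b a = Id K c" "Comp K a b = Id K c'"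
    using isoE[OF c(2)] .
  note XY = P_ob[OF X] P_ob[OF Y] H(2)
  from colimit_iso[OF C par_category par_is_functor[OF C XY] c(1) c'(2-5)]
  have "coequalizer K Y H c' (Comp K a (\<tau> True))" by (rule coequalizer_colimit[OF C XY H(3)])
  with c'(1) show ?thesis by blast
qed

text \<open>\<open>P\<close> is a generator: every object is a colimit of presentable objects, and
  each of these has an isomorphic copy in \<open>P\<close> on which the leg can be tested.\<close>

lemma P_separate:
  assumes f: "f \<in> hom K A B" and g: "g \<in> hom K A B"
    and eq: "\<And>X x. X \<in> P \<Longrightarrow> x \<in> hom K X A \<Longrightarrow> Comp K f x = Comp K g x"
  shows "f = g"
proof -
  have "A \<in> Ob K" using hom_ob[OF C f] by simp
  from gen[OF this] obtain J :: "('u, 'u) cat" and D \<tau> where J: "small_category U J" "filtered r J"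
    "is_functor J K D" "\<And>i. i \<in> Ob J \<Longrightarrow> presentable U r K (omap D i)" "colimit K J D A \<tau>" by blast
  have J_cat: "category J" using J(1) by (simp add: small_category_def)
  show ?thesis
  proof (rule colimit_eq[OF C J_cat J(3,5) f g])
    fix i assume i: "i \<in> Ob J"
    note t = cocone_hom[OF colimit_cocone[OF J(5)] i]
    obtain X a b where X: "X \<in> P" "a \<in> hom K (omap D i) X" "b \<in> hom K X (omap D i)"
      "Comp K b a = Id K (omap D i)" using isoE[OF J(4)[OF i]] .
    have "Comp K (Comp K f (\<tau> i)) b = Comp K (Comp K g (\<tau> i)) b"
      using eq[OF X(1) comp_in[OF C X(3) t]] comp_assoc[OF C X(3) t f] comp_assoc[OF C X(3) t g] by simp
    then have "Comp K (Comp K f (\<tau> i)) (Comp K b a) = Comp K (Comp K g (\<tau> i)) (Comp K b a)"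
      using comp_assoc[OF C X(2,3) comp_in[OF C t f]] comp_assoc[OF C X(2,3) comp_in[OF C t g]] by simp
    then show "Comp K f (\<tau> i) = Comp K g (\<tau> i)"
      by (simp add: X(4) comp_id[OF C comp_in[OF C t f]] comp_id[OF C comp_in[OF C t g]])
  qed
qed

text \<open>\<open>P\<close> is dense: a natural transformation between hom-functors restricted to
  \<open>P\<close> comes from a morphism. It is built on a presentation of \<open>A\<close> by
  presentable objects; presentability of \<open>Y\<close> then gives the formula for every
  \<open>Y\<close>-element of \<open>A\<close> and not only for the legs.\<close>

lemma P_extend:
  assumes A: "A \<in> Ob K" and B: "B \<in> Ob K"
    and \<phi>: "\<And>X x. X \<in> P \<Longrightarrow> x \<in> hom K X A \<Longrightarrow> \<phi> X x \<in> hom K X B"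
    and nat: "\<And>X Y u x. X \<in> P \<Longrightarrow> Y \<in> P \<Longrightarrow> u \<in> hom K Y X \<Longrightarrow> x \<in> hom K X A \<Longrightarrow>
      \<phi> Y (Comp K x u) = Comp K (\<phi> X x) u"
  obtains h where "h \<in> hom K A B" "\<forall>X\<in>P. \<forall>x\<in>hom K X A. Comp K h x = \<phi> X x"
proof -
  from gen[OF A] obtain J :: "('u, 'u) cat" and D \<tau> where J: "small_category U J" "filtered r J"
    "is_functor J K D" "\<And>i. i \<in> Ob J \<Longrightarrow> presentable U r K (omap D i)" "colimit K J D A \<tau>" by blast
  have J_cat: "category J" using J(1) by (simp add: small_category_def)
  have J_filt: "filt r J" by (rule filtered_filt[OF J(2) r small_r])
  note \<tau> = cocone_hom[OF colimit_cocone[OF J(5)]]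
  have "\<exists>X a b. X \<in> P \<and> a \<in> hom K (omap D i) X \<and> b \<in> hom K X (omap D i) \<and>
      Comp K b a = Id K (omap D i)" if "i \<in> Ob J" for i
    using isoE[OF J(4)[OF that]] by metis
  then obtain X a b where X: "\<And>i. i \<in> Ob J \<Longrightarrow> X i \<in> P"
    and a: "\<And>i. i \<in> Ob J \<Longrightarrow> a i \<in> hom K (omap D i) (X i)"
    and b: "\<And>i. i \<in> Ob J \<Longrightarrow> b i \<in> hom K (X i) (omap D i)"
    and ba: "\<And>i. i \<in> Ob J \<Longrightarrow> Comp K (b i) (a i) = Id K (omap D i)" by metis
  note \<tau>b = comp_in[OF C b \<tau>]
  \<comment> \<open>The object at stage \<open>i\<close> need not be in \<open>P\<close>, so
    \<open>\<phi>\<close> is applied to the copy \<open>X i\<close> and the result is moved back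
    along \<open>a i\<close>.\<close>
  define \<sigma> where "\<sigma> i = Comp K (\<phi> (X i) (Comp K (\<tau> i) (b i))) (a i)" for i
  have \<sigma>: "Comp K (\<sigma> i) g = \<phi> Y (Comp K (\<tau> i) g)" if i: "i \<in> Ob J" and Y: "Y \<in> P" and g: "g \<in> hom K Y (omap D i)" for i Y g
  proof -
    have "Comp K (\<sigma> i) g = Comp K (\<phi> (X i) (Comp K (\<tau> i) (b i))) (Comp K (a i) g)"
      unfolding \<sigma>_def by (rule comp_assoc[OF C g a[OF i] \<phi>[OF X[OF i] \<tau>b[OF i i]]])
    also have "\<dots> = \<phi> Y (Comp K (Comp K (\<tau> i) (b i)) (Comp K (a i) g))"
      by (rule nat[OF X[OF i] Y comp_in[OF C g a[OF i]] \<tau>b[OF i i], symmetric])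
    also have "Comp K (Comp K (\<tau> i) (b i)) (Comp K (a i) g) = Comp K (\<tau> i) (Comp K (Comp K (b i) (a i)) g)"
      using comp_assoc[OF C comp_in[OF C g a[OF i]] b[OF i] \<tau>[OF i]] comp_assoc[OF C g a[OF i] b[OF i]] by simp
    also have "\<dots> = Comp K (\<tau> i) g" by (simp add: ba[OF i] id_comp[OF C g])
    finally show ?thesis .
  qed
  have "cocone K J D B \<sigma>"
  proof (rule coconeI[OF B])
    show \<sigma>_in: "\<sigma> i \<in> hom K (omap D i) B" if i: "i \<in> Ob J" for i
      unfolding \<sigma>_def by (rule comp_in[OF C a[OF i] \<phi>[OF X[OF i] \<tau>b[OF i i]]])
    fix i j d assume d: "d \<in> hom J i j"
    then have ij: "i \<in> Ob J" "j \<in> Ob J" using hom_ob[OF J_cat] by auto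
    note Dd = functor_hom[OF J(3) d]
    show "Comp K (\<sigma> j) (amap D d) = \<sigma> i"
    proof (rule P_separate[OF comp_in[OF C Dd \<sigma>_in[OF ij(2)]] \<sigma>_in[OF ij(1)]])
      fix Y x assume Y: "Y \<in> P" and x: "x \<in> hom K Y (omap D i)"
      have "Comp K (Comp K (\<sigma> j) (amap D d)) x = \<phi> Y (Comp K (\<tau> j) (Comp K (amap D d) x))"
        using comp_assoc[OF C x Dd \<sigma>_in[OF ij(2)]] \<sigma>[OF ij(2) Y comp_in[OF C x Dd]] by simp
      also have "Comp K (\<tau> j) (Comp K (amap D d) x) = Comp K (\<tau> i) x"
        using comp_assoc[OF C x Dd \<tau>[OF ij(2)]] cocone_comp[OF colimit_cocone[OF J(5)] d] by simp
      finally show "Comp K (Comp K (\<sigma> j) (amap D d)) x = Comp K (\<sigma> i) x" using \<sigma>[OF ij(1) Y x] by simp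
    qed
  qed
  from colimit_factor[OF J(5) this] obtain h where h: "h \<in> hom K A B" "\<And>i. i \<in> Ob J \<Longrightarrow> Comp K h (\<tau> i) = \<sigma> i"
    by blast
  interpret d: diagram_in U r K J D A \<tau> by (rule diagram_inI[OF J(1) J_filt J(3,5)])
  have "Comp K h x = \<phi> Y x" if Y: "Y \<in> P" and x: "x \<in> hom K Y A" for Y x
  proof -
    have "d.factors Y" using presentableD[OF P_pres[OF Y] J(1) J_filt J(3,5)] by simp
    from d.factorsE[OF this x] obtain i g where ig: "i \<in> Ob J" "g \<in> hom K Y (omap D i)" "Comp K (\<tau> i) g = x" .
    then show ?thesis using comp_assoc[OF C ig(2) \<tau>[OF ig(1)] h(1)] h(2)[OF ig(1)] \<sigma>[OF ig(1) Y ig(2)] by simp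
  qed
  with h(1) show thesis by (intro that ballI)
qed

end

lemma lp_catI:
  assumes "universe U" "regular_cardinal r" "small U (Field r)" "locally_presentable U r K"
    and "representative_presentables U r K P"
  shows "lp_cat U r K P"
proof
  fix X assume X: "X \<in> Ob K"
  from assms(4) obtain G where G: "\<forall>X\<in>G. presentable U r K X"
    and "\<forall>X\<in>Ob K. \<exists>(J :: ('a, 'a) cat) D \<tau>. small_category U J \<and> filtered r J \<and>
      is_functor J K D \<and> (\<forall>i\<in>Ob J. omap D i \<in> G) \<and> colimit K J D X \<tau>"
    unfolding locally_presentable_def by blast
  with X obtain J :: "('a, 'a) cat" and D \<tau> where "small_category U J" "filtered r J"
    "is_functor J K D" "\<forall>i\<in>Ob J. omap D i \<in> G" "colimit K J D X \<tau>" by blast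
  with G show "\<exists>(J :: ('a, 'a) cat) D \<tau>. small_category U J \<and> filtered r J \<and>
      is_functor J K D \<and> (\<forall>i\<in>Ob J. presentable U r K (omap D i)) \<and> colimit K J D X \<tau>" by blast
qed (use assms in \<open>simp_all add: locally_presentable_def representative_presentables_def\<close>)


section \<open>The category of algebras\<close>

locale theory_on = lp_cat U r K P
  for U :: "'u itself" and r :: "'l rel" and K :: "('o, 'm) cat" and P :: "'o set" +
  fixes E :: "('o, 'm, 'w) eq_theory"
  assumes E: "equational_theory U K P E"
begin

abbreviation comp (infixr \<open>\<odot>\<close> 70) where "g \<odot> f \<equiv> Comp K g f"

abbreviation "Alg \<equiv> alg_cat K P E"
abbreviation "algs \<equiv> algebras K P E"
abbreviation "src w \<equiv> fst (ar E w)"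
abbreviation "tgt w \<equiv> snd (ar E w)"
abbreviation "hm \<equiv> homomorphism K E"

lemma arity: "w \<in> ops E \<Longrightarrow> src w \<in> P \<and> tgt w \<in> P"
  using E unfolding equational_theory_def by (force dest: funcset_mem)

lemma algs_type: "B \<in> algs \<Longrightarrow> B \<in> type_algebras K E"
  by (simp add: algebras_def)

lemma alg_ob: "B \<in> type_algebras K E \<Longrightarrow> fst B \<in> Ob K"
  by (auto simp: type_algebras_def)

lemma op_in:
  assumes "B \<in> type_algebras K E" "w \<in> ops E" "g \<in> hom K (src w) (fst B)"
  shows "snd B w g \<in> hom K (tgt w) (fst B)"
proof -
  have "snd B \<in> (\<Pi>\<^sub>E w\<in>ops E. hom K (src w) (fst B) \<rightarrow>\<^sub>E hom K (tgt w) (fst B))"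
    using assms(1) by (simp add: type_algebras_def split_beta)
  from PiE_mem[OF PiE_mem[OF this assms(2)] assms(3)] show ?thesis .
qed

lemma type_algebra_eqI:
  assumes B: "B \<in> type_algebras K E" and C: "C \<in> type_algebras K E" and eq: "fst B = fst C"
    and ops: "\<And>w g. w \<in> ops E \<Longrightarrow> g \<in> hom K (src w) (fst B) \<Longrightarrow> snd B w g = snd C w g"
  shows "B = C"
proof -
  have 1: "snd B \<in> (\<Pi>\<^sub>E w\<in>ops E. hom K (src w) (fst B) \<rightarrow>\<^sub>E hom K (tgt w) (fst B))"
    using B by (simp add: type_algebras_def split_beta)
  have 2: "snd C \<in> (\<Pi>\<^sub>E w\<in>ops E. hom K (src w) (fst B) \<rightarrow>\<^sub>E hom K (tgt w) (fst B))"
    using C by (simp add: type_algebras_def split_beta eq)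
  have "snd B = snd C"
  proof (rule PiE_ext[OF 1 2])
    fix w assume w: "w \<in> ops E"
    show "snd B w = snd C w" by (rule PiE_ext[OF PiE_mem[OF 1 w] PiE_mem[OF 2 w] ops[OF w]])
  qed
  with eq show ?thesis by (rule prod_eqI)
qed

definition mk_alg :: "'o \<Rightarrow> ('w \<Rightarrow> 'm \<Rightarrow> 'm) \<Rightarrow> ('o, 'm, 'w) alg" where
  "mk_alg B f = (B, \<lambda>w\<in>ops E. \<lambda>g\<in>hom K (src w) B. f w g)"

lemma mk_alg_sel:
  "fst (mk_alg B f) = B"
  "w \<in> ops E \<Longrightarrow> g \<in> hom K (src w) B \<Longrightarrow> snd (mk_alg B f) w g = f w g"
  by (simp_all add: mk_alg_def)

lemma mk_alg_type:
  assumes "B \<in> Ob K"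
    and "\<And>w g. w \<in> ops E \<Longrightarrow> g \<in> hom K (src w) B \<Longrightarrow> f w g \<in> hom K (tgt w) B"
  shows "mk_alg B f \<in> type_algebras K E"
  using assms by (simp add: type_algebras_def mk_alg_def PiE_iff)

lemma hm_hom: "hm B h C \<Longrightarrow> h \<in> hom K (fst B) (fst C)"
  and hm_op: "hm B h C \<Longrightarrow> w \<in> ops E \<Longrightarrow> g \<in> hom K (src w) (fst B) \<Longrightarrow>
    h \<odot> snd B w g = snd C w (h \<odot> g)"
  by (simp_all add: homomorphism_def)

lemma hmI: "h \<in> hom K (fst B) (fst C) \<Longrightarrow>
    (\<And>w g. w \<in> ops E \<Longrightarrow> g \<in> hom K (src w) (fst B) \<Longrightarrow> h \<odot> snd B w g = snd C w (h \<odot> g)) \<Longrightarrow> hm B h C"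
  by (simp add: homomorphism_def)

lemma hm_id: "B \<in> type_algebras K E \<Longrightarrow> hm B (Id K (fst B)) B"
  by (rule hmI) (simp_all add: id_in[OF C alg_ob] id_comp[OF C] op_in id_comp[OF C op_in])

lemma hm_comp:
  assumes B: "B \<in> type_algebras K E" and h: "hm B h D" and k: "hm D k F"
  shows "hm B (k \<odot> h) F"
proof (rule hmI)
  note h' = hm_hom[OF h] and k' = hm_hom[OF k]
  show "k \<odot> h \<in> hom K (fst B) (fst F)" by (rule comp_in[OF C h' k'])
  fix w g assume w: "w \<in> ops E" and g: "g \<in> hom K (src w) (fst B)"
  show "(k \<odot> h) \<odot> snd B w g = snd F w ((k \<odot> h) \<odot> g)"
    using comp_assoc[OF C op_in[OF B w g] h' k'] comp_assoc[OF C g h' k'] hm_op[OF h w g]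
      hm_op[OF k w comp_in[OF C g h']] by simp
qed

section \<open>Terms and equations under homomorphisms\<close>

lemma raw_interp_hm:
  assumes B: "B \<in> type_algebras K E" and h: "hm B h D"
    and p: "has_arity K P E p X Y" and g: "g \<in> hom K X (fst B)"
  shows "h \<odot> raw_interp K (snd B) p g = raw_interp K (snd D) p (h \<odot> g)"
  using p g
proof (induction arbitrary: g)
  case (opn w X Y)
  then show ?case using hm_op[OF h opn(1)] by simp
next
  case (var X Y f)
  then show ?case using comp_assoc[OF C var(3) var(4) hm_hom[OF h]] by simp
next
  case (cmp p X Y q Z)
  then show ?case using raw_interp_in_hom[OF C B cmp(1)] by simp
qed

lemma term_class:
  assumes B: "B \<in> type_algebras K E" and T: "T \<in> terms_of K P E X Y"
  shows "\<exists>p. p \<in> T" and "p \<in> T \<Longrightarrow> has_arity K P E p X Y"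
proof -
  obtain s where s: "has_arity K P E s X Y" "T = {q. term_cong K P E X Y s q}"
    using T unfolding terms_of_def by (blast elim: quotientE)
  show "\<exists>p. p \<in> T" using term_cong.refl[OF s(1)] s(2) by blast
  show "has_arity K P E p X Y" if "p \<in> T"
    using raw_interp_cong[OF C B E] that s(2) by blast
qed

text \<open>Satisfaction by representatives of the term classes, to which the lemmas on
  \<open>raw_interp\<close> apply, in place of the function picked by
  \<open>the_elem\<close>.\<close>

definition satisfies_all :: "('o, 'm, 'w) alg \<Rightarrow> bool" where
  "satisfies_all B \<longleftrightarrow> (\<forall>e\<in>eqs E. \<forall>X Y p q. fst e \<in> terms_of K P E X Y \<longrightarrow> snd e \<in> terms_of K P E X Y \<longrightarrow>
     p \<in> fst e \<longrightarrow> q \<in> snd e \<longrightarrow> (\<forall>g\<in>hom K X (fst B). raw_interp K (snd B) p g = raw_interp K (snd B) q g))"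

lemma algs_iff: "B \<in> algs \<longleftrightarrow> B \<in> type_algebras K E \<and> satisfies_all B"
proof -
  have "(\<forall>e\<in>eqs E. satisfies K P E B e) \<longleftrightarrow> satisfies_all B" if B: "B \<in> type_algebras K E"
  proof
    assume sat: "\<forall>e\<in>eqs E. satisfies K P E B e"
    show "satisfies_all B"
      unfolding satisfies_all_def
    proof (intro ballI allI impI)
      fix e X Y p q g assume e: "e \<in> eqs E" "fst e \<in> terms_of K P E X Y" "snd e \<in> terms_of K P E X Y"
        and pq: "p \<in> fst e" "q \<in> snd e" and g: "g \<in> hom K X (fst B)"
      have "term_interp K B X (fst e) = term_interp K B X (snd e)"
        using sat e unfolding satisfies_def by blast
      then have "restrict (raw_interp K (snd B) p) (hom K X (fst B)) =
          restrict (raw_interp K (snd B) q) (hom K X (fst B))"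
        by (simp only: term_interp_eq[OF C B E e(2) pq(1)] term_interp_eq[OF C B E e(3) pq(2)])
      from fun_cong[OF this, of g] g show "raw_interp K (snd B) p g = raw_interp K (snd B) q g" by simp
    qed
  next
    assume sat: "satisfies_all B"
    show "\<forall>e\<in>eqs E. satisfies K P E B e"
      unfolding satisfies_def
    proof (intro ballI allI impI)
      fix e X Y assume e: "e \<in> eqs E" "fst e \<in> terms_of K P E X Y" "snd e \<in> terms_of K P E X Y"
      obtain p q where pq: "p \<in> fst e" "q \<in> snd e" using term_class(1)[OF B] e by blast
      have "raw_interp K (snd B) p g = raw_interp K (snd B) q g" if "g \<in> hom K X (fst B)" for g
        using sat e pq that unfolding satisfies_all_def by blast
      then show "term_interp K B X (fst e) = term_interp K B X (snd e)"
        unfolding term_interp_eq[OF C B E e(2) pq(1)] term_interp_eq[OF C B E e(3) pq(2)]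
        by (rule restrict_ext)
    qed
  qed
  then show ?thesis by (auto simp: algebras_def)
qed

lemma satisfies_allE:
  assumes "B \<in> algs" "e \<in> eqs E" "fst e \<in> terms_of K P E X Y" "snd e \<in> terms_of K P E X Y"
    "p \<in> fst e" "q \<in> snd e" "g \<in> hom K X (fst B)"
  shows "raw_interp K (snd B) p g = raw_interp K (snd B) q g"
  using assms unfolding algs_iff satisfies_all_def by blast

text \<open>The analogue of closure under subalgebras of products: homomorphisms commute with terms,
  so the two sides of an equation have the same image in every \<open>A s\<close>. Values of terms
  have arity in \<open>P\<close>, which is where joint monicity is used.\<close>

lemma algs_jointly_mono:
  assumes B: "B \<in> type_algebras K E" and h: "\<And>s. s \<in> S \<Longrightarrow> A s \<in> algs \<and> hm B (h s) (A s)"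
    and mono: "\<And>X x y. X \<in> P \<Longrightarrow> x \<in> hom K X (fst B) \<Longrightarrow> y \<in> hom K X (fst B) \<Longrightarrow>
      (\<forall>s\<in>S. h s \<odot> x = h s \<odot> y) \<Longrightarrow> x = y"
  shows "B \<in> algs"
  unfolding algs_iff satisfies_all_def
proof (intro conjI ballI allI impI B)
  fix e X Y p q g assume e: "e \<in> eqs E" "fst e \<in> terms_of K P E X Y" "snd e \<in> terms_of K P E X Y"
    and pq: "p \<in> fst e" "q \<in> snd e" and g: "g \<in> hom K X (fst B)"
  note p = term_class(2)[OF B e(2) pq(1)] and q = term_class(2)[OF B e(3) pq(2)]
  have Y: "Y \<in> P" using has_arity_objects[OF E p] by simp
  show "raw_interp K (snd B) p g = raw_interp K (snd B) q g"
  proof (rule mono[OF Y raw_interp_in_hom[OF C B p g] raw_interp_in_hom[OF C B q g]], rule ballI)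
    fix s assume "s \<in> S"
    then have hs: "hm B (h s) (A s)" and A: "A s \<in> algs" using h by blast+
    show "h s \<odot> raw_interp K (snd B) p g = h s \<odot> raw_interp K (snd B) q g"
      unfolding raw_interp_hm[OF B hs p g] raw_interp_hm[OF B hs q g]
      by (rule satisfies_allE[OF A e pq comp_in[OF C g hm_hom[OF hs]]])
  qed
qed

text \<open>The analogue of closure under quotients: a term at \<open>g\<close> is the image of the
  same term at a preimage of \<open>g\<close>. The covering algebra may depend on the element, as is
  the case in a filtered colimit.\<close>

lemma algs_cover:
  assumes B: "B \<in> type_algebras K E"
    and cov: "\<And>X g. X \<in> P \<Longrightarrow> g \<in> hom K X (fst B) \<Longrightarrow>
      \<exists>A h g'. A \<in> algs \<and> hm A h B \<and> g' \<in> hom K X (fst A) \<and> h \<odot> g' = g"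
  shows "B \<in> algs"
  unfolding algs_iff satisfies_all_def
proof (intro conjI ballI allI impI B)
  fix e X Y p q g assume e: "e \<in> eqs E" "fst e \<in> terms_of K P E X Y" "snd e \<in> terms_of K P E X Y"
    and pq: "p \<in> fst e" "q \<in> snd e" and g: "g \<in> hom K X (fst B)"
  note p = term_class(2)[OF B e(2) pq(1)] and q = term_class(2)[OF B e(3) pq(2)]
  have X: "X \<in> P" using has_arity_objects[OF E p] by simp
  obtain A h g' where A: "A \<in> algs" "hm A h B" "g' \<in> hom K X (fst A)" "h \<odot> g' = g"
    using cov[OF X g] by blast
  note A' = algs_type[OF A(1)]
  show "raw_interp K (snd B) p g = raw_interp K (snd B) q g"
    using raw_interp_hm[OF A' A(2) p A(3)] raw_interp_hm[OF A' A(2) q A(3)]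
      satisfies_allE[OF A(1) e pq A(3)] A(4) by simp
qed


subsection \<open>Basic properties of \<open>Alg\<close>\<close>

lemma Alg_hom: "f \<in> hom Alg B D \<longleftrightarrow> (\<exists>h. f = (B, h, D) \<and> B \<in> algs \<and> D \<in> algs \<and> hm B h D)"
  by (auto simp: hom_def alg_cat_def)

lemma Alg_homI: "B \<in> algs \<Longrightarrow> D \<in> algs \<Longrightarrow> hm B h D \<Longrightarrow> (B, h, D) \<in> hom Alg B D"
  by (simp add: Alg_hom)

lemma Alg_homE:
  assumes "f \<in> hom Alg B D"
  obtains h where "f = (B, h, D)" "B \<in> algs" "D \<in> algs" "hm B h D"
  using assms by (auto simp: Alg_hom)

lemma Alg_sel [simp]: "Ob Alg = algs" "Comp Alg (B, k, D) (B', h, B'') = (B', k \<odot> h, D)"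
    "Id Alg B = (B, Id K (fst B), B)"
  by (simp_all add: alg_cat_def)

lemma forget_sel [simp]: "omap alg_forget B = fst B" "amap alg_forget (B, h, D) = h"
  by (simp_all add: alg_forget_def)

lemma Alg_category: "category Alg"
proof (rule categoryI)
  show "Dom Alg f \<in> Ob Alg \<and> Cod Alg f \<in> Ob Alg" if "f \<in> Arr Alg" for f
    using that by (auto simp: alg_cat_def)
  show "Id Alg X \<in> hom Alg X X" if "X \<in> Ob Alg" for X
    using that by (simp add: Alg_hom hm_id algs_type)
  show "Comp Alg g f \<in> hom Alg X Z" if "f \<in> hom Alg X Y" "g \<in> hom Alg Y Z" for X Y Z f g
    using that by (elim Alg_homE) (simp add: Alg_hom hm_comp algs_type)
  show "Comp Alg f (Id Alg X) = f \<and> Comp Alg (Id Alg Y) f = f" if "f \<in> hom Alg X Y" for X Y f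
    using that by (elim Alg_homE) (simp add: comp_id[OF C hm_hom] id_comp[OF C hm_hom])
  show "Comp Alg h (Comp Alg g f) = Comp Alg (Comp Alg h g) f"
    if "f \<in> hom Alg W X" "g \<in> hom Alg X Y" "h \<in> hom Alg Y Z" for W X Y Z f g h
    using that by (elim Alg_homE) (simp add: comp_assoc[OF C hm_hom hm_hom hm_hom])
qed

lemma Alg_locally_small: "locally_small U Alg"
  unfolding locally_small_def
proof (intro ballI)
  fix B D assume "B \<in> Ob Alg" "D \<in> Ob Alg"
  then have "small U (hom K (fst B) (fst D))"
    using C_small alg_ob[OF algs_type] by (simp add: locally_small_def)
  moreover have "hom Alg B D \<subseteq> (\<lambda>h. (B, h, D)) ` hom K (fst B) (fst D)"
    using hm_hom by (auto simp: Alg_hom)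
  ultimately show "small U (hom Alg B D)" by (rule small_surj)
qed

lemma Alg_base: "base U r Alg"
  by unfold_locales (rule U r small_r Alg_category Alg_locally_small)+

lemma forget_functor: "is_functor Alg K alg_forget"
proof (rule is_functorI)
  show "omap alg_forget X \<in> Ob K" if "X \<in> Ob Alg" for X using that by (simp add: alg_ob algs_type)
  show "amap alg_forget f \<in> hom K (omap alg_forget X) (omap alg_forget Y)" if "f \<in> hom Alg X Y" for X Y f
    using that by (elim Alg_homE) (simp add: hm_hom)
  show "amap alg_forget (Comp Alg g f) = amap alg_forget g \<odot> amap alg_forget f"
    if "f \<in> hom Alg X Y" "g \<in> hom Alg Y Z" for X Y Z f g
    using that by (elim Alg_homE) simp
qed simp


subsection \<open>Filtered colimits of algebras\<close>

lemma filtered_colimit: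
  fixes J :: "('i, 'j) cat"
  assumes J: "small_category U J" "filt r J" and D: "is_functor J Alg D"
    and L: "colimit K J (comp_functor alg_forget D) L \<tau>"
  obtains B where "B \<in> algs" "fst B = L" "colimit Alg J D B (\<lambda>i. (omap D i, \<tau> i, B))"
proof -
  let ?UD = "comp_functor alg_forget D"
  have UD: "is_functor J K ?UD" by (rule comp_functor_functor[OF D forget_functor])
  have UDo: "omap ?UD i = fst (omap D i)" for i by (simp add: comp_functor_def)
  interpret d: diagram_in U r K J ?UD L \<tau> by (rule diagram_inI[OF J UD L])
  have Dalg: "omap D i \<in> algs" if "i \<in> Ob J" for i using functor_ob[OF D that] by simp
  note Dtype = algs_type[OF Dalg]
  have Dhm: "hm (omap D i) (amap ?UD a) (omap D j)" "amap D a = (omap D i, amap ?UD a, omap D j)"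
    if "a \<in> hom J i j" for i j a
    using functor_hom[OF D that] by (auto simp: Alg_hom comp_functor_def)
  have \<tau>: "\<tau> i \<in> hom K (fst (omap D i)) L" if "i \<in> Ob J" for i
    using d.\<tau>_hom[OF that] by (simp add: UDo)
  have fac: "d.factors X" and sep: "d.separates X" if "X \<in> P" for X
    using presentableD[OF P_pres[OF that] J UD L] by simp_all
  \<comment> \<open>The value of an operation must not depend on the stage: two representatives of
    one element become equal later, and transition maps are homomorphisms.\<close>
  have wd: "\<tau> i \<odot> snd (omap D i) w g = \<tau> j \<odot> snd (omap D j) w g'"
    if w: "w \<in> ops E" and i: "i \<in> Ob J" and g: "g \<in> hom K (src w) (fst (omap D i))"
      and j: "j \<in> Ob J" and g': "g' \<in> hom K (src w) (fst (omap D j))" and eq: "\<tau> i \<odot> g = \<tau> j \<odot> g'"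
    for w i g j g'
  proof -
    have X: "src w \<in> P" using arity[OF w] by simp
    obtain k u v where uv: "u \<in> hom J i k" "v \<in> hom J j k" "amap ?UD u \<odot> g = amap ?UD v \<odot> g'"
      using d.separatesE2[OF sep[OF X] i g[folded UDo] j g'[folded UDo] eq] .
    have "\<tau> i \<odot> snd (omap D i) w g = \<tau> k \<odot> amap ?UD u \<odot> snd (omap D i) w g"
      by (rule d.\<tau>_comp'[where X = "tgt w", OF uv(1), symmetric]) (simp add: UDo op_in[OF Dtype[OF i] w g])
    also have "\<dots> = \<tau> k \<odot> amap ?UD v \<odot> snd (omap D j) w g'"
      using hm_op[OF Dhm(1)[OF uv(1)] w g] hm_op[OF Dhm(1)[OF uv(2)] w g'] uv(3) by simp
    also have "\<dots> = \<tau> j \<odot> snd (omap D j) w g'"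
      by (rule d.\<tau>_comp'[where X = "tgt w", OF uv(2)]) (simp add: UDo op_in[OF Dtype[OF j] w g'])
    finally show ?thesis .
  qed
  define f where "f w x = (SOME y. \<exists>i\<in>Ob J. \<exists>g\<in>hom K (src w) (fst (omap D i)).
    \<tau> i \<odot> g = x \<and> y = \<tau> i \<odot> snd (omap D i) w g)" for w x
  have f: "f w (\<tau> i \<odot> g) = \<tau> i \<odot> snd (omap D i) w g"
    if w: "w \<in> ops E" and i: "i \<in> Ob J" and g: "g \<in> hom K (src w) (fst (omap D i))" for w i g
    unfolding f_def
  proof (rule some_equality)
    show "\<exists>i'\<in>Ob J. \<exists>g'\<in>hom K (src w) (fst (omap D i')). \<tau> i' \<odot> g' = \<tau> i \<odot> g \<and>
        \<tau> i \<odot> snd (omap D i) w g = \<tau> i' \<odot> snd (omap D i') w g'"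
      by (rule bexI[OF _ i], rule bexI[OF _ g]) simp
    fix y assume "\<exists>i'\<in>Ob J. \<exists>g'\<in>hom K (src w) (fst (omap D i')). \<tau> i' \<odot> g' = \<tau> i \<odot> g \<and>
        y = \<tau> i' \<odot> snd (omap D i') w g'"
    then obtain i' g' where "i' \<in> Ob J" "g' \<in> hom K (src w) (fst (omap D i'))" "\<tau> i' \<odot> g' = \<tau> i \<odot> g"
      "y = \<tau> i' \<odot> snd (omap D i') w g'" by (elim bexE conjE)
    then show "y = \<tau> i \<odot> snd (omap D i) w g" using wd[OF w _ _ i g] by simp
  qed
  have facE: "\<exists>i g. i \<in> Ob J \<and> g \<in> hom K X (fst (omap D i)) \<and> x = \<tau> i \<odot> g"
    if X: "X \<in> P" and x: "x \<in> hom K X L" for X x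
    using d.factorsE[OF fac[OF X] x] by (metis UDo)
  define B where "B = mk_alg L f"
  have fB: "fst B = L" by (simp add: B_def mk_alg_sel)
  have L_ob: "L \<in> Ob K" by (rule cocone_ob[OF colimit_cocone[OF L]])
  have Btype: "B \<in> type_algebras K E"
    unfolding B_def
  proof (rule mk_alg_type[OF L_ob])
    fix w x assume w: "w \<in> ops E" and x: "x \<in> hom K (src w) L"
    from facE[OF _ x] arity[OF w] obtain i g where ig: "i \<in> Ob J" "g \<in> hom K (src w) (fst (omap D i))"
      "x = \<tau> i \<odot> g" by blast
    show "f w x \<in> hom K (tgt w) L"
      unfolding ig(3) f[OF w ig(1,2)] by (rule comp_in[OF C op_in[OF Dtype[OF ig(1)] w ig(2)] \<tau>[OF ig(1)]])
  qed
  have B_op: "snd B w (\<tau> i \<odot> g) = \<tau> i \<odot> snd (omap D i) w g"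
    if "w \<in> ops E" "i \<in> Ob J" "g \<in> hom K (src w) (fst (omap D i))" for w i g
    using f[OF that] mk_alg_sel(2)[OF that(1) comp_in[OF C that(3) \<tau>[OF that(2)]]] by (simp add: B_def)
  have \<tau>hm: "hm (omap D i) (\<tau> i) B" if "i \<in> Ob J" for i
    by (rule hmI) (simp_all add: fB \<tau> that B_op)
  \<comment> \<open>Each element of the colimit with arity in \<open>P\<close> comes from a stage,
    and the stages satisfy the equations.\<close>
  have B: "B \<in> algs"
  proof (rule algs_cover[OF Btype])
    fix X g assume "X \<in> P" "g \<in> hom K X (fst B)"
    from facE[OF this[unfolded fB]] obtain i g' where "i \<in> Ob J" "g' \<in> hom K X (fst (omap D i))"
      "g = \<tau> i \<odot> g'" by blast
    then show "\<exists>A h g'. A \<in> algs \<and> hm A h B \<and> g' \<in> hom K X (fst A) \<and> h \<odot> g' = g"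
      using Dalg \<tau>hm by blast
  qed
  have "colimit Alg J D B (\<lambda>i. (omap D i, \<tau> i, B))"
  proof (rule colimitI)
    show "cocone Alg J D B (\<lambda>i. (omap D i, \<tau> i, B))"
    proof (rule coconeI)
      show "B \<in> Ob Alg" using B by simp
      show "(omap D i, \<tau> i, B) \<in> hom Alg (omap D i) B" if "i \<in> Ob J" for i
        by (rule Alg_homI[OF Dalg[OF that] B \<tau>hm[OF that]])
      show "Comp Alg (omap D j, \<tau> j, B) (amap D a) = (omap D i, \<tau> i, B)" if a: "a \<in> hom J i j" for i j a
        unfolding Dhm(2)[OF a] using d.\<tau>_comp[OF a] by simp
    qed
  next
    fix B' \<sigma> assume co: "cocone Alg J D B' \<sigma>"
    have B': "B' \<in> algs" using cocone_ob[OF co] by simp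
    define s where "s i = amap alg_forget (\<sigma> i)" for i
    have s: "\<sigma> i = (omap D i, s i, B')" "hm (omap D i) (s i) B'" if "i \<in> Ob J" for i
      using cocone_hom[OF co that] by (auto simp: Alg_hom s_def)
    have "cocone K J ?UD (fst B') s"
    proof (rule coconeI)
      show "fst B' \<in> Ob K" by (rule alg_ob[OF algs_type[OF B']])
      show "s i \<in> hom K (omap ?UD i) (fst B')" if "i \<in> Ob J" for i using hm_hom[OF s(2)[OF that]] by (simp add: UDo)
      show "s j \<odot> amap ?UD a = s i" if a: "a \<in> hom J i j" for i j a
      proof -
        have ij: "i \<in> Ob J" "j \<in> Ob J" using hom_ob[OF d.J_cat a] by auto
        show ?thesis using cocone_comp[OF co a] by (simp add: Dhm(2)[OF a] s(1)[OF ij(1)] s(1)[OF ij(2)])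
      qed
    qed
    from colimit_factor[OF L this] obtain h where h: "h \<in> hom K L (fst B')"
      "\<And>i. i \<in> Ob J \<Longrightarrow> h \<odot> \<tau> i = s i" by blast
    have h\<tau>: "h \<odot> \<tau> i \<odot> g = s i \<odot> g" if "i \<in> Ob J" "g \<in> hom K X (fst (omap D i))" for i g X
      using comp_assoc[OF C that(2) \<tau>[OF that(1)] h(1)] h(2)[OF that(1)] by simp
    have "hm B h B'"
    proof (rule hmI)
      show "h \<in> hom K (fst B) (fst B')" using h(1) by (simp add: fB)
      fix w x assume w: "w \<in> ops E" and x: "x \<in> hom K (src w) (fst B)"
      from facE x arity[OF w] obtain i g where ig: "i \<in> Ob J" "g \<in> hom K (src w) (fst (omap D i))"
        "x = \<tau> i \<odot> g" unfolding fB by blast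
      show "h \<odot> snd B w x = snd B' w (h \<odot> x)"
        unfolding ig(3) B_op[OF w ig(1,2)] h\<tau>[OF ig(1,2)] h\<tau>[OF ig(1) op_in[OF Dtype[OF ig(1)] w ig(2)]]
        by (rule hm_op[OF s(2)[OF ig(1)] w ig(2)])
    qed
    then show "\<exists>h\<in>hom Alg B B'. \<forall>i\<in>Ob J. Comp Alg h (omap D i, \<tau> i, B) = \<sigma> i"
      by (intro bexI[of _ "(B, h, B')"] Alg_homI[OF B B'] ballI) (simp_all add: h(2) s(1))
  next
    fix B' h k assume h: "h \<in> hom Alg B B'" and k: "k \<in> hom Alg B B'"
      and eq: "\<And>i. i \<in> Ob J \<Longrightarrow> Comp Alg h (omap D i, \<tau> i, B) = Comp Alg k (omap D i, \<tau> i, B)"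
    obtain h' where h': "h = (B, h', B')" "hm B h' B'" using h by (rule Alg_homE)
    obtain k' where k': "k = (B, k', B')" "hm B k' B'" using k by (rule Alg_homE)
    have "h' = k'"
    proof (rule colimit_eq[OF C d.J_cat UD L])
      show "h' \<in> hom K L (fst B')" "k' \<in> hom K L (fst B')"
        using hm_hom[OF h'(2)] hm_hom[OF k'(2)] by (simp_all add: fB)
      show "h' \<odot> \<tau> i = k' \<odot> \<tau> i" if "i \<in> Ob J" for i using eq[OF that] by (simp add: h' k')
    qed
    then show "h = k" by (simp add: h' k')
  qed
  with B fB show thesis by (rule that)
qed

text \<open>\<open>filtered_colimit\<close> treats one particular colimit in \<open>Alg\<close>; the
  given one is isomorphic to it, and the underlying isomorphism carries the colimit property over in
  \<open>K\<close>.\<close>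

lemma colimit_in_K:
  fixes J :: "('i, 'j) cat"
  assumes J: "small_category U J" "filt r J" and D: "is_functor J Alg D" and c: "colimit Alg J D c \<sigma>"
  shows "colimit K J (comp_functor alg_forget D) (fst c) (\<lambda>i. amap alg_forget (\<sigma> i))"
proof -
  let ?UD = "comp_functor alg_forget D"
  have UD: "is_functor J K ?UD" by (rule comp_functor_functor[OF D forget_functor])
  have J_cat: "category J" using J by (simp add: small_category_def)
  obtain L \<tau> where L: "colimit K J ?UD L \<tau>" using cocomplete_colimit[OF cocomp J(1) UD] .
  obtain B where B: "B \<in> algs" "fst B = L" "colimit Alg J D B (\<lambda>i. (omap D i, \<tau> i, B))"
    using filtered_colimit[OF J D L] .
  obtain h k where hk: "h \<in> hom Alg B c" "k \<in> hom Alg c B" "Comp Alg k h = Id Alg B" "Comp Alg h k = Id Alg c"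
    and h: "\<And>i. i \<in> Ob J \<Longrightarrow> Comp Alg h (omap D i, \<tau> i, B) = \<sigma> i"
    using colimit_unique[OF Alg_category J_cat D B(3) c] by blast
  obtain h' where h': "h = (B, h', c)" "hm B h' c" using hk(1) by (rule Alg_homE)
  obtain k' where k': "k = (c, k', B)" "hm c k' B" using hk(2) by (rule Alg_homE)
  have "colimit K J ?UD (fst c) (\<lambda>i. h' \<odot> \<tau> i)"
    by (rule colimit_iso[OF C J_cat UD L, of _ _ k'])
      (use hm_hom[OF h'(2)] hm_hom[OF k'(2)] hk(3,4) in \<open>simp_all add: h' k' B(2)\<close>)
  moreover have "amap alg_forget (\<sigma> i) = h' \<odot> \<tau> i" if "i \<in> Ob J" for i
    unfolding h[OF that, symmetric] by (simp add: h'(1))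
  ultimately show ?thesis by (rule colimit_cong[OF J_cat])
qed

lemma preserves: "preserves_filtered_colimits U r Alg K alg_forget"
  unfolding preserves_filtered_colimits_def
proof (intro allI impI)
  fix J :: "('u, 'u) cat" and D c \<tau>
  assume "small_category U J" "filtered r J" "is_functor J Alg D" "colimit Alg J D c \<tau>"
  then show "colimit K J (comp_functor alg_forget D) (omap alg_forget c) (\<lambda>i. amap alg_forget (\<tau> i))"
    unfolding forget_sel by (intro colimit_in_K filtered_filt[OF _ r small_r])
qed

end


section \<open>Initial structures\<close>

context theory_on
begin

text \<open>Algebras with a family of morphisms \<open>Z i \<rightarrow> B\<close>. For free algebras the family has one member,
  for a colimit of algebras it is the cocone; \<open>ok\<close> collects the conditions on it.\<close>

definition structs :: "'i set \<Rightarrow> ('i \<Rightarrow> 'o) \<Rightarrow> (('o, 'm, 'w) alg \<Rightarrow> ('i \<Rightarrow> 'm) \<Rightarrow> bool) \<Rightarrow>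
    (('o, 'm, 'w) alg \<times> ('i \<Rightarrow> 'm)) set" where
  "structs I Z ok = {(B, f). B \<in> algs \<and> f \<in> (\<Pi>\<^sub>E i\<in>I. hom K (Z i) (fst B)) \<and> ok B f}"

lemma small_hom_K: "small U (hom K X Y)"
proof (cases "X \<in> Ob K \<and> Y \<in> Ob K")
  case True
  then show ?thesis using C_small by (simp add: locally_small_def)
next
  case False
  then have "hom K X Y = {}" using hom_ob[OF C] by blast
  then show ?thesis by (simp add: small_finite[OF U])
qed

lemma small_ops: "small U (ops E)"
proof (rule small_mono)
  show "small U (\<Union>X\<in>P. \<Union>Y\<in>P. {w \<in> ops E. ar E w = (X, Y)})"
    using E by (intro small_UNION[OF U P_small]) (simp add: equational_theory_def)
  show "ops E \<subseteq> (\<Union>X\<in>P. \<Union>Y\<in>P. {w \<in> ops E. ar E w = (X, Y)})"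
    using arity by (force simp: prod_eq_iff)
qed

end

text \<open>\<open>ok_reflect\<close> is the condition under which the algebra to be constructed is
  a structure itself: \<open>ok\<close> must follow from compatible, jointly monic homomorphisms to
  all structures.\<close>

locale structures = theory_on U r K P E
  for U :: "'u itself" and r :: "'l rel" and K :: "('o, 'm) cat" and P :: "'o set"
    and E :: "('o, 'm, 'w) eq_theory" +
  fixes I :: "'i set" and Z :: "'i \<Rightarrow> 'o" and ok :: "('o, 'm, 'w) alg \<Rightarrow> ('i \<Rightarrow> 'm) \<Rightarrow> bool"
  assumes I_small: "small U I" and Z_ob: "i \<in> I \<Longrightarrow> Z i \<in> Ob K"
    and ok_reflect: "L \<in> algs \<Longrightarrow> f \<in> (\<Pi>\<^sub>E i\<in>I. hom K (Z i) (fst L)) \<Longrightarrow>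
      (\<And>s. s \<in> structs I Z ok \<Longrightarrow> hm L (e s) (fst s) \<and> (\<forall>i\<in>I. e s \<odot> f i = snd s i)) \<Longrightarrow>
      (\<And>X x y. x \<in> hom K X (fst L) \<Longrightarrow> y \<in> hom K X (fst L) \<Longrightarrow>
        (\<forall>s\<in>structs I Z ok. e s \<odot> x = e s \<odot> y) \<Longrightarrow> x = y) \<Longrightarrow> ok L f"
begin

abbreviation "S \<equiv> structs I Z ok"
abbreviation "carrier s \<equiv> fst (fst s)"

lemma S_alg: "s \<in> S \<Longrightarrow> fst s \<in> algs"
  and S_fam: "s \<in> S \<Longrightarrow> i \<in> I \<Longrightarrow> snd s i \<in> hom K (Z i) (carrier s)"
  by (auto simp: structs_def)

lemmas S_type = algs_type[OF S_alg]

text \<open>The coproduct is indexed by the set of elements itself, each counted with its arity.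
  Fixing one coproduct per \<open>T\<close> leaves at most one result of gluing
  \<open>T\<close>.\<close>

definition cop :: "('o \<times> (('o, 'm, 'w) alg \<times> ('i \<Rightarrow> 'm) \<Rightarrow> 'm)) set \<Rightarrow>
    'o \<times> ('o \<times> (('o, 'm, 'w) alg \<times> ('i \<Rightarrow> 'm) \<Rightarrow> 'm) \<Rightarrow> 'm)" where
  "cop T = (SOME p. fst p \<in> P \<and> coproduct K T fst (fst p) (snd p))"

definition coeq :: "'o \<Rightarrow> 'm set \<Rightarrow> 'o \<times> 'm" where
  "coeq Y H = (SOME p. fst p \<in> P \<and> coequalizer K Y H (fst p) (snd p))"

lemma cop:
  assumes "|T| <o r" "fst ` T \<subseteq> P"
  shows "fst (cop T) \<in> P" "coproduct K T fst (fst (cop T)) (snd (cop T))"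
proof -
  have "\<exists>p. fst p \<in> P \<and> coproduct K T fst (fst p) (snd p)"
    using P_coproduct[OF assms(1), of fst] assms(2) by auto
  from someI_ex[OF this] show "fst (cop T) \<in> P" "coproduct K T fst (fst (cop T)) (snd (cop T))"
    by (simp_all add: cop_def)
qed

lemma coeq:
  assumes "|H| <o r" "H \<subseteq> hom K X Y" "H \<noteq> {}" "X \<in> P" "Y \<in> P"
  shows "fst (coeq Y H) \<in> P" "coequalizer K Y H (fst (coeq Y H)) (snd (coeq Y H))"
proof -
  have "\<exists>p. fst p \<in> P \<and> coequalizer K Y H (fst p) (snd p)"
    using P_coequalizer[OF assms] by auto
  from someI_ex[OF this] show "fst (coeq Y H) \<in> P" "coequalizer K Y H (fst (coeq Y H)) (snd (coeq Y H))"
    by (simp_all add: coeq_def)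
qed

text \<open>The \<open>X\<close>-elements \<open>(X, \<phi>)\<close> of the initial structure are generated inside the product over all
  structures; \<open>\<phi> s\<close> is the interpretation of the element in \<open>s\<close>.\<close>

inductive gen :: "('o \<times> (('o, 'm, 'w) alg \<times> ('i \<Rightarrow> 'm) \<Rightarrow> 'm)) set \<Rightarrow>
    'o \<times> (('o, 'm, 'w) alg \<times> ('i \<Rightarrow> 'm) \<Rightarrow> 'm) \<Rightarrow> bool" where
  start: "i \<in> I \<Longrightarrow> X \<in> P \<Longrightarrow> g \<in> hom K X (Z i) \<Longrightarrow> gen {} (X, \<lambda>s\<in>S. snd s i \<odot> g)"
| op: "w \<in> ops E \<Longrightarrow> gen {(src w, \<phi>)} (tgt w, \<lambda>s\<in>S. snd (fst s) w (\<phi> s))"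
| pre: "X \<in> P \<Longrightarrow> Y \<in> P \<Longrightarrow> g \<in> hom K Y X \<Longrightarrow> gen {(X, \<phi>)} (Y, \<lambda>s\<in>S. \<phi> s \<odot> g)"
| glue: "|T| <o r \<Longrightarrow> fst ` T \<subseteq> P \<Longrightarrow> \<chi> \<in> (\<Pi>\<^sub>E s\<in>S. hom K (fst (cop T)) (carrier s)) \<Longrightarrow>
    \<forall>s\<in>S. \<forall>t\<in>T. \<chi> s \<odot> snd (cop T) t = snd t s \<Longrightarrow> gen T (fst (cop T), \<chi>)"
| quot: "|H| <o r \<Longrightarrow> H \<subseteq> hom K X Y \<Longrightarrow> H \<noteq> {} \<Longrightarrow> X \<in> P \<Longrightarrow> Y \<in> P \<Longrightarrow>
    \<chi> \<in> (\<Pi>\<^sub>E s\<in>S. hom K (fst (coeq Y H)) (carrier s)) \<Longrightarrow>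
    \<forall>s\<in>S. \<chi> s \<odot> snd (coeq Y H) = \<psi> s \<Longrightarrow> gen {(Y, \<psi>)} (fst (coeq Y H), \<chi>)"

definition \<Phi> :: "('o \<times> (('o, 'm, 'w) alg \<times> ('i \<Rightarrow> 'm) \<Rightarrow> 'm)) set" where
  "\<Phi> = closure {(T, z). gen T z}"

lemma \<Phi>I: "gen T z \<Longrightarrow> T \<subseteq> \<Phi> \<Longrightarrow> z \<in> \<Phi>"
  unfolding \<Phi>_def by (rule closure.step[of T]) auto

lemma \<Phi>_induct [consumes 1, case_names gen]:
  assumes "z \<in> \<Phi>" and "\<And>T z. gen T z \<Longrightarrow> T \<subseteq> \<Phi> \<Longrightarrow> (\<And>t. t \<in> T \<Longrightarrow> Q t) \<Longrightarrow> Q z"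
  shows "Q z"
proof -
  have "z \<in> closure {(T, z). gen T z}" using assms(1) by (simp add: \<Phi>_def)
  then show ?thesis
  proof induction
    case (step T z)
    then have "gen T z" "T \<subseteq> \<Phi>" by (auto simp: \<Phi>_def)
    then show ?case using step(3) by (rule assms(2))
  qed
qed

lemma \<Phi>_mem:
  assumes "z \<in> \<Phi>"
  shows "fst z \<in> P \<and> snd z \<in> (\<Pi>\<^sub>E s\<in>S. hom K (fst z) (carrier s))"
  using assms
proof (induction rule: \<Phi>_induct)
  case (gen T z)
  from gen(1) show ?case
  proof cases
    case (start i X g)
    then show ?thesis using comp_in[OF C _ S_fam] by auto
  next
    case (op w \<phi>)
    then have "\<phi> \<in> (\<Pi>\<^sub>E s\<in>S. hom K (src w) (carrier s))" using gen(3)[of "(src w, \<phi>)"] by simp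
    then show ?thesis using arity[OF op(3)] op_in[OF S_type op(3)] by (auto simp: op(2) PiE_iff extensional_def)
  next
    case (pre X Y g \<phi>)
    then have "\<phi> \<in> (\<Pi>\<^sub>E s\<in>S. hom K X (carrier s))" using gen(3)[of "(X, \<phi>)"] by simp
    then show ?thesis using pre comp_in[OF C pre(5)] by (auto simp: PiE_iff extensional_def)
  next
    case (glue \<chi>)
    then show ?thesis using cop(1)[OF glue(2,3)] by simp
  next
    case (quot H X Y \<chi> \<psi>)
    then show ?thesis using coeq(1)[OF quot(3-7)] by simp
  qed
qed

lemma \<Phi>_hom: "(X, \<phi>) \<in> \<Phi> \<Longrightarrow> s \<in> S \<Longrightarrow> \<phi> s \<in> hom K X (carrier s)"
  using \<Phi>_mem[of "(X, \<phi>)"] by (auto simp: PiE_iff)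

lemma small_sub1: "(\<And>x y. x \<in> A \<Longrightarrow> y \<in> A \<Longrightarrow> x = y) \<Longrightarrow> small U A"
proof -
  assume eq: "\<And>x y. x \<in> A \<Longrightarrow> y \<in> A \<Longrightarrow> x = y"
  have "\<exists>x. A \<subseteq> {x}"
  proof (cases "A = {}")
    case False
    then obtain x where "x \<in> A" by blast
    then show ?thesis using eq by blast
  qed simp
  then have "finite A" using finite_subset by blast
  then show "small U A" by (rule small_finite[OF U])
qed

text \<open>The results of \<open>start\<close>, \<open>op\<close> and \<open>pre\<close> are
  indexed by small sets of parameters. For \<open>glue\<close> and \<open>quot\<close> the family
  \<open>\<chi>\<close> is forced by the universal property, so each \<open>T\<close>, respectively
  each choice of \<open>X\<close> and \<open>H\<close> for a given premise, gives at most one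
  result.\<close>

lemma \<Phi>_small: "small U \<Phi>"
  unfolding \<Phi>_def
proof (rule small_closure[OF U r small_r])
  show "|T| <o r" if "(T, z) \<in> {(T, z). gen T z}" for T z
  proof -
    have "gen T z" using that by simp
    then show ?thesis by cases (simp_all add: lt_finite[OF r])
  qed
  fix T :: "('o \<times> (('o, 'm, 'w) alg \<times> ('i \<Rightarrow> 'm) \<Rightarrow> 'm)) set" assume T: "small U T"
  define A1 where "A1 = (\<lambda>(i, X, g). (X, \<lambda>s\<in>S. snd s i \<odot> g)) ` (SIGMA i:I. SIGMA X:P. hom K X (Z i))"
  define A2 where "A2 = (\<lambda>(t, w). (tgt w, \<lambda>s\<in>S. snd (fst s) w (snd t s))) ` (T \<times> ops E)"
  define A3 where "A3 = (\<lambda>(t, Y, g). (Y, \<lambda>s\<in>S. snd t s \<odot> g)) ` (SIGMA t:T. SIGMA Y:P. hom K Y (fst t))"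
  define A4 where "A4 = {z. \<exists>\<chi>. |T| <o r \<and> fst ` T \<subseteq> P \<and> z = (fst (cop T), \<chi>) \<and>
    \<chi> \<in> (\<Pi>\<^sub>E s\<in>S. hom K (fst (cop T)) (carrier s)) \<and> (\<forall>s\<in>S. \<forall>t\<in>T. \<chi> s \<odot> snd (cop T) t = snd t s)}"
  define A5 where "A5 t X H = {z. \<exists>\<chi>. |H| <o r \<and> H \<subseteq> hom K X (fst t) \<and> H \<noteq> {} \<and> X \<in> P \<and> fst t \<in> P \<and>
    z = (fst (coeq (fst t) H), \<chi>) \<and> \<chi> \<in> (\<Pi>\<^sub>E s\<in>S. hom K (fst (coeq (fst t) H)) (carrier s)) \<and>
    (\<forall>s\<in>S. \<chi> s \<odot> snd (coeq (fst t) H) = snd t s)}"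
    for t :: "'o \<times> (('o, 'm, 'w) alg \<times> ('i \<Rightarrow> 'm) \<Rightarrow> 'm)" and X H
  have "small U A1" "small U A2" "small U A3"
    unfolding A1_def A2_def A3_def
    by (intro small_image small_Sigma[OF U] I_small P_small T small_ops small_hom_K)+
  moreover have "small U A4"
  proof (rule small_sub1)
    fix y z assume "y \<in> A4" "z \<in> A4"
    then obtain \<chi> \<xi> where T: "|T| <o r" "fst ` T \<subseteq> P" and y: "y = (fst (cop T), \<chi>)" and z: "z = (fst (cop T), \<xi>)"
      and mem: "\<chi> \<in> (\<Pi>\<^sub>E s\<in>S. hom K (fst (cop T)) (carrier s))" "\<xi> \<in> (\<Pi>\<^sub>E s\<in>S. hom K (fst (cop T)) (carrier s))"
      and eq: "\<forall>s\<in>S. \<forall>t\<in>T. \<chi> s \<odot> snd (cop T) t = snd t s" "\<forall>s\<in>S. \<forall>t\<in>T. \<xi> s \<odot> snd (cop T) t = snd t s"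
      unfolding A4_def by blast
    have "\<chi> = \<xi>"
    proof (rule PiE_ext[OF mem])
      fix s assume s: "s \<in> S"
      show "\<chi> s = \<xi> s"
        by (rule coproductD(3)[OF cop(2)[OF T] PiE_mem[OF mem(1) s] PiE_mem[OF mem(2) s]])
          (simp add: eq[rule_format, OF s])
    qed
    then show "y = z" by (simp add: y z)
  qed
  moreover have "small U (A5 t X H)" for t X H
  proof (rule small_sub1)
    fix y z assume "y \<in> A5 t X H" "z \<in> A5 t X H"
    then obtain \<chi> \<xi> where H: "|H| <o r" "H \<subseteq> hom K X (fst t)" "H \<noteq> {}" "X \<in> P" "fst t \<in> P"
      and y: "y = (fst (coeq (fst t) H), \<chi>)" and z: "z = (fst (coeq (fst t) H), \<xi>)"
      and mem: "\<chi> \<in> (\<Pi>\<^sub>E s\<in>S. hom K (fst (coeq (fst t) H)) (carrier s))"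
        "\<xi> \<in> (\<Pi>\<^sub>E s\<in>S. hom K (fst (coeq (fst t) H)) (carrier s))"
      and eq: "\<forall>s\<in>S. \<chi> s \<odot> snd (coeq (fst t) H) = snd t s" "\<forall>s\<in>S. \<xi> s \<odot> snd (coeq (fst t) H) = snd t s"
      unfolding A5_def by blast
    have "\<chi> = \<xi>"
    proof (rule PiE_ext[OF mem])
      fix s assume s: "s \<in> S"
      show "\<chi> s = \<xi> s"
        by (rule coequalizerD(4)[OF coeq(2)[OF H] PiE_mem[OF mem(1) s] PiE_mem[OF mem(2) s]])
          (simp add: eq[rule_format, OF s])
    qed
    then show "y = z" by (simp add: y z)
  qed
  then have "small U (\<Union>t\<in>T. \<Union>X\<in>P. \<Union>H\<in>Pow (hom K X (fst t)). A5 t X H)"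
    by (intro small_UNION[OF U] small_Pow[OF U] T P_small small_hom_K)
  ultimately have "small U (A1 \<union> A2 \<union> A3 \<union> A4 \<union> (\<Union>t\<in>T. \<Union>X\<in>P. \<Union>H\<in>Pow (hom K X (fst t)). A5 t X H))"
    by (intro small_Un[OF U])
  moreover have "{z. (T, z) \<in> {(T, z). gen T z}} \<subseteq>
      A1 \<union> A2 \<union> A3 \<union> A4 \<union> (\<Union>t\<in>T. \<Union>X\<in>P. \<Union>H\<in>Pow (hom K X (fst t)). A5 t X H)"
  proof
    fix z assume "z \<in> {z. (T, z) \<in> {(T, z). gen T z}}"
    then have "gen T z" by simp
    then show "z \<in> A1 \<union> A2 \<union> A3 \<union> A4 \<union> (\<Union>t\<in>T. \<Union>X\<in>P. \<Union>H\<in>Pow (hom K X (fst t)). A5 t X H)"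
    proof cases
      case (start i X g)
      then have "z \<in> A1" unfolding A1_def by (intro image_eqI[of _ _ "(i, X, g)"]) simp_all
      then show ?thesis by blast
    next
      case (op w \<phi>)
      then have "z \<in> A2" unfolding A2_def by (intro image_eqI[of _ _ "((src w, \<phi>), w)"]) simp_all
      then show ?thesis by blast
    next
      case (pre X Y g \<phi>)
      then have "z \<in> A3" unfolding A3_def by (intro image_eqI[of _ _ "((X, \<phi>), Y, g)"]) simp_all
      then show ?thesis by blast
    next
      case (glue \<chi>)
      then have "z \<in> A4" unfolding A4_def by blast
      then show ?thesis by blast
    next
      case (quot H X Y \<chi> \<psi>)
      then have "z \<in> A5 (Y, \<psi>) X H" unfolding A5_def fst_conv snd_conv by blast
      then show ?thesis using quot by force
    qed
  qed
  ultimately show "small U {z. (T, z) \<in> {(T, z). gen T z}}" by (rule small_mono)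
qed

text \<open>The category of elements over \<open>P\<close> of the virtual product of all structures,
  restricted to \<open>\<Phi>\<close>: an arrow exhibits its source as the restriction of its target
  along a morphism of \<open>K\<close>.\<close>

definition El where
  "El = \<lparr>Ob = \<Phi>,
     Arr = {(a, g, b). a \<in> \<Phi> \<and> b \<in> \<Phi> \<and> g \<in> hom K (fst a) (fst b) \<and> (\<forall>s\<in>S. snd b s \<odot> g = snd a s)},
     Dom = (\<lambda>(a, g, b). a), Cod = (\<lambda>(a, g, b). b),
     Id = (\<lambda>a. (a, Id K (fst a), a)), Comp = (\<lambda>(b, g, c) (a, f, b'). (a, g \<odot> f, c))\<rparr>"

definition El_fun :: "('o \<times> (('o, 'm, 'w) alg \<times> ('i \<Rightarrow> 'm) \<Rightarrow> 'm),
    ('o \<times> (('o, 'm, 'w) alg \<times> ('i \<Rightarrow> 'm) \<Rightarrow> 'm)) \<times> 'm \<times> ('o \<times> (('o, 'm, 'w) alg \<times> ('i \<Rightarrow> 'm) \<Rightarrow> 'm)),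
    'o, 'm) fctr" where
  "El_fun = \<lparr>omap = fst, amap = (\<lambda>(a, g, b). g)\<rparr>"

lemma El_hom: "f \<in> hom El a b \<longleftrightarrow> (\<exists>g. f = (a, g, b) \<and> a \<in> \<Phi> \<and> b \<in> \<Phi> \<and>
    g \<in> hom K (fst a) (fst b) \<and> (\<forall>s\<in>S. snd b s \<odot> g = snd a s))"
  unfolding hom_def[of El] by (auto simp: El_def)

lemma El_homI: "a \<in> \<Phi> \<Longrightarrow> b \<in> \<Phi> \<Longrightarrow> g \<in> hom K (fst a) (fst b) \<Longrightarrow>
    (\<And>s. s \<in> S \<Longrightarrow> snd b s \<odot> g = snd a s) \<Longrightarrow> (a, g, b) \<in> hom El a b"
  by (simp add: El_hom)

lemma El_homE:
  assumes "f \<in> hom El a b"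
  obtains g where "f = (a, g, b)" "a \<in> \<Phi>" "b \<in> \<Phi>" "g \<in> hom K (fst a) (fst b)"
    "\<forall>s\<in>S. snd b s \<odot> g = snd a s"
  using assms unfolding El_hom by (elim exE conjE)

lemma El_sel: "Ob El = \<Phi>" "Comp El (b, g, c) (a, f, b') = (a, g \<odot> f, c)" "Id El a = (a, Id K (fst a), a)"
    "omap El_fun a = fst a" "amap El_fun (a, g, b) = g"
  by (simp_all add: El_def El_fun_def)

lemma \<Phi>_snd: "a \<in> \<Phi> \<Longrightarrow> s \<in> S \<Longrightarrow> snd a s \<in> hom K (fst a) (carrier s)"
  using \<Phi>_hom[of "fst a" "snd a" s] by simp

lemma El_category: "category El"
proof (rule categoryI)
  show "Dom El f \<in> Ob El \<and> Cod El f \<in> Ob El" if "f \<in> Arr El" for f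
    using that by (auto simp: El_def)
  show "Id El a \<in> hom El a a" if "a \<in> Ob El" for a
  proof -
    have a: "a \<in> \<Phi>" using that by (simp add: El_sel)
    then have "fst a \<in> Ob K" using \<Phi>_mem P_ob by blast
    then show ?thesis unfolding El_sel
      by (intro El_homI a) (simp_all add: id_in[OF C] comp_id[OF C \<Phi>_snd[OF a]])
  qed
  show "Comp El g f \<in> hom El X Y" if fg: "f \<in> hom El X W" "g \<in> hom El W Y" for X Y W f g
  proof -
    obtain f' where f: "f = (X, f', W)" "X \<in> \<Phi>" "W \<in> \<Phi>" "f' \<in> hom K (fst X) (fst W)"
      "\<forall>s\<in>S. snd W s \<odot> f' = snd X s" using fg(1) by (rule El_homE)
    obtain g' where g: "g = (W, g', Y)" "W \<in> \<Phi>" "Y \<in> \<Phi>" "g' \<in> hom K (fst W) (fst Y)"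
      "\<forall>s\<in>S. snd Y s \<odot> g' = snd W s" using fg(2) by (rule El_homE)
    show ?thesis unfolding f(1) g(1) El_sel
    proof (rule El_homI[OF f(2) g(3) comp_in[OF C f(4) g(4)]])
      fix s assume s: "s \<in> S"
      show "snd Y s \<odot> g' \<odot> f' = snd X s"
        using comp_assoc[OF C f(4) g(4) \<Phi>_snd[OF g(3) s]] f(5) g(5) s by simp
    qed
  qed
  show "Comp El f (Id El X) = f \<and> Comp El (Id El Y) f = f" if "f \<in> hom El X Y" for X Y f
    using that by (elim El_homE) (simp add: El_sel comp_id[OF C] id_comp[OF C])
  show "Comp El h (Comp El g f) = Comp El (Comp El h g) f"
    if "f \<in> hom El W X" "g \<in> hom El X Y" "h \<in> hom El Y V" for W X Y V f g h
    using that by (elim El_homE) (simp add: El_sel comp_assoc[OF C])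
qed

lemma El_small: "small_category U El"
proof -
  have "small U (\<Phi> \<times> (\<Union>a\<in>\<Phi>. \<Union>b\<in>\<Phi>. hom K (fst a) (fst b)) \<times> \<Phi>)"
    by (intro small_Sigma[OF U] small_UNION[OF U] \<Phi>_small small_hom_K)
  then have "small U (Arr El)" by (rule small_mono) (auto simp: El_def)
  then show ?thesis by (simp add: small_category_def El_category El_sel \<Phi>_small)
qed

text \<open>The rules \<open>glue\<close> and \<open>quot\<close> are made for this: a glued element
  bounds the elements of \<open>T\<close>, and an element factored through a coequalizer makes the
  arrows of \<open>H\<close> equal.\<close>

lemma El_filt: "filt r El"
  unfolding filt_def
proof (intro conjI allI impI)
  show "category El" by (rule El_category)
  fix T assume T: "T \<subseteq> Ob El" "|T| <o r"
  then have T\<Phi>: "T \<subseteq> \<Phi>" by (simp add: El_sel)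
  then have TP: "fst ` T \<subseteq> P" using \<Phi>_mem by blast
  note co = cop[OF T(2) TP]
  have "\<exists>h. h \<in> hom K (fst (cop T)) (carrier s) \<and> (\<forall>t\<in>T. h \<odot> snd (cop T) t = snd t s)" if s: "s \<in> S" for s
    using coproductD(2)[OF co(2) alg_ob[OF S_type[OF s]], of "\<lambda>t. snd t s"] T\<Phi> \<Phi>_snd[OF _ s] by blast
  then obtain \<chi> where \<chi>: "\<And>s. s \<in> S \<Longrightarrow> \<chi> s \<in> hom K (fst (cop T)) (carrier s)"
    "\<And>s. s \<in> S \<Longrightarrow> \<forall>t\<in>T. \<chi> s \<odot> snd (cop T) t = snd t s" by metis
  have "gen T (fst (cop T), restrict \<chi> S)"
    by (rule gen.glue[OF T(2) TP]) (simp_all add: \<chi>(1), intro ballI, simp add: \<chi>(2)[rule_format])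
  then have z: "(fst (cop T), restrict \<chi> S) \<in> \<Phi>" by (rule \<Phi>I[OF _ T\<Phi>])
  have "(t, snd (cop T) t, (fst (cop T), restrict \<chi> S)) \<in> hom El t (fst (cop T), restrict \<chi> S)" if t: "t \<in> T" for t
    using t T\<Phi> by (intro El_homI z) (auto simp: coproductD(1)[OF co(2)] \<chi>(2)[rule_format])
  then show "\<exists>k\<in>Ob El. \<forall>i\<in>T. hom El i k \<noteq> {}" using z unfolding El_sel by blast
next
  fix a b H assume H: "H \<subseteq> hom El a b" "|H| <o r" and b: "b \<in> Ob El"
  show "\<exists>k z. z \<in> hom El b k \<and> (\<forall>f\<in>H. \<forall>g\<in>H. Comp El z f = Comp El z g)"
  proof (cases "H = {}")
    case True
    then show ?thesis using id_in[OF El_category b] by blast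
  next
    case False
    have b\<Phi>: "b \<in> \<Phi>" using b by (simp add: El_sel)
    have a\<Phi>: "a \<in> \<Phi>" using H(1) False by (auto simp: El_hom)
    define H' where "H' = amap El_fun ` H"
    have H_eq: "f = (a, amap El_fun f, b)" and f_in: "amap El_fun f \<in> hom K (fst a) (fst b)"
      and f_eq: "s \<in> S \<Longrightarrow> snd b s \<odot> amap El_fun f = snd a s" if "f \<in> H" for f s
    proof -
      have "f \<in> hom El a b" using H(1) that by blast
      then show "f = (a, amap El_fun f, b)" "amap El_fun f \<in> hom K (fst a) (fst b)"
        "s \<in> S \<Longrightarrow> snd b s \<odot> amap El_fun f = snd a s"
        by (auto elim!: El_homE simp: El_sel)
    qed
    have H': "|H'| <o r" "H' \<subseteq> hom K (fst a) (fst b)" "H' \<noteq> {}"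
      unfolding H'_def using lt_image[OF H(2)] f_in False by blast+
    have PP: "fst a \<in> P" "fst b \<in> P" using a\<Phi> b\<Phi> \<Phi>_mem by blast+
    note co = coeq[OF H' PP]
    define c q where "c = fst (coeq (fst b) H')" and "q = snd (coeq (fst b) H')"
    note co = co[folded c_def q_def]
    have "\<exists>h. h \<in> hom K c (carrier s) \<and> h \<odot> q = snd b s" if s: "s \<in> S" for s
    proof -
      \<comment> \<open>All arrows of \<open>H\<close> restrict \<open>b\<close> to the same element
        \<open>a\<close>, so the interpretation of \<open>b\<close> in every structure factors
        through the coequalizer.\<close>
      have "snd b s \<odot> h = snd b s \<odot> h'" if "h \<in> H'" "h' \<in> H'" for h h'
      proof -
        have "snd b s \<odot> k = snd a s" if "k \<in> H'" for k
          using that f_eq[OF _ s] unfolding H'_def by (elim imageE) simp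
        from this[OF that(1)] this[OF that(2)] show ?thesis by simp
      qed
      from coequalizerD(3)[OF co(2) \<Phi>_snd[OF b\<Phi> s] this] show ?thesis by blast
    qed
    then obtain \<chi> where \<chi>: "\<And>s. s \<in> S \<Longrightarrow> \<chi> s \<in> hom K c (carrier s)"
      "\<And>s. s \<in> S \<Longrightarrow> \<chi> s \<odot> q = snd b s" by metis
    have "gen {(fst b, snd b)} (c, restrict \<chi> S)"
      unfolding c_def
      by (rule gen.quot[OF H' PP]) (simp_all add: \<chi> flip: c_def q_def)
    then have z: "(c, restrict \<chi> S) \<in> \<Phi>" by (rule \<Phi>I) (simp add: b\<Phi>)
    have zz: "(b, q, (c, restrict \<chi> S)) \<in> hom El b (c, restrict \<chi> S)"
      by (rule El_homI[OF b\<Phi> z]) (simp_all add: coequalizerD(1)[OF co(2)] \<chi>(2))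
    have "Comp El (b, q, (c, restrict \<chi> S)) f = Comp El (b, q, (c, restrict \<chi> S)) g" if "f \<in> H" "g \<in> H" for f g
    proof -
      have "q \<odot> amap El_fun f = q \<odot> amap El_fun g"
        by (rule coequalizerD(2)[OF co(2)]) (use that in \<open>simp_all add: H'_def\<close>)
      then show ?thesis by (subst H_eq[OF that(1)], subst H_eq[OF that(2)]) (simp add: El_sel)
    qed
    then show ?thesis using zz by (intro exI[of _ "(c, restrict \<chi> S)"] exI[of _ "(b, q, (c, restrict \<chi> S))"] conjI ballI)
  qed
qed

lemma El_functor: "is_functor El K El_fun"
proof (rule is_functorI)
  show "omap El_fun X \<in> Ob K" if "X \<in> Ob El" for X
    using that \<Phi>_mem P_ob by (simp add: El_sel)
  show "amap El_fun f \<in> hom K (omap El_fun X) (omap El_fun Y)" if "f \<in> hom El X Y" for X Y f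
    using that by (elim El_homE) (simp add: El_sel)
  show "amap El_fun (Comp El g f) = amap El_fun g \<odot> amap El_fun f"
    if "f \<in> hom El X Y" "g \<in> hom El Y W" for X Y W f g
    using that by (elim El_homE) (simp add: El_sel)
qed (simp add: El_sel)

theorem initial_structure:
  obtains L f where "(L, f) \<in> S"
    "\<And>s. s \<in> S \<Longrightarrow> \<exists>h. hm L h (fst s) \<and> (\<forall>i\<in>I. h \<odot> f i = snd s i)"
    "\<And>B h k. hm L h B \<Longrightarrow> hm L k B \<Longrightarrow> \<forall>i\<in>I. h \<odot> f i = k \<odot> f i \<Longrightarrow> h = k"
proof -
  obtain L \<kappa> where L: "colimit K El El_fun L \<kappa>" using cocomplete_colimit[OF cocomp El_small El_functor] .
  note Lc = colimit_cocone[OF L]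
  have L_ob: "L \<in> Ob K" by (rule cocone_ob[OF Lc])
  have \<kappa>: "\<kappa> a \<in> hom K (fst a) L" if "a \<in> \<Phi>" for a using cocone_hom[OF Lc, of a] that by (simp add: El_sel)
  have \<kappa>_comp: "\<kappa> b \<odot> g = \<kappa> a" if "(a, g, b) \<in> hom El a b" for a b g
    using cocone_comp[OF Lc that] by (simp add: El_sel)
  \<comment> \<open>Evaluation at \<open>s\<close> is a cocone over the category of elements; its
    mediating morphism \<open>e s\<close> will be the homomorphism to \<open>s\<close>.\<close>
  have "\<exists>h. h \<in> hom K L (carrier s) \<and> (\<forall>a\<in>\<Phi>. h \<odot> \<kappa> a = snd a s)" if s: "s \<in> S" for s
  proof -
    have "cocone K El El_fun (carrier s) (\<lambda>a. snd a s)"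
    proof (rule coconeI[OF alg_ob[OF S_type[OF s]]])
      show "snd i s \<in> hom K (omap El_fun i) (carrier s)" if "i \<in> Ob El" for i
        using that \<Phi>_snd[OF _ s] by (simp add: El_sel)
      show "snd j s \<odot> amap El_fun a = snd i s" if "a \<in> hom El i j" for i j a
        using that s by (elim El_homE) (simp add: El_sel)
    qed
    from colimit_factor[OF L this] obtain h where "h \<in> hom K L (carrier s)"
      "\<And>a. a \<in> Ob El \<Longrightarrow> h \<odot> \<kappa> a = snd a s" by blast
    then show ?thesis by (intro exI[of _ h] conjI ballI) (simp_all add: El_sel)
  qed
  then obtain e where e: "\<And>s. s \<in> S \<Longrightarrow> e s \<in> hom K L (carrier s)"
    and e\<kappa>': "\<And>s. s \<in> S \<Longrightarrow> \<forall>a\<in>\<Phi>. e s \<odot> \<kappa> a = snd a s" by metis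
  have e\<kappa>: "e s \<odot> \<kappa> (X, \<phi>) = \<phi> s" if "s \<in> S" "(X, \<phi>) \<in> \<Phi>" for s X \<phi> using e\<kappa>'[OF that(1)] that(2) by force
  interpret d: diagram_in U r K El El_fun L \<kappa> by (rule diagram_inI[OF El_small El_filt El_functor L])
  \<comment> \<open>An \<open>X\<close>-element of \<open>L\<close> is turned back into the family
    of its values. By presentability of \<open>X\<close> it factors through some leg, hence the
    family is generated by \<open>pre\<close>, and the leg at the new element is the given
    morphism.\<close>
  define el where "el X x = (X, \<lambda>s\<in>S. e s \<odot> x)" for X :: 'o and x
  have el: "el X x \<in> \<Phi>" "\<kappa> (el X x) = x" if X: "X \<in> P" and x: "x \<in> hom K X L" for X x
  proof -
    have "d.factors X" using presentableD[OF P_pres[OF X] El_small El_filt El_functor L] by simp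
    from d.factorsE[OF this x] obtain a g where ag: "a \<in> \<Phi>" "g \<in> hom K X (fst a)" "\<kappa> a \<odot> g = x"
      by (auto simp: El_sel)
    have aP: "fst a \<in> P" using \<Phi>_mem[OF ag(1)] by simp
    have ex: "e s \<odot> x = snd a s \<odot> g" if "s \<in> S" for s
      using comp_assoc[OF C ag(2) \<kappa>[OF ag(1)] e[OF that]] e\<kappa>'[OF that] ag by simp
    have elx: "el X x = (X, \<lambda>s\<in>S. snd a s \<odot> g)"
      unfolding el_def by (simp add: ex cong: restrict_cong)
    have "gen {(fst a, snd a)} (X, \<lambda>s\<in>S. snd a s \<odot> g)" by (rule gen.pre[OF aP X ag(2)])
    then show 1: "el X x \<in> \<Phi>" unfolding elx by (rule \<Phi>I) (simp add: ag(1))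
    have "(el X x, g, a) \<in> hom El (el X x) a"
      by (rule El_homI[OF 1 ag(1)]) (simp_all add: elx ag(2))
    from \<kappa>_comp[OF this] show "\<kappa> (el X x) = x" using ag(3) by simp
  qed
  have mono_P: "x = y" if X: "X \<in> P" and x: "x \<in> hom K X L" and y: "y \<in> hom K X L"
    and eq: "\<forall>s\<in>S. e s \<odot> x = e s \<odot> y" for X x y
  proof -
    have "el X x = el X y" unfolding el_def using eq by (intro arg_cong[of _ _ "Pair X"] restrict_ext) blast
    then have "\<kappa> (el X x) = \<kappa> (el X y)" by (rule arg_cong)
    then show ?thesis unfolding el(2)[OF X x] el(2)[OF X y] .
  qed
  \<comment> \<open>Joint monicity on elements with arity in \<open>P\<close> extends to all domains
    because \<open>P\<close> is a generator.\<close>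
  have mono: "x = y" if x: "x \<in> hom K X L" and y: "y \<in> hom K X L"
    and eq: "\<forall>s\<in>S. e s \<odot> x = e s \<odot> y" for X x y
  proof (rule P_separate[OF x y])
    fix Y p assume Y: "Y \<in> P" and p: "p \<in> hom K Y X"
    show "x \<odot> p = y \<odot> p"
    proof (rule mono_P[OF Y comp_in[OF C p x] comp_in[OF C p y]], rule ballI)
      fix s assume s: "s \<in> S"
      show "e s \<odot> x \<odot> p = e s \<odot> y \<odot> p"
        using comp_assoc[OF C p x e[OF s]] comp_assoc[OF C p y e[OF s]] eq s by simp
    qed
  qed
  \<comment> \<open>The result of an operation is the leg at the element that \<open>op\<close>
    generates from the values of \<open>x\<close>.\<close>
  define f where "f w x = \<kappa> (tgt w, \<lambda>s\<in>S. snd (fst s) w (e s \<odot> x))" for w x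
  have op_\<Phi>: "(tgt w, \<lambda>s\<in>S. snd (fst s) w (e s \<odot> x)) \<in> \<Phi>" if w: "w \<in> ops E" and x: "x \<in> hom K (src w) L" for w x
  proof -
    have "gen {(src w, \<lambda>s\<in>S. e s \<odot> x)} (tgt w, \<lambda>s\<in>S. snd (fst s) w ((\<lambda>s\<in>S. e s \<odot> x) s))" by (rule gen.op[OF w])
    moreover have "(tgt w, \<lambda>s\<in>S. snd (fst s) w ((\<lambda>s\<in>S. e s \<odot> x) s)) = (tgt w, \<lambda>s\<in>S. snd (fst s) w (e s \<odot> x))"
      by (simp cong: restrict_cong)
    ultimately have "gen {el (src w) x} (tgt w, \<lambda>s\<in>S. snd (fst s) w (e s \<odot> x))" by (simp add: el_def)
    then show ?thesis by (rule \<Phi>I) (use el(1)[OF _ x] arity[OF w] in simp)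
  qed
  define B where "B = mk_alg L f"
  have fB: "fst B = L" by (simp add: B_def mk_alg_sel)
  have B_op: "snd B w x = f w x" if "w \<in> ops E" "x \<in> hom K (src w) L" for w x
    using that by (simp add: B_def mk_alg_sel)
  have Btype: "B \<in> type_algebras K E"
    unfolding B_def by (rule mk_alg_type[OF L_ob]) (use \<kappa>[OF op_\<Phi>] in \<open>simp add: f_def\<close>)
  have e_hm: "hm B (e s) (fst s)" if s: "s \<in> S" for s
  proof (rule hmI)
    show "e s \<in> hom K (fst B) (carrier s)" using e[OF s] by (simp add: fB)
    fix w g assume w: "w \<in> ops E" and g: "g \<in> hom K (src w) (fst B)"
    note g' = g[unfolded fB]
    show "e s \<odot> snd B w g = snd (fst s) w (e s \<odot> g)"
      unfolding B_op[OF w g'] f_def using e\<kappa>[OF s op_\<Phi>[OF w g']] s by simp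
  qed
  have B: "B \<in> algs"
    by (rule algs_jointly_mono[OF Btype, of S fst e]) (use S_alg e_hm mono fB in auto)
  have fam_\<Phi>: "(X, \<lambda>s\<in>S. snd s i \<odot> x) \<in> \<Phi>" if i: "i \<in> I" and X: "X \<in> P" and x: "x \<in> hom K X (Z i)" for i X x
    by (rule \<Phi>I[OF gen.start[OF i X x]]) simp
  \<comment> \<open>\<open>Z i\<close> need not be in \<open>P\<close>, so the morphism into
    \<open>L\<close> is obtained by density from the elements given by \<open>start\<close>.\<close>
  have "\<exists>h. h \<in> hom K (Z i) L \<and> (\<forall>X\<in>P. \<forall>x\<in>hom K X (Z i). h \<odot> x = \<kappa> (X, \<lambda>s\<in>S. snd s i \<odot> x))"
    if i: "i \<in> I" for i
  proof -
    have "\<kappa> (Y, \<lambda>s\<in>S. snd s i \<odot> x \<odot> u) = \<kappa> (X, \<lambda>s\<in>S. snd s i \<odot> x) \<odot> u"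
      if X: "X \<in> P" and Y: "Y \<in> P" and u: "u \<in> hom K Y X" and x: "x \<in> hom K X (Z i)" for X Y u x
      by (rule \<kappa>_comp[symmetric], rule El_homI[OF fam_\<Phi>[OF i Y comp_in[OF C u x]] fam_\<Phi>[OF i X x]])
        (use u in \<open>simp_all add: comp_assoc[OF C u x S_fam[OF _ i]]\<close>)
    note nat = this
    show ?thesis
    proof (rule P_extend[where \<phi> = "\<lambda>X x. \<kappa> (X, \<lambda>s\<in>S. snd s i \<odot> x)", OF Z_ob[OF i] L_ob])
      show "\<kappa> (X, \<lambda>s\<in>S. snd s i \<odot> x) \<in> hom K X L" if "X \<in> P" "x \<in> hom K X (Z i)" for X x
        using \<kappa>[OF fam_\<Phi>[OF i that]] by simp
      show "\<kappa> (Y, \<lambda>s\<in>S. snd s i \<odot> x \<odot> u) = \<kappa> (X, \<lambda>s\<in>S. snd s i \<odot> x) \<odot> u"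
        if "X \<in> P" "Y \<in> P" "u \<in> hom K Y X" "x \<in> hom K X (Z i)" for X Y u x
        by (rule nat[OF that])
    qed (intro exI conjI)
  qed
  then obtain f0 where f0: "\<And>i. i \<in> I \<Longrightarrow> f0 i \<in> hom K (Z i) L"
    and f0x: "\<And>i. i \<in> I \<Longrightarrow> \<forall>X\<in>P. \<forall>x\<in>hom K X (Z i). f0 i \<odot> x = \<kappa> (X, \<lambda>s\<in>S. snd s i \<odot> x)" by metis
  define fam where "fam = restrict f0 I"
  have fam: "fam i \<in> hom K (Z i) L" if "i \<in> I" for i using f0 that by (simp add: fam_def)
  have famx: "fam i \<odot> x = \<kappa> (X, \<lambda>s\<in>S. snd s i \<odot> x)" if "i \<in> I" "X \<in> P" "x \<in> hom K X (Z i)" for i X x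
    using f0x that by (simp add: fam_def)
  have e_fam: "e s \<odot> fam i = snd s i" if s: "s \<in> S" and i: "i \<in> I" for s i
  proof (rule P_separate[OF comp_in[OF C fam[OF i] e[OF s]] S_fam[OF s i]])
    fix X x assume X: "X \<in> P" and x: "x \<in> hom K X (Z i)"
    show "(e s \<odot> fam i) \<odot> x = snd s i \<odot> x"
      using comp_assoc[OF C x fam[OF i] e[OF s]] famx[OF i X x] e\<kappa>[OF s fam_\<Phi>[OF i X x]] s by simp
  qed
  have famE: "fam \<in> (\<Pi>\<^sub>E i\<in>I. hom K (Z i) (fst B))"
    using fam by (simp add: fB PiE_iff) (simp add: fam_def)
  have "ok B fam"
    by (rule ok_reflect[OF B famE, of e]) (use e_hm e_fam mono fB in auto)
  then have BS: "(B, fam) \<in> S" using B famE by (simp add: structs_def)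
  show thesis
  proof (rule that[OF BS])
    show "\<exists>h. hm B h (fst s) \<and> (\<forall>i\<in>I. h \<odot> fam i = snd s i)" if "s \<in> S" for s
      using e_hm[OF that] e_fam[OF that] by blast
    fix D h k assume h: "hm B h D" and k: "hm B k D" and hk: "\<forall>i\<in>I. h \<odot> fam i = k \<odot> fam i"
    note h' = hm_hom[OF h, unfolded fB] and k' = hm_hom[OF k, unfolded fB]
    \<comment> \<open>Agreement on the given family settles \<open>start\<close>. For
      \<open>op\<close> the step uses that \<open>h\<close> and \<open>k\<close> are homomorphisms;
      for \<open>glue\<close> and \<open>quot\<close> it is the uniqueness clause of the coproduct
      or coequalizer.\<close>
    have main: "h \<odot> \<kappa> a = k \<odot> \<kappa> a" if "a \<in> \<Phi>" for a
      using that
    proof (induction rule: \<Phi>_induct)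
      case (gen T z)
      have z: "z \<in> \<Phi>" by (rule \<Phi>I[OF gen(1,2)])
      from gen(1) show ?case
      proof cases
        case (start i X g)
        have "\<kappa> z = fam i \<odot> g" unfolding start(2) by (rule famx[OF start(3-5), symmetric])
        then show ?thesis
          using comp_assoc[OF C start(5) fam[OF start(3)] h'] comp_assoc[OF C start(5) fam[OF start(3)] k'] hk start(3)
          by simp
      next
        case (op w \<phi>)
        have a: "(src w, \<phi>) \<in> \<Phi>" using gen(2) op(1) by simp
        have \<kappa>a: "\<kappa> (src w, \<phi>) \<in> hom K (src w) L" using \<kappa>[OF a] by simp
        have "(\<lambda>s\<in>S. snd (fst s) w (e s \<odot> \<kappa> (src w, \<phi>))) = (\<lambda>s\<in>S. snd (fst s) w (\<phi> s))"
          by (simp add: e\<kappa>[OF _ a] cong: restrict_cong)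
        then have \<kappa>z: "\<kappa> z = snd B w (\<kappa> (src w, \<phi>))" unfolding B_op[OF op(3) \<kappa>a] f_def op(2) by simp
        show ?thesis unfolding \<kappa>z
          using hm_op[OF h op(3)] hm_op[OF k op(3)] gen(3)[of "(src w, \<phi>)"] \<kappa>a by (simp add: fB op(1))
      next
        case (pre X Y g \<phi>)
        have a: "(X, \<phi>) \<in> \<Phi>" using gen(2) pre(1) by simp
        have "(z, g, (X, \<phi>)) \<in> hom El z (X, \<phi>)" by (rule El_homI[OF z a]) (simp_all add: pre(2,5))
        then have \<kappa>z: "\<kappa> z = \<kappa> (X, \<phi>) \<odot> g" by (rule \<kappa>_comp[symmetric])
        have g: "g \<in> hom K Y (fst (X, \<phi>))" using pre(5) by simp
        show ?thesis unfolding \<kappa>z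
          using comp_assoc[OF C g \<kappa>[OF a] h'] comp_assoc[OF C g \<kappa>[OF a] k'] gen(3)[of "(X, \<phi>)"] by (simp add: pre(1))
      next
        case (glue \<chi>)
        note co = cop(2)[OF glue(2,3)]
        have \<kappa>z: "\<kappa> z \<in> hom K (fst (cop T)) L" using \<kappa>[OF z] by (simp add: glue(1))
        show ?thesis
        proof (rule coproductD(3)[OF co comp_in[OF C \<kappa>z h'] comp_in[OF C \<kappa>z k']])
          fix t assume t: "t \<in> T"
          then have t\<Phi>: "t \<in> \<Phi>" using gen(2) by blast
          note \<iota> = coproductD(1)[OF co t]
          have "(t, snd (cop T) t, z) \<in> hom El t z"
            by (rule El_homI[OF t\<Phi> z]) (use \<iota> glue(5) t in \<open>simp_all add: glue(1)\<close>)
          then have "\<kappa> z \<odot> snd (cop T) t = \<kappa> t" by (rule \<kappa>_comp)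
          then show "(h \<odot> \<kappa> z) \<odot> snd (cop T) t = (k \<odot> \<kappa> z) \<odot> snd (cop T) t"
            using comp_assoc[OF C \<iota> \<kappa>z h'] comp_assoc[OF C \<iota> \<kappa>z k'] gen(3)[OF t] by simp
        qed
      next
        case (quot H X Y \<chi> \<psi>)
        note co = coeq(2)[OF quot(3-7)]
        have t\<Phi>: "(Y, \<psi>) \<in> \<Phi>" using gen(2) by (simp add: quot(1))
        have \<kappa>z: "\<kappa> z \<in> hom K (fst (coeq Y H)) L" using \<kappa>[OF z] by (simp add: quot(2))
        show ?thesis
        proof (rule coequalizerD(4)[OF co comp_in[OF C \<kappa>z h'] comp_in[OF C \<kappa>z k']])
          note q = coequalizerD(1)[OF co]
          have "((Y, \<psi>), snd (coeq Y H), z) \<in> hom El (Y, \<psi>) z"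
            by (rule El_homI[OF t\<Phi> z]) (use q quot(9) in \<open>simp_all add: quot(2)\<close>)
          then have "\<kappa> z \<odot> snd (coeq Y H) = \<kappa> (Y, \<psi>)" by (rule \<kappa>_comp)
          then show "(h \<odot> \<kappa> z) \<odot> snd (coeq Y H) = (k \<odot> \<kappa> z) \<odot> snd (coeq Y H)"
            using comp_assoc[OF C q \<kappa>z h'] comp_assoc[OF C q \<kappa>z k'] gen(3)[of "(Y, \<psi>)"] by (simp add: quot(1))
        qed
      qed
    qed
    show "h = k"
      by (rule colimit_eq[OF C El_category El_functor L h' k']) (simp add: El_sel main)
  qed
qed

end


section \<open>Free algebras and monadicity\<close>

context theory_on
begin

definition is_free :: "'o \<Rightarrow> ('o, 'm, 'w) alg \<Rightarrow> 'm \<Rightarrow> bool" where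
  "is_free X B e \<longleftrightarrow> B \<in> algs \<and> e \<in> hom K X (fst B) \<and>
     (\<forall>D x. D \<in> algs \<longrightarrow> x \<in> hom K X (fst D) \<longrightarrow> (\<exists>h. hm B h D \<and> h \<odot> e = x)) \<and>
     (\<forall>D h k. hm B h D \<longrightarrow> hm B k D \<longrightarrow> h \<odot> e = k \<odot> e \<longrightarrow> h = k)"

text \<open>With one index and no condition, a structure is an algebra with a single morphism from
  \<open>X\<close>, and the initial one is free on \<open>X\<close>.\<close>

lemma free_ex:
  assumes X: "X \<in> Ob K"
  shows "\<exists>B e. is_free X B e"
proof -
  interpret s: structures U r K P E "UNIV :: unit set" "\<lambda>_. X" "\<lambda>_ _. True"
    by unfold_locales (simp_all add: X small_finite[OF U])
  obtain L f where L: "(L, f) \<in> s.S" "\<And>s. s \<in> s.S \<Longrightarrow> \<exists>h. hm L h (fst s) \<and> (\<forall>i\<in>UNIV. h \<odot> f i = snd s i)"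
    "\<And>B h k. hm L h B \<Longrightarrow> hm L k B \<Longrightarrow> \<forall>i\<in>UNIV. h \<odot> f i = k \<odot> f i \<Longrightarrow> h = k"
    by (rule s.initial_structure) rule
  have "is_free X L (f ())"
    unfolding is_free_def
  proof (intro conjI allI impI)
    show "L \<in> algs" "f () \<in> hom K X (fst L)" using L(1) by (auto simp: structs_def)
    fix D x assume "D \<in> algs" "x \<in> hom K X (fst D)"
    then have "(D, \<lambda>_. x) \<in> s.S" by (simp add: structs_def PiE_iff)
    from L(2)[OF this] show "\<exists>h. hm L h D \<and> h \<odot> f () = x" by simp
  next
    fix D h k assume "hm L h D" "hm L k D" "h \<odot> f () = k \<odot> f ()"
    then show "h = k" by (intro L(3)[of h D k]) simp_all
  qed
  then show ?thesis by blast
qed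

definition "free X = (SOME p. is_free X (fst p) (snd p))"
definition "Fr X = fst (free X)"
definition "\<eta> X = snd (free X)"
definition "ext X D x = (SOME h. hm (Fr X) h D \<and> h \<odot> \<eta> X = x)"

lemma Fr_free: "X \<in> Ob K \<Longrightarrow> is_free X (Fr X) (\<eta> X)"
  unfolding Fr_def \<eta>_def free_def by (rule someI_ex) (use free_ex in simp)

lemma Fr: "X \<in> Ob K \<Longrightarrow> Fr X \<in> algs"
  and \<eta>: "X \<in> Ob K \<Longrightarrow> \<eta> X \<in> hom K X (fst (Fr X))"
  using Fr_free by (simp_all add: is_free_def)

lemma Fr_type: "X \<in> Ob K \<Longrightarrow> Fr X \<in> type_algebras K E"
  and Fr_ob: "X \<in> Ob K \<Longrightarrow> fst (Fr X) \<in> Ob K"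
  using alg_ob[OF algs_type[OF Fr]] algs_type[OF Fr] by simp_all

lemma ext:
  assumes "X \<in> Ob K" "D \<in> algs" "x \<in> hom K X (fst D)"
  shows "hm (Fr X) (ext X D x) D" "ext X D x \<odot> \<eta> X = x"
proof -
  have "\<forall>D x. D \<in> algs \<longrightarrow> x \<in> hom K X (fst D) \<longrightarrow> (\<exists>h. hm (Fr X) h D \<and> h \<odot> \<eta> X = x)"
    using Fr_free[OF assms(1)] unfolding is_free_def by (elim conjE)
  from someI_ex[OF this[THEN spec, THEN spec, THEN mp, THEN mp, OF assms(2,3)]] show "hm (Fr X) (ext X D x) D" "ext X D x \<odot> \<eta> X = x"
    by (simp_all add: ext_def)
qed

lemma Fr_eqI:
  assumes "X \<in> Ob K" "hm (Fr X) h D" "hm (Fr X) k D" "h \<odot> \<eta> X = k \<odot> \<eta> X"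
  shows "h = k"
proof -
  have "\<forall>D h k. hm (Fr X) h D \<longrightarrow> hm (Fr X) k D \<longrightarrow> h \<odot> \<eta> X = k \<odot> \<eta> X \<longrightarrow> h = k"
    using Fr_free[OF assms(1)] unfolding is_free_def by (elim conjE)
  from this[THEN spec, THEN spec, THEN spec, THEN mp, THEN mp, THEN mp, OF assms(2-4)] show ?thesis .
qed

text \<open>\<open>lift\<close> and \<open>eps\<close> are the underlying morphisms in
  \<open>K\<close> of the left adjoint on arrows and of the counit, kept apart from the triples of
  \<open>Alg\<close> so that calculations stay in \<open>K\<close>.\<close>

definition "lift f = ext (Dom K f) (Fr (Cod K f)) (\<eta> (Cod K f) \<odot> f)"
definition "eps B = ext (fst B) B (Id K (fst B))"

lemma lift:
  assumes f: "f \<in> hom K X Y"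
  shows "hm (Fr X) (lift f) (Fr Y)" "lift f \<odot> \<eta> X = \<eta> Y \<odot> f"
proof -
  have XY: "X \<in> Ob K" "Y \<in> Ob K" "Dom K f = X" "Cod K f = Y"
    using hom_ob[OF C f] f by (auto simp: hom_def)
  note e = ext[OF XY(1) Fr[OF XY(2)] comp_in[OF C f \<eta>[OF XY(2)]]]
  show "hm (Fr X) (lift f) (Fr Y)" "lift f \<odot> \<eta> X = \<eta> Y \<odot> f"
    using e by (simp_all add: lift_def XY)
qed

lemma eps:
  assumes B: "B \<in> algs"
  shows "hm (Fr (fst B)) (eps B) B" "eps B \<odot> \<eta> (fst B) = Id K (fst B)"
proof -
  have "fst B \<in> Ob K" by (rule alg_ob[OF algs_type[OF B]])
  note e = ext[OF this B id_in[OF C this]]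
  show "hm (Fr (fst B)) (eps B) B" "eps B \<odot> \<eta> (fst B) = Id K (fst B)"
    using e by (simp_all add: eps_def)
qed

definition "Free = \<lparr>omap = Fr, amap = (\<lambda>f. (Fr (Dom K f), lift f, Fr (Cod K f)))\<rparr>"
definition "counit B = (Fr (fst B), eps B, B)"

lemma Free_sel: "omap Free X = Fr X" "f \<in> hom K X Y \<Longrightarrow> amap Free f = (Fr X, lift f, Fr Y)"
  by (auto simp: Free_def hom_def)

lemma lift_id:
  assumes X: "X \<in> Ob K"
  shows "lift (Id K X) = Id K (fst (Fr X))"
proof (rule Fr_eqI[OF X lift(1)[OF id_in[OF C X]] hm_id[OF Fr_type[OF X]]])
  show "lift (Id K X) \<odot> \<eta> X = Id K (fst (Fr X)) \<odot> \<eta> X"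
    unfolding lift(2)[OF id_in[OF C X]] comp_id[OF C \<eta>[OF X]] id_comp[OF C \<eta>[OF X]] ..
qed

lemma lift_comp:
  assumes f: "f \<in> hom K X Y" and g: "g \<in> hom K Y Z"
  shows "lift (g \<odot> f) = lift g \<odot> lift f"
proof (rule Fr_eqI)
  note gf = comp_in[OF C f g]
  have ob: "X \<in> Ob K" "Y \<in> Ob K" "Z \<in> Ob K" using hom_ob[OF C f] hom_ob[OF C g] by auto
  show "X \<in> Ob K" by fact
  show "hm (Fr X) (lift (g \<odot> f)) (Fr Z)" by (rule lift(1)[OF gf])
  show "hm (Fr X) (lift g \<odot> lift f) (Fr Z)" by (rule hm_comp[OF Fr_type[OF ob(1)] lift(1)[OF f] lift(1)[OF g]])
  note lf = hm_hom[OF lift(1)[OF f]] and lg = hm_hom[OF lift(1)[OF g]]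
  show "lift (g \<odot> f) \<odot> \<eta> X = (lift g \<odot> lift f) \<odot> \<eta> X"
    using lift(2)[OF gf] lift(2)[OF f] lift(2)[OF g] comp_assoc[OF C \<eta>[OF ob(1)] lf lg]
      comp_assoc[OF C f \<eta>[OF ob(2)] lg] comp_assoc[OF C f g \<eta>[OF ob(3)]] by simp
qed

lemma eps_natural:
  assumes B: "B \<in> algs" and D: "D \<in> algs" and h: "hm B h D"
  shows "h \<odot> eps B = eps D \<odot> lift h"
proof (rule Fr_eqI)
  note h' = hm_hom[OF h] and eB = hm_hom[OF eps(1)[OF B]] and eD = hm_hom[OF eps(1)[OF D]]
  note lh = lift[OF h']
  have ob: "fst B \<in> Ob K" "fst D \<in> Ob K" using alg_ob[OF algs_type] B D by auto
  show "fst B \<in> Ob K" by (rule ob)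
  show "hm (Fr (fst B)) (h \<odot> eps B) D" by (rule hm_comp[OF Fr_type[OF ob(1)] eps(1)[OF B] h])
  show "hm (Fr (fst B)) (eps D \<odot> lift h) D" by (rule hm_comp[OF Fr_type[OF ob(1)] lh(1) eps(1)[OF D]])
  have "(h \<odot> eps B) \<odot> \<eta> (fst B) = h"
    using comp_assoc[OF C \<eta>[OF ob(1)] eB h'] eps(2)[OF B] comp_id[OF C h'] by simp
  moreover have "(eps D \<odot> lift h) \<odot> \<eta> (fst B) = h"
    using comp_assoc[OF C \<eta>[OF ob(1)] hm_hom[OF lh(1)] eD] lh(2) comp_assoc[OF C h' \<eta>[OF ob(2)] eD]
      eps(2)[OF D] id_comp[OF C h'] by simp
  ultimately show "(h \<odot> eps B) \<odot> \<eta> (fst B) = (eps D \<odot> lift h) \<odot> \<eta> (fst B)" by simp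
qed

lemma Free_functor: "is_functor K Alg Free"
proof (rule is_functorI)
  show "omap Free X \<in> Ob Alg" if "X \<in> Ob K" for X using Fr[OF that] by (simp add: Free_sel)
  show "amap Free f \<in> hom Alg (omap Free X) (omap Free Y)" if f: "f \<in> hom K X Y" for X Y f
    unfolding Free_sel(2)[OF f] Free_sel(1)
    using hom_ob[OF C f] by (intro Alg_homI lift(1)[OF f] Fr) simp_all
  show "amap Free (Id K X) = Id Alg (omap Free X)" if X: "X \<in> Ob K" for X
    unfolding Free_sel(2)[OF id_in[OF C X]] by (simp add: Free_sel lift_id[OF X])
  show "amap Free (g \<odot> f) = Comp Alg (amap Free g) (amap Free f)"
    if f: "f \<in> hom K X Y" and g: "g \<in> hom K Y Z" for X Y Z f g
    unfolding Free_sel(2)[OF f] Free_sel(2)[OF g] Free_sel(2)[OF comp_in[OF C f g]]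
    by (simp add: lift_comp[OF f g])
qed

lemma adjunction_Free: "adjunction K Alg Free alg_forget \<eta> counit"
  unfolding adjunction_def
proof (intro conjI ballI)
  show "is_functor K Alg Free" "is_functor Alg K alg_forget" by (rule Free_functor forget_functor)+
  show "nat_trans K K id_functor (comp_functor alg_forget Free) \<eta>"
    unfolding nat_trans_def
  proof (intro conjI ballI)
    show "\<eta> X \<in> hom K (omap id_functor X) (omap (comp_functor alg_forget Free) X)" if "X \<in> Ob K" for X
      using \<eta>[OF that] by (simp add: id_functor_def comp_functor_def Free_sel)
    fix f assume "f \<in> Arr K"
    then have f: "f \<in> hom K (Dom K f) (Cod K f)" by (simp add: hom_def)
    show "\<eta> (Cod K f) \<odot> amap id_functor f = amap (comp_functor alg_forget Free) f \<odot> \<eta> (Dom K f)"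
      by (simp add: id_functor_def comp_functor_def Free_sel(2)[OF f] lift(2)[OF f])
  qed
  show "nat_trans Alg Alg (comp_functor Free alg_forget) id_functor counit"
    unfolding nat_trans_def
  proof (intro conjI ballI)
    show "counit B \<in> hom Alg (omap (comp_functor Free alg_forget) B) (omap id_functor B)" if "B \<in> Ob Alg" for B
    proof -
      have B: "B \<in> algs" using that by simp
      show ?thesis
        using Alg_homI[OF Fr[OF alg_ob[OF algs_type[OF B]]] B eps(1)[OF B]]
        by (simp add: id_functor_def comp_functor_def Free_sel counit_def)
    qed
    fix f assume "f \<in> Arr Alg"
    then obtain B h D where f: "f = (B, h, D)" "B \<in> algs" "D \<in> algs" "hm B h D" by (auto simp: alg_cat_def)
    have BD: "Dom Alg f = B" "Cod Alg f = D" by (simp_all add: f alg_cat_def)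
    show "Comp Alg (counit (Cod Alg f)) (amap (comp_functor Free alg_forget) f) =
        Comp Alg (amap id_functor f) (counit (Dom Alg f))"
      unfolding BD using eps_natural[OF f(2-4)]
      by (simp add: id_functor_def comp_functor_def f(1) Free_sel(2)[OF hm_hom[OF f(4)]] counit_def)
  qed
  show "Comp Alg (counit (omap Free X)) (amap Free (\<eta> X)) = Id Alg (omap Free X)" if X: "X \<in> Ob K" for X
  proof -
    note F = Fr[OF X]
    note l = lift[OF \<eta>[OF X]]
    note ep = eps[OF F]
    have "eps (Fr X) \<odot> lift (\<eta> X) = Id K (fst (Fr X))"
    proof (rule Fr_eqI[OF X hm_comp[OF Fr_type[OF X] l(1) ep(1)] hm_id[OF Fr_type[OF X]]])
      show "(eps (Fr X) \<odot> lift (\<eta> X)) \<odot> \<eta> X = Id K (fst (Fr X)) \<odot> \<eta> X"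
        using comp_assoc[OF C \<eta>[OF X] hm_hom[OF l(1)] hm_hom[OF ep(1)]] l(2)
          comp_assoc[OF C \<eta>[OF X] \<eta>[OF Fr_ob[OF X]] hm_hom[OF ep(1)]] ep(2) by simp
    qed
    then show ?thesis by (simp add: Free_sel(1) Free_sel(2)[OF \<eta>[OF X]] counit_def)
  qed
  show "amap alg_forget (counit B) \<odot> \<eta> (omap alg_forget B) = Id K (omap alg_forget B)" if "B \<in> Ob Alg" for B
    using eps(2)[of B] that by (simp add: counit_def)
qed

section \<open>Eilenberg-Moore algebras of the induced monad\<close>

abbreviation "UF \<equiv> comp_functor alg_forget Free"
abbreviation "\<mu> X \<equiv> amap alg_forget (counit (omap Free X))"
abbreviation "EM \<equiv> em_cat K UF \<eta> (\<lambda>X. \<mu> X)"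
abbreviation "Cmp_fun \<equiv> comparison_functor Alg alg_forget counit"

lemma UF_sel: "omap UF X = fst (Fr X)" "f \<in> hom K X Y \<Longrightarrow> amap UF f = lift f" "\<mu> X = eps (Fr X)"
  by (simp_all add: comp_functor_def Free_sel counit_def)

definition "EMo = em_objects K UF \<eta> (\<lambda>X. \<mu> X)"

lemma EMo: "(X, a) \<in> EMo \<longleftrightarrow> X \<in> Ob K \<and> a \<in> hom K (fst (Fr X)) X \<and> a \<odot> \<eta> X = Id K X \<and>
    a \<odot> eps (Fr X) = a \<odot> lift a"
  unfolding EMo_def em_objects_def by (auto simp: UF_sel cong: conj_cong)

lemma EM_sel: "Ob EM = EMo" "Id EM x = (x, Id K (fst x), x)" "Comp EM (y, k, z) (x, h, y') = (x, k \<odot> h, z)"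
  by (simp_all add: em_cat_def EMo_def)

lemma EM_hom: "f \<in> hom EM x y \<longleftrightarrow> (\<exists>h. f = (x, h, y) \<and> x \<in> EMo \<and> y \<in> EMo \<and> h \<in> hom K (fst x) (fst y) \<and>
    h \<odot> snd x = snd y \<odot> lift h)"
proof -
  have "f \<in> hom EM x y \<longleftrightarrow> (\<exists>h. f = (x, h, y) \<and> x \<in> EMo \<and> y \<in> EMo \<and> h \<in> hom K (fst x) (fst y) \<and>
    h \<odot> snd x = snd y \<odot> amap UF h)"
    unfolding hom_def[of EM] by (cases x; cases y) (auto simp: em_cat_def EMo_def)
  then show ?thesis by (auto simp: UF_sel(2) cong: conj_cong)
qed

definition "alg_of x = mk_alg (fst x) (\<lambda>w g. snd x \<odot> snd (Fr (fst x)) w (\<eta> (fst x) \<odot> g))"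

text \<open>The associativity law makes \<open>a\<close> a homomorphism from \<open>Fr X\<close>. By
  the unit law each \<open>g\<close> is \<open>a\<close> after \<open>\<eta> X\<close> after
  \<open>g\<close>, so \<open>Fr X\<close> covers the new algebra and passes its equations
  on.\<close>

lemma alg_of:
  assumes x: "(X, a) \<in> EMo"
  shows "alg_of (X, a) \<in> algs" "fst (alg_of (X, a)) = X" "hm (Fr X) a (alg_of (X, a))" "eps (alg_of (X, a)) = a"
    and "w \<in> ops E \<Longrightarrow> g \<in> hom K (src w) X \<Longrightarrow> snd (alg_of (X, a)) w g = a \<odot> snd (Fr X) w (\<eta> X \<odot> g)"
proof -
  let ?B = "alg_of (X, a)"
  have X: "X \<in> Ob K" and a: "a \<in> hom K (fst (Fr X)) X" and unit: "a \<odot> \<eta> X = Id K X"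
    and mult: "a \<odot> eps (Fr X) = a \<odot> lift a" using x by (auto simp: EMo)
  note \<eta>X = \<eta>[OF X] and FX = Fr_type[OF X]
  note FFX = Fr_type[OF Fr_ob[OF X]] and \<eta>FX = \<eta>[OF Fr_ob[OF X]]
  note ep = eps[OF Fr[OF X]] and la = lift[OF a]
  note ep' = hm_hom[OF ep(1)] and la' = hm_hom[OF la(1)]
  show fB: "fst ?B = X" by (simp add: alg_of_def mk_alg_sel)
  show B_op: "snd ?B w g = a \<odot> snd (Fr X) w (\<eta> X \<odot> g)" if "w \<in> ops E" "g \<in> hom K (src w) X" for w g
    using that by (simp add: alg_of_def mk_alg_sel)
  have Btype: "?B \<in> type_algebras K E"
    unfolding alg_of_def fst_conv snd_conv
    by (rule mk_alg_type[OF X]) (rule comp_in[OF C op_in[OF FX _ comp_in[OF C _ \<eta>X]] a])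
  show a_hm: "hm (Fr X) a ?B"
  proof (rule hmI)
    show "a \<in> hom K (fst (Fr X)) (fst ?B)" using a by (simp add: fB)
    fix w y assume w: "w \<in> ops E" and y: "y \<in> hom K (src w) (fst (Fr X))"
    note ay = comp_in[OF C y a] and \<eta>y = comp_in[OF C y \<eta>FX]
    note o = op_in[OF FFX w \<eta>y]
    \<comment> \<open>Naturality of \<open>\<eta>\<close> turns \<open>\<eta>\<close> after
      \<open>a\<close> into \<open>lift a\<close> after \<open>\<eta>\<close>; the associativity law
      then trades \<open>lift a\<close> for the counit, which cancels against
      \<open>\<eta>\<close>.\<close>
    have "snd ?B w (a \<odot> y) = a \<odot> snd (Fr X) w (lift a \<odot> \<eta> (fst (Fr X)) \<odot> y)"
      using B_op[OF w ay] comp_assoc[OF C y a \<eta>X] comp_assoc[OF C y \<eta>FX la'] la(2) by simp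
    also have "\<dots> = (a \<odot> lift a) \<odot> snd (Fr (fst (Fr X))) w (\<eta> (fst (Fr X)) \<odot> y)"
      using hm_op[OF la(1) w \<eta>y] comp_assoc[OF C o la' a] by simp
    also have "\<dots> = a \<odot> snd (Fr X) w (eps (Fr X) \<odot> \<eta> (fst (Fr X)) \<odot> y)"
      unfolding mult[symmetric] using hm_op[OF ep(1) w \<eta>y] comp_assoc[OF C o ep' a] by simp
    also have "eps (Fr X) \<odot> \<eta> (fst (Fr X)) \<odot> y = y"
      using comp_assoc[OF C y \<eta>FX ep'] ep(2) id_comp[OF C y] by simp
    finally show "a \<odot> snd (Fr X) w y = snd ?B w (a \<odot> y)" by simp
  qed
  show B: "?B \<in> algs"
  proof (rule algs_cover[OF Btype])
    fix Y g assume "g \<in> hom K Y (fst ?B)"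
    then have g: "g \<in> hom K Y X" by (simp add: fB)
    have "a \<odot> \<eta> X \<odot> g = g" using comp_assoc[OF C g \<eta>X a] unit id_comp[OF C g] by simp
    then show "\<exists>A h g'. A \<in> algs \<and> hm A h ?B \<and> g' \<in> hom K Y (fst A) \<and> h \<odot> g' = g"
      using Fr[OF X] a_hm comp_in[OF C g \<eta>X] by (intro exI conjI)
  qed
  show "eps ?B = a"
    by (rule Fr_eqI[OF X, of _ ?B]) (use eps[OF B] a_hm unit in \<open>simp_all add: fB\<close>)
qed

text \<open>The first claim is naturality of the counit at the counit. For the second,
  \<open>eps B\<close> is a homomorphism and \<open>eps B\<close> after \<open>\<eta>\<close> is the
  identity, so the recovered operation takes the original value at \<open>g\<close>.\<close>

lemma alg_of_eps:
  assumes B: "B \<in> algs"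
  shows "(fst B, eps B) \<in> EMo" "alg_of (fst B, eps B) = B"
proof -
  have X: "fst B \<in> Ob K" by (rule alg_ob[OF algs_type[OF B]])
  note e = eps[OF B]
  note e' = hm_hom[OF e(1)]
  have "eps B \<odot> eps (Fr (fst B)) = eps B \<odot> lift (eps B)"
    by (rule eps_natural[OF Fr[OF X] B e(1)])
  then show x: "(fst B, eps B) \<in> EMo" using X e e' by (simp add: EMo)
  show "alg_of (fst B, eps B) = B"
  proof (rule type_algebra_eqI[OF algs_type[OF alg_of(1)[OF x]] algs_type[OF B] alg_of(2)[OF x]])
    fix w g assume w: "w \<in> ops E" and "g \<in> hom K (src w) (fst (alg_of (fst B, eps B)))"
    then have g: "g \<in> hom K (src w) (fst B)" by (simp add: alg_of(2)[OF x])
    show "snd (alg_of (fst B, eps B)) w g = snd B w g"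
      using alg_of(5)[OF x w g] hm_op[OF e(1) w comp_in[OF C g \<eta>[OF X]]] comp_assoc[OF C g \<eta>[OF X] e'] e(2)
        id_comp[OF C g] by simp
  qed
qed

lemma alg_of_hm:
  assumes x: "x \<in> EMo" and y: "y \<in> EMo" and h: "h \<in> hom K (fst x) (fst y)"
    and eq: "h \<odot> snd x = snd y \<odot> lift h"
  shows "hm (alg_of x) h (alg_of y)"
proof -
  obtain X a Y b where xy: "x = (X, a)" "y = (Y, b)" by (cases x, cases y)
  note x = x[unfolded xy] and y = y[unfolded xy] and h = h[unfolded xy fst_conv] and eq = eq[unfolded xy snd_conv]
  have X: "X \<in> Ob K" and a: "a \<in> hom K (fst (Fr X)) X" using x by (auto simp: EMo)
  have Y: "Y \<in> Ob K" and b: "b \<in> hom K (fst (Fr Y)) Y" using y by (auto simp: EMo)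
  note l = lift[OF h]
  note l' = hm_hom[OF l(1)]
  show ?thesis unfolding xy
  proof (rule hmI)
    show "h \<in> hom K (fst (alg_of (X, a))) (fst (alg_of (Y, b)))"
      using h by (simp add: alg_of(2)[OF x] alg_of(2)[OF y])
    fix w g assume w: "w \<in> ops E" and "g \<in> hom K (src w) (fst (alg_of (X, a)))"
    then have g: "g \<in> hom K (src w) X" by (simp add: alg_of(2)[OF x])
    note \<eta>g = comp_in[OF C g \<eta>[OF X]]
    note o = op_in[OF Fr_type[OF X] w \<eta>g]
    have "h \<odot> snd (alg_of (X, a)) w g = (h \<odot> a) \<odot> snd (Fr X) w (\<eta> X \<odot> g)"
      using alg_of(5)[OF x w g] comp_assoc[OF C o a h] by simp
    also have "\<dots> = b \<odot> lift h \<odot> snd (Fr X) w (\<eta> X \<odot> g)"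
      unfolding eq by (rule comp_assoc[OF C o l' b])
    also have "\<dots> = b \<odot> snd (Fr Y) w (\<eta> Y \<odot> h \<odot> g)"
      using hm_op[OF l(1) w \<eta>g] comp_assoc[OF C g \<eta>[OF X] l'] comp_assoc[OF C g h \<eta>[OF Y]] l(2) by simp
    also have "\<dots> = snd (alg_of (Y, b)) w (h \<odot> g)"
      using alg_of(5)[OF y w comp_in[OF C g h]] by simp
    finally show "h \<odot> snd (alg_of (X, a)) w g = snd (alg_of (Y, b)) w (h \<odot> g)" .
  qed
qed

lemma EM_homE:
  assumes "f \<in> hom EM x y"
  obtains h where "f = (x, h, y)" "x \<in> EMo" "y \<in> EMo" "h \<in> hom K (fst x) (fst y)" "h \<odot> snd x = snd y \<odot> lift h"
  using assms unfolding EM_hom by (elim exE conjE)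

lemma EM_homI: "x \<in> EMo \<Longrightarrow> y \<in> EMo \<Longrightarrow> h \<in> hom K (fst x) (fst y) \<Longrightarrow> h \<odot> snd x = snd y \<odot> lift h \<Longrightarrow>
    (x, h, y) \<in> hom EM x y"
  by (simp add: EM_hom)

lemma EMo_hom: "x \<in> EMo \<Longrightarrow> fst x \<in> Ob K \<and> snd x \<in> hom K (fst (Fr (fst x))) (fst x)"
  by (cases x) (simp add: EMo)

definition alg_fun :: "('o \<times> 'm, ('o \<times> 'm) \<times> 'm \<times> 'o \<times> 'm, ('o, 'm, 'w) alg,
    ('o, 'm, 'w) alg \<times> 'm \<times> ('o, 'm, 'w) alg) fctr" where
  "alg_fun = \<lparr>omap = alg_of, amap = (\<lambda>(x, h, y). (alg_of x, h, alg_of y))\<rparr>"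

lemma alg_of': "x \<in> EMo \<Longrightarrow> alg_of x \<in> algs" "x \<in> EMo \<Longrightarrow> fst (alg_of x) = fst x"
    "x \<in> EMo \<Longrightarrow> (fst (alg_of x), eps (alg_of x)) = x"
  using alg_of[of "fst x" "snd x"] by simp_all

lemma Cmp_sel: "omap Cmp_fun B = (fst B, eps B)"
    "amap Cmp_fun (B, h, D) = ((fst B, eps B), h, (fst D, eps D))"
  by (simp_all add: comparison_functor_def counit_def alg_cat_def)

lemma EM_category: "category EM"
proof (rule categoryI)
  show "Dom EM f \<in> Ob EM \<and> Cod EM f \<in> Ob EM" if "f \<in> Arr EM" for f
    using that by (auto simp: em_cat_def)
  show "Id EM x \<in> hom EM x x" if "x \<in> Ob EM" for x
  proof -
    have x: "x \<in> EMo" using that by (simp add: EM_sel)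
    note x' = EMo_hom[OF x]
    show ?thesis unfolding EM_sel
      by (rule EM_homI[OF x x]) (use x' in \<open>simp_all add: id_in[OF C] lift_id id_comp[OF C conjunct2[OF x']] comp_id[OF C conjunct2[OF x']]\<close>)
  qed
  show "Comp EM g f \<in> hom EM x z" if fg: "f \<in> hom EM x y" "g \<in> hom EM y z" for x y z f g
  proof -
    obtain h where h: "f = (x, h, y)" "x \<in> EMo" "y \<in> EMo" "h \<in> hom K (fst x) (fst y)"
      "h \<odot> snd x = snd y \<odot> lift h" using fg(1) by (rule EM_homE)
    obtain k where k: "g = (y, k, z)" "y \<in> EMo" "z \<in> EMo" "k \<in> hom K (fst y) (fst z)"
      "k \<odot> snd y = snd z \<odot> lift k" using fg(2) by (rule EM_homE)
    note x = EMo_hom[OF h(2)] and y = EMo_hom[OF h(3)] and z = EMo_hom[OF k(3)]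
    note lh = hm_hom[OF lift(1)[OF h(4)]] and lk = hm_hom[OF lift(1)[OF k(4)]]
    have "(k \<odot> h) \<odot> snd x = k \<odot> snd y \<odot> lift h"
      using comp_assoc[OF C conjunct2[OF x] h(4) k(4)] h(5) by simp
    also have "\<dots> = (snd z \<odot> lift k) \<odot> lift h"
      using comp_assoc[OF C lh conjunct2[OF y] k(4)] k(5) by simp
    also have "\<dots> = snd z \<odot> lift (k \<odot> h)"
      using comp_assoc[OF C lh lk conjunct2[OF z]] lift_comp[OF h(4) k(4)] by simp
    finally have "(k \<odot> h) \<odot> snd x = snd z \<odot> lift (k \<odot> h)" .
    then show ?thesis unfolding h(1) k(1) EM_sel by (rule EM_homI[OF h(2) k(3) comp_in[OF C h(4) k(4)]])
  qed
  show "Comp EM f (Id EM x) = f \<and> Comp EM (Id EM y) f = f" if "f \<in> hom EM x y" for x y f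
    using that by (elim EM_homE) (simp add: EM_sel comp_id[OF C] id_comp[OF C])
  show "Comp EM h (Comp EM g f) = Comp EM (Comp EM h g) f"
    if "f \<in> hom EM w x" "g \<in> hom EM x y" "h \<in> hom EM y z" for w x y z f g h
    using that by (elim EM_homE) (simp add: EM_sel comp_assoc[OF C])
qed

lemma Cmp_functor: "is_functor Alg EM Cmp_fun"
proof (rule is_functorI)
  show "omap Cmp_fun B \<in> Ob EM" if "B \<in> Ob Alg" for B
    using alg_of_eps(1)[of B] that by (simp add: Cmp_sel EM_sel)
  show "amap Cmp_fun f \<in> hom EM (omap Cmp_fun B) (omap Cmp_fun D)" if "f \<in> hom Alg B D" for B D f
    using that
  proof (rule Alg_homE)
    fix h assume h: "f = (B, h, D)" "B \<in> algs" "D \<in> algs" "hm B h D"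
    show ?thesis unfolding h(1) Cmp_sel
      by (rule EM_homI[OF alg_of_eps(1)[OF h(2)] alg_of_eps(1)[OF h(3)]])
        (use hm_hom[OF h(4)] eps_natural[OF h(2-4)] in simp_all)
  qed
  show "amap Cmp_fun (Comp Alg g f) = Comp EM (amap Cmp_fun g) (amap Cmp_fun f)"
    if "f \<in> hom Alg X Y" "g \<in> hom Alg Y Z" for X Y Z f g
    using that by (elim Alg_homE) (simp add: Cmp_sel EM_sel)
qed (simp add: Cmp_sel EM_sel)

lemma alg_fun_functor: "is_functor EM Alg alg_fun"
proof (rule is_functorI)
  show "omap alg_fun x \<in> Ob Alg" if "x \<in> Ob EM" for x
    using that alg_of' by (simp add: EM_sel alg_fun_def)
  show "amap alg_fun f \<in> hom Alg (omap alg_fun x) (omap alg_fun y)" if "f \<in> hom EM x y" for x y f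
    using that by (elim EM_homE) (simp add: alg_fun_def Alg_homI alg_of' alg_of_hm)
  show "amap alg_fun (Id EM x) = Id Alg (omap alg_fun x)" if "x \<in> Ob EM" for x
    using that by (simp add: EM_sel alg_fun_def alg_of')
  show "amap alg_fun (Comp EM g f) = Comp Alg (amap alg_fun g) (amap alg_fun f)"
    if "f \<in> hom EM X Y" "g \<in> hom EM Y Z" for X Y Z f g
    using that by (elim EM_homE) (simp add: EM_sel alg_fun_def)
qed

text \<open>The comparison functor is even an isomorphism of categories: both composites with
  \<open>alg_fun\<close> are the identity on objects and arrows.\<close>

lemma monadic: "monadic Alg K alg_forget"
proof -
  have "naturally_isomorphic Alg Alg id_functor (comp_functor alg_fun Cmp_fun)"
  proof (rule naturally_isomorphic_eqI(1)[OF Alg_category Alg_category id_functor_functor[OF Alg_category]])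
    show "omap (comp_functor alg_fun Cmp_fun) B = omap id_functor B" if "B \<in> Ob Alg" for B
      using that alg_of_eps(2)[of B] by (simp add: comp_functor_def id_functor_def Cmp_sel alg_fun_def)
    show "amap (comp_functor alg_fun Cmp_fun) f = amap id_functor f" if "f \<in> hom Alg B D" for B D f
      using that by (elim Alg_homE) (simp add: comp_functor_def id_functor_def Cmp_sel alg_fun_def alg_of_eps(2))
  qed
  moreover have "naturally_isomorphic EM EM (comp_functor Cmp_fun alg_fun) id_functor"
  proof (rule naturally_isomorphic_eqI(2)[OF EM_category EM_category id_functor_functor[OF EM_category]])
    show "omap (comp_functor Cmp_fun alg_fun) x = omap id_functor x" if "x \<in> Ob EM" for x
    proof -
      have "x \<in> EMo" using that by (simp add: EM_sel)
      then show ?thesis by (simp add: comp_functor_def id_functor_def Cmp_sel alg_fun_def alg_of'(3))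
    qed
    show "amap (comp_functor Cmp_fun alg_fun) f = amap id_functor f" if "f \<in> hom EM x y" for x y f
      using that by (elim EM_homE) (simp add: comp_functor_def id_functor_def Cmp_sel alg_fun_def alg_of'(3))
  qed
  ultimately have "equivalence Alg EM Cmp_fun"
    unfolding equivalence_def using Cmp_functor alg_fun_functor by blast
  then show ?thesis unfolding monadic_def using adjunction_Free by blast
qed

end


section \<open>Local presentability of the category of algebras\<close>

context theory_on
begin

text \<open>For the family of carriers of \<open>D\<close>, the condition \<open>ok\<close> turns a
  structure into a cocone over \<open>D\<close>, so an initial structure is a colimit.\<close>

lemma Alg_cocomplete: "cocomplete U Alg"
  unfolding cocomplete_def
proof (intro allI impI)
  fix J :: "('u, 'u) cat" and D assume J: "small_category U J" and D: "is_functor J Alg D"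
  have J_cat: "category J" and J_ob: "small U (Ob J)" using J by (simp_all add: small_category_def)
  have Dalg: "omap D i \<in> algs" if "i \<in> Ob J" for i using functor_ob[OF D that] by simp
  note Dtype = algs_type[OF Dalg]
  define d where "d a = amap alg_forget (amap D a)" for a
  have Dhm: "amap D a = (omap D i, d a, omap D j)" "hm (omap D i) (d a) (omap D j)"
    if "a \<in> hom J i j" for i j a
    using functor_hom[OF D that] by (auto simp: Alg_hom d_def)
  define ok where "ok B f \<longleftrightarrow> (\<forall>i\<in>Ob J. hm (omap D i) (f i) B) \<and>
    (\<forall>i j a. a \<in> hom J i j \<longrightarrow> f j \<odot> d a = f i)" for B f
  let ?Z = "\<lambda>i. fst (omap D i)"
  interpret s: structures U r K P E "Ob J" ?Z ok
  proof unfold_locales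
    show "small U (Ob J)" by (rule J_ob)
    show "?Z i \<in> Ob K" if "i \<in> Ob J" for i by (rule alg_ob[OF Dtype[OF that]])
    fix L f e assume L: "L \<in> algs" and f: "f \<in> (\<Pi>\<^sub>E i\<in>Ob J. hom K (?Z i) (fst L))"
      and e: "\<And>s. s \<in> structs (Ob J) ?Z ok \<Longrightarrow> hm L (e s) (fst s) \<and> (\<forall>i\<in>Ob J. e s \<odot> f i = snd s i)"
      and mono: "\<And>X x y. x \<in> hom K X (fst L) \<Longrightarrow> y \<in> hom K X (fst L) \<Longrightarrow>
        (\<forall>s\<in>structs (Ob J) ?Z ok. e s \<odot> x = e s \<odot> y) \<Longrightarrow> x = y"
    note fi = PiE_mem[OF f]
    have s_ok: "ok (fst s) (snd s)" if "s \<in> structs (Ob J) ?Z ok" for s using that by (auto simp: structs_def)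
    \<comment> \<open>Both clauses of \<open>ok\<close> are equations between morphisms into
      \<open>L\<close>. They hold after each \<open>e s\<close> because the structures satisfy them,
      and joint monicity removes \<open>e s\<close>.\<close>
    have "hm (omap D i) (f i) L" if i: "i \<in> Ob J" for i
    proof (rule hmI[OF fi[OF i]])
      fix w g assume w: "w \<in> ops E" and g: "g \<in> hom K (src w) (?Z i)"
      note o = op_in[OF Dtype[OF i] w g] and fg = comp_in[OF C g fi[OF i]]
      show "f i \<odot> snd (omap D i) w g = snd L w (f i \<odot> g)"
      proof (rule mono[OF comp_in[OF C o fi[OF i]] op_in[OF algs_type[OF L] w fg]], rule ballI)
        fix s assume s: "s \<in> structs (Ob J) ?Z ok"
        have es: "hm L (e s) (fst s)" and ef: "e s \<odot> f i = snd s i" using e[OF s] i by auto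
        have si: "hm (omap D i) (snd s i) (fst s)" using s_ok[OF s] i by (simp add: ok_def)
        show "e s \<odot> f i \<odot> snd (omap D i) w g = e s \<odot> snd L w (f i \<odot> g)"
          using comp_assoc[OF C o fi[OF i] hm_hom[OF es]] comp_assoc[OF C g fi[OF i] hm_hom[OF es]]
            hm_op[OF si w g] hm_op[OF es w fg] ef by simp
      qed
    qed
    moreover have "f j \<odot> d a = f i" if a: "a \<in> hom J i j" for i j a
    proof -
      have ij: "i \<in> Ob J" "j \<in> Ob J" using hom_ob[OF J_cat a] by auto
      note da = hm_hom[OF Dhm(2)[OF a]]
      show ?thesis
      proof (rule mono[OF comp_in[OF C da fi[OF ij(2)]] fi[OF ij(1)]], rule ballI)
        fix s assume s: "s \<in> structs (Ob J) ?Z ok"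
        have es: "e s \<in> hom K (fst L) (fst (fst s))" and ef: "e s \<odot> f i = snd s i" "e s \<odot> f j = snd s j"
          using e[OF s] ij hm_hom by auto
        have "snd s j \<odot> d a = snd s i" using s_ok[OF s] a by (simp add: ok_def)
        then show "e s \<odot> f j \<odot> d a = e s \<odot> f i"
          using comp_assoc[OF C da fi[OF ij(2)] es] ef by simp
      qed
    qed
    ultimately show "ok L f" by (simp add: ok_def)
  qed
  obtain L f where L: "(L, f) \<in> s.S" "\<And>s. s \<in> s.S \<Longrightarrow> \<exists>h. hm L h (fst s) \<and> (\<forall>i\<in>Ob J. h \<odot> f i = snd s i)"
    "\<And>B h k. hm L h B \<Longrightarrow> hm L k B \<Longrightarrow> \<forall>i\<in>Ob J. h \<odot> f i = k \<odot> f i \<Longrightarrow> h = k"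
    by (rule s.initial_structure) rule
  have L_alg: "L \<in> algs" and "ok L f" using L(1) by (simp_all add: structs_def)
  then have fhm: "hm (omap D i) (f i) L" if "i \<in> Ob J" for i using that by (simp add: ok_def)
  have fd: "f j \<odot> d a = f i" if "a \<in> hom J i j" for i j a using \<open>ok L f\<close> that by (simp add: ok_def)
  have "colimit Alg J D L (\<lambda>i. (omap D i, f i, L))"
  proof (rule colimitI)
    show "cocone Alg J D L (\<lambda>i. (omap D i, f i, L))"
    proof (rule coconeI)
      show "L \<in> Ob Alg" using L_alg by simp
      show "(omap D i, f i, L) \<in> hom Alg (omap D i) L" if "i \<in> Ob J" for i
        by (rule Alg_homI[OF Dalg[OF that] L_alg fhm[OF that]])
      show "Comp Alg (omap D j, f j, L) (amap D a) = (omap D i, f i, L)" if a: "a \<in> hom J i j" for i j a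
        unfolding Dhm(1)[OF a] using fd[OF a] by simp
    qed
  next
    fix B \<sigma> assume co: "cocone Alg J D B \<sigma>"
    have B: "B \<in> algs" using cocone_ob[OF co] by simp
    define t where "t = (\<lambda>i\<in>Ob J. amap alg_forget (\<sigma> i))"
    have t: "\<sigma> i = (omap D i, t i, B)" "hm (omap D i) (t i) B" if "i \<in> Ob J" for i
      using cocone_hom[OF co that] that by (auto simp: Alg_hom t_def)
    have "t j \<odot> d a = t i" if a: "a \<in> hom J i j" for i j a
    proof -
      have ij: "i \<in> Ob J" "j \<in> Ob J" using hom_ob[OF J_cat a] by auto
      show ?thesis using cocone_comp[OF co a] by (simp add: Dhm(1)[OF a] t(1)[OF ij(1)] t(1)[OF ij(2)])
    qed
    then have "ok B t" using t(2) by (simp add: ok_def)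
    moreover have "t \<in> (\<Pi>\<^sub>E i\<in>Ob J. hom K (?Z i) (fst B))"
      using hm_hom[OF t(2)] by (simp add: PiE_iff) (simp add: t_def)
    ultimately have "(B, t) \<in> s.S" using B by (simp add: structs_def)
    from L(2)[OF this] obtain h where h: "hm L h B" "\<forall>i\<in>Ob J. h \<odot> f i = t i" by auto
    then show "\<exists>h\<in>hom Alg L B. \<forall>i\<in>Ob J. Comp Alg h (omap D i, f i, L) = \<sigma> i"
      by (intro bexI[of _ "(L, h, B)"] Alg_homI[OF L_alg B h(1)] ballI) (simp add: t(1))
  next
    fix B h k assume h: "h \<in> hom Alg L B" and k: "k \<in> hom Alg L B"
      and eq: "\<And>i. i \<in> Ob J \<Longrightarrow> Comp Alg h (omap D i, f i, L) = Comp Alg k (omap D i, f i, L)"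
    obtain h' where h': "h = (L, h', B)" "hm L h' B" using h by (rule Alg_homE)
    obtain k' where k': "k = (L, k', B)" "hm L k' B" using k by (rule Alg_homE)
    have "h' = k'" by (rule L(3)[OF h'(2) k'(2)]) (use eq in \<open>simp add: h' k'\<close>)
    then show "h = k" by (simp add: h' k')
  qed
  then show "\<exists>c \<tau>. colimit Alg J D c \<tau>" by blast
qed

lemma Alg_cocomplete_base: "cocomplete_base U r Alg"
  by (intro cocomplete_base.intro Alg_base) (unfold_locales, rule Alg_cocomplete)

text \<open>By adjunction, homomorphisms out of \<open>Fr X\<close> are morphisms from
  \<open>X\<close> to the carrier, and filtered colimits are computed in \<open>K\<close>. Both
  properties of \<open>X\<close> are thus carried over, through \<open>ext\<close> and
  \<open>Fr_eqI\<close>.\<close>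

lemma Fr_presentable:
  assumes X: "X \<in> P"
  shows "presentable U r Alg (Fr X)"
proof -
  interpret A: base U r Alg by (rule Alg_base)
  note X_ob = P_ob[OF X]
  show ?thesis
  proof (rule A.presentableI)
    show "Fr X \<in> Ob Alg" using Fr[OF X_ob] by simp
    fix J :: "('u, 'u) cat" and D c \<tau> assume "diagram_in U r Alg J D c \<tau>"
    then interpret d: diagram_in U r Alg J D c \<tau> .
    let ?UD = "comp_functor alg_forget D" and ?\<tau> = "\<lambda>i. amap alg_forget (\<tau> i)"
    have UD: "is_functor J K ?UD" by (rule comp_functor_functor[OF d.D forget_functor])
    have UDo: "omap ?UD i = fst (omap D i)" for i by (simp add: comp_functor_def)
    have L: "colimit K J ?UD (fst c) ?\<tau>" by (rule colimit_in_K[OF d.J_small d.J d.D d.c])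
    interpret k: diagram_in U r K J ?UD "fst c" ?\<tau> by (rule diagram_inI[OF d.J_small d.J UD L])
    have fac: "k.factors X" and sep: "k.separates X"
      using presentableD[OF P_pres[OF X] d.J_small d.J UD L] by simp_all
    have Dalg: "omap D i \<in> algs" if "i \<in> Ob J" for i using functor_ob[OF d.D that] by simp
    have \<tau>: "\<tau> i = (omap D i, ?\<tau> i, c)" "hm (omap D i) (?\<tau> i) c" if "i \<in> Ob J" for i
      using d.\<tau>_hom[OF that] by (auto simp: Alg_hom)
    note \<eta>X = \<eta>[OF X_ob] and FX = Fr_type[OF X_ob]
    have "d.factors (Fr X)"
      unfolding d.factors_def
    proof
      fix x assume "x \<in> hom Alg (Fr X) c"
      then obtain h where h: "x = (Fr X, h, c)" "hm (Fr X) h c" by (rule Alg_homE)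
      obtain i g where ig: "i \<in> Ob J" "g \<in> hom K X (fst (omap D i))" "?\<tau> i \<odot> g = h \<odot> \<eta> X"
        using k.factorsE[OF fac comp_in[OF C \<eta>X hm_hom[OF h(2)]]] unfolding UDo .
      note e = ext[OF X_ob Dalg[OF ig(1)] ig(2)]
      have "?\<tau> i \<odot> ext X (omap D i) g = h"
        by (rule Fr_eqI[OF X_ob hm_comp[OF FX e(1) \<tau>(2)[OF ig(1)]] h(2)])
          (simp add: comp_assoc[OF C \<eta>X hm_hom[OF e(1)] hm_hom[OF \<tau>(2)[OF ig(1)]]] e(2) ig(3))
      then have "Comp Alg (\<tau> i) (Fr X, ext X (omap D i) g, omap D i) = x"
        by (subst \<tau>(1)[OF ig(1)]) (simp add: h(1))
      then show "\<exists>i\<in>Ob J. \<exists>g\<in>hom Alg (Fr X) (omap D i). Comp Alg (\<tau> i) g = x"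
        using ig(1) Alg_homI[OF Fr[OF X_ob] Dalg[OF ig(1)] e(1)] by (intro bexI)
    qed
    moreover have "d.separates (Fr X)"
      unfolding d.separates_def
    proof (intro ballI impI)
      fix i g g' assume i: "i \<in> Ob J" and g: "g \<in> hom Alg (Fr X) (omap D i)" and g': "g' \<in> hom Alg (Fr X) (omap D i)"
        and eq: "Comp Alg (\<tau> i) g = Comp Alg (\<tau> i) g'"
      obtain h where h: "g = (Fr X, h, omap D i)" "hm (Fr X) h (omap D i)" using g by (rule Alg_homE)
      obtain h' where h': "g' = (Fr X, h', omap D i)" "hm (Fr X) h' (omap D i)" using g' by (rule Alg_homE)
      have "?\<tau> i \<odot> h = ?\<tau> i \<odot> h'" using eq unfolding h(1) h'(1) by (subst (asm) (1 2) \<tau>(1)[OF i]) simp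
      then have "?\<tau> i \<odot> h \<odot> \<eta> X = ?\<tau> i \<odot> h' \<odot> \<eta> X"
        using comp_assoc[OF C \<eta>X hm_hom[OF h(2)] hm_hom[OF \<tau>(2)[OF i]]]
          comp_assoc[OF C \<eta>X hm_hom[OF h'(2)] hm_hom[OF \<tau>(2)[OF i]]] by simp
      then obtain k w where w: "w \<in> hom J i k" "amap ?UD w \<odot> h \<odot> \<eta> X = amap ?UD w \<odot> h' \<odot> \<eta> X"
        using k.separatesE[OF sep i, of "h \<odot> \<eta> X" "h' \<odot> \<eta> X"] comp_in[OF C \<eta>X hm_hom[OF h(2)]]
          comp_in[OF C \<eta>X hm_hom[OF h'(2)]] unfolding UDo by blast
      have Dw: "amap D w = (omap D i, amap ?UD w, omap D k)" "hm (omap D i) (amap ?UD w) (omap D k)"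
        using functor_hom[OF d.D w(1)] by (auto simp: Alg_hom comp_functor_def)
      have "amap ?UD w \<odot> h = amap ?UD w \<odot> h'"
        by (rule Fr_eqI[OF X_ob hm_comp[OF FX h(2) Dw(2)] hm_comp[OF FX h'(2) Dw(2)]])
          (simp add: comp_assoc[OF C \<eta>X hm_hom[OF h(2)] hm_hom[OF Dw(2)]]
            comp_assoc[OF C \<eta>X hm_hom[OF h'(2)] hm_hom[OF Dw(2)]] w(2))
      then have "Comp Alg (amap D w) g = Comp Alg (amap D w) g'" by (simp add: Dw(1) h(1) h'(1))
      then show "\<exists>k. \<exists>w\<in>hom J i k. Comp Alg (amap D w) g = Comp Alg (amap D w) g'"
        using w(1) by (intro exI[of _ k] bexI[of _ w])
    qed
    ultimately show "d.factors (Fr X) \<and> d.separates (Fr X)" ..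
  qed
qed

section \<open>A small set of presentable algebras closed under coproducts and coequalizers of size
  below \<open>r\<close>\<close>

definition "acop N d = (SOME c. (\<exists>\<iota>. colimit Alg (disc_cat N) (disc_functor Alg d) c \<iota>) \<and>
  presentable U r Alg c)" for N :: "'l set"

definition "acoeq A B H = (SOME c. (\<exists>\<tau>. colimit Alg (par_cat H) (par_functor Alg A B) c \<tau>) \<and>
  presentable U r Alg c)"

lemma acop:
  assumes "|N :: 'l set| <o r" "\<And>n. n \<in> N \<Longrightarrow> presentable U r Alg (d n)"
  shows "\<exists>\<iota>. coproduct Alg N d (acop N d) \<iota>" "presentable U r Alg (acop N d)"
proof -
  interpret A: cocomplete_base U r Alg by (rule Alg_cocomplete_base)
  obtain c \<iota> where "colimit Alg (disc_cat N) (disc_functor Alg d) c \<iota>" "presentable U r Alg c"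
    using A.coproduct_ex[where d = d, OF assms] .
  then have "\<exists>c. (\<exists>\<iota>. colimit Alg (disc_cat N) (disc_functor Alg d) c \<iota>) \<and> presentable U r Alg c"
    by (intro exI conjI)
  from someI_ex[OF this] obtain \<iota> where "colimit Alg (disc_cat N) (disc_functor Alg d) (acop N d) \<iota>"
    and pr: "presentable U r Alg (acop N d)" by (auto simp: acop_def)
  then have "coproduct Alg N d (acop N d) \<iota>"
    using A.presentable_ob[OF assms(2)] by (intro coproduct_colimit[OF Alg_category])
  then show "\<exists>\<iota>. coproduct Alg N d (acop N d) \<iota>" by blast
  show "presentable U r Alg (acop N d)" by fact
qed

lemma acoeq:
  assumes "|H| <o r" "H \<subseteq> hom Alg A B" "presentable U r Alg A" "presentable U r Alg B"
  shows "H \<noteq> {} \<Longrightarrow> \<exists>q. coequalizer Alg B H (acoeq A B H) q" "presentable U r Alg (acoeq A B H)"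
proof -
  interpret A: cocomplete_base U r Alg by (rule Alg_cocomplete_base)
  obtain c \<tau> where "colimit Alg (par_cat H) (par_functor Alg A B) c \<tau>" "presentable U r Alg c"
    using A.coequalizer_ex[OF assms] .
  then have "\<exists>c. (\<exists>\<tau>. colimit Alg (par_cat H) (par_functor Alg A B) c \<tau>) \<and> presentable U r Alg c"
    by (intro exI conjI)
  from someI_ex[OF this] obtain \<tau> where \<tau>: "colimit Alg (par_cat H) (par_functor Alg A B) (acoeq A B H) \<tau>"
    and pr: "presentable U r Alg (acoeq A B H)" by (auto simp: acoeq_def)
  show "\<exists>q. coequalizer Alg B H (acoeq A B H) q" if "H \<noteq> {}"
    using coequalizer_colimit[OF Alg_category A.presentable_ob[OF assms(3)] A.presentable_ob[OF assms(4)] assms(2) that \<tau>]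
    by blast
  show "presentable U r Alg (acoeq A B H)" by fact
qed

text \<open>The families are indexed by subsets of \<open>Field r\<close> because there is only a small set of those.\<close>

inductive ggen :: "('o, 'm, 'w) alg set \<Rightarrow> ('o, 'm, 'w) alg \<Rightarrow> bool" where
  free: "X \<in> P \<Longrightarrow> ggen {} (Fr X)"
| sum: "N \<subseteq> Field r \<Longrightarrow> |N| <o r \<Longrightarrow> d \<in> extensional N \<Longrightarrow> ggen (d ` N) (acop N d)"
| coeq: "|H| <o r \<Longrightarrow> H \<subseteq> hom Alg A B \<Longrightarrow> ggen {A, B} (acoeq A B H)"

definition "\<Gamma> = closure {(T, z). ggen T z}"

lemma \<Gamma>I: "ggen T z \<Longrightarrow> T \<subseteq> \<Gamma> \<Longrightarrow> z \<in> \<Gamma>"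
  unfolding \<Gamma>_def by (rule closure.step[of T]) auto

lemma \<Gamma>_presentable: "B \<in> \<Gamma> \<Longrightarrow> presentable U r Alg B"
  unfolding \<Gamma>_def
proof (induction rule: closure.induct)
  case (step T z)
  from step(1) have "ggen T z" by simp
  then show ?case
  proof cases
    case (free X)
    then show ?thesis using Fr_presentable by simp
  next
    case (sum N d)
    then show ?thesis using acop(2)[of N d] step(3) by simp
  next
    case (coeq H A B)
    then show ?thesis using acoeq(2)[of H A B] step(3) by simp
  qed
qed

lemma \<Gamma>_algs: "B \<in> \<Gamma> \<Longrightarrow> B \<in> algs"
  using base.presentable_ob[OF Alg_base \<Gamma>_presentable] by simp

lemma small_hom_Alg: "small U (hom Alg A B)"
proof (cases "A \<in> algs \<and> B \<in> algs")
  case True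
  then show ?thesis using Alg_locally_small by (simp add: locally_small_def)
next
  case False
  then have "hom Alg A B = {}" by (auto simp: Alg_hom)
  then show ?thesis by (simp add: small_finite[OF U])
qed

text \<open>\<open>acop\<close> is a choice that depends on \<open>d\<close> as a function, also off
  \<open>N\<close>; the extensionality demanded by \<open>sum\<close> places \<open>d\<close> in the
  small set \<open>N \<rightarrow>\<^sub>E T\<close>, so only a small set of choices occurs.\<close>

lemma \<Gamma>_small: "small U \<Gamma>"
  unfolding \<Gamma>_def
proof (rule small_closure[OF U r small_r])
  show "|T| <o r" if "(T, z) \<in> {(T, z). ggen T z}" for T z
  proof -
    have "ggen T z" using that by simp
    then show ?thesis by cases (simp_all add: lt_finite[OF r] lt_image)
  qed
  fix T :: "('o, 'm, 'w) alg set" assume T: "small U T"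
  have "small U (Fr ` P \<union> (\<lambda>(N, d). acop N d) ` (SIGMA N:Pow (Field r). N \<rightarrow>\<^sub>E T) \<union>
      (\<Union>A\<in>T. \<Union>B\<in>T. acoeq A B ` Pow (hom Alg A B)))"
    by (intro small_Un[OF U] small_image small_Sigma[OF U] small_PiE[OF U] small_UNION[OF U] small_Pow[OF U]
        P_small T small_r small_hom_Alg) (auto intro: small_mono[OF small_r])
  moreover have "{z. (T, z) \<in> {(T, z). ggen T z}} \<subseteq>
      Fr ` P \<union> (\<lambda>(N, d). acop N d) ` (SIGMA N:Pow (Field r). N \<rightarrow>\<^sub>E T) \<union>
      (\<Union>A\<in>T. \<Union>B\<in>T. acoeq A B ` Pow (hom Alg A B))"
  proof
    fix z assume "z \<in> {z. (T, z) \<in> {(T, z). ggen T z}}"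
    then have "ggen T z" by simp
    then show "z \<in> Fr ` P \<union> (\<lambda>(N, d). acop N d) ` (SIGMA N:Pow (Field r). N \<rightarrow>\<^sub>E T) \<union>
      (\<Union>A\<in>T. \<Union>B\<in>T. acoeq A B ` Pow (hom Alg A B))"
    proof cases
      case (sum N d)
      then have "(N, d) \<in> (SIGMA N:Pow (Field r). N \<rightarrow>\<^sub>E T)" by (auto simp: PiE_iff)
      then have "(\<lambda>(N, d). acop N d) (N, d) \<in> (\<lambda>(N, d). acop N d) ` (SIGMA N:Pow (Field r). N \<rightarrow>\<^sub>E T)"
        by (rule imageI)
      then show ?thesis unfolding sum(2) by simp
    next
      case (coeq H A B)
      then show ?thesis by blast
    qed blast
  qed
  ultimately show "small U {z. (T, z) \<in> {(T, z). ggen T z}}" by (rule small_mono)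
qed

section \<open>The canonical diagram of an algebra\<close>

definition slice :: "('o, 'm, 'w) alg \<Rightarrow> (('o, 'm, 'w) alg \<times> 'm,
    (('o, 'm, 'w) alg \<times> 'm) \<times> 'm \<times> ('o, 'm, 'w) alg \<times> 'm) cat" where
  "slice A = \<lparr>Ob = {(G, x). G \<in> \<Gamma> \<and> hm G x A},
     Arr = {((G, x), h, (G', x')). G \<in> \<Gamma> \<and> hm G x A \<and> G' \<in> \<Gamma> \<and> hm G' x' A \<and> hm G h G' \<and> x' \<odot> h = x},
     Dom = (\<lambda>(a, h, b). a), Cod = (\<lambda>(a, h, b). b),
     Id = (\<lambda>a. (a, Id K (fst (fst a)), a)), Comp = (\<lambda>(b, k, c) (a, h, b'). (a, k \<odot> h, c))\<rparr>"

definition slice_fun :: "(('o, 'm, 'w) alg \<times> 'm, (('o, 'm, 'w) alg \<times> 'm) \<times> 'm \<times> ('o, 'm, 'w) alg \<times> 'm,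
    ('o, 'm, 'w) alg, ('o, 'm, 'w) alg \<times> 'm \<times> ('o, 'm, 'w) alg) fctr" where
  "slice_fun = \<lparr>omap = fst, amap = (\<lambda>(a, h, b). (fst a, h, fst b))\<rparr>"

lemma slice_sel: "a \<in> Ob (slice A) \<longleftrightarrow> fst a \<in> \<Gamma> \<and> hm (fst a) (snd a) A"
    "Comp (slice A) (b, k, c) (a, h, b') = (a, k \<odot> h, c)" "Id (slice A) a = (a, Id K (fst (fst a)), a)"
    "omap slice_fun a = fst a" "amap slice_fun (a, h, b) = (fst a, h, fst b)"
  by (auto simp: slice_def slice_fun_def)

lemma slice_hom: "f \<in> hom (slice A) a b \<longleftrightarrow> (\<exists>h. f = (a, h, b) \<and> a \<in> Ob (slice A) \<and> b \<in> Ob (slice A) \<and>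
    hm (fst a) h (fst b) \<and> snd b \<odot> h = snd a)"
  unfolding hom_def[of "slice A"] by (cases a; cases b) (auto simp: slice_def)

lemma slice_homE:
  assumes "f \<in> hom (slice A) a b"
  obtains h where "f = (a, h, b)" "a \<in> Ob (slice A)" "b \<in> Ob (slice A)" "hm (fst a) h (fst b)" "snd b \<odot> h = snd a"
  using assms unfolding slice_hom by (elim exE conjE)

lemma slice_homI: "a \<in> Ob (slice A) \<Longrightarrow> b \<in> Ob (slice A) \<Longrightarrow> hm (fst a) h (fst b) \<Longrightarrow> snd b \<odot> h = snd a \<Longrightarrow>
    (a, h, b) \<in> hom (slice A) a b"
  by (simp add: slice_hom)

lemma slice_ob: "a \<in> Ob (slice A) \<Longrightarrow> fst a \<in> \<Gamma>" "a \<in> Ob (slice A) \<Longrightarrow> fst a \<in> algs"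
    "a \<in> Ob (slice A) \<Longrightarrow> fst a \<in> type_algebras K E" "a \<in> Ob (slice A) \<Longrightarrow> hm (fst a) (snd a) A"
  by (simp_all add: slice_sel \<Gamma>_algs algs_type)

lemma slice_category: "category (slice A)"
proof (rule categoryI)
  show "Dom (slice A) f \<in> Ob (slice A) \<and> Cod (slice A) f \<in> Ob (slice A)" if "f \<in> Arr (slice A)" for f
    using that by (auto simp: slice_def)
  show "Id (slice A) a \<in> hom (slice A) a a" if a: "a \<in> Ob (slice A)" for a
    unfolding slice_sel
    by (rule slice_homI[OF a a hm_id[OF slice_ob(3)[OF a]] comp_id[OF C hm_hom[OF slice_ob(4)[OF a]]]])
  show "Comp (slice A) g f \<in> hom (slice A) a c" if fg: "f \<in> hom (slice A) a b" "g \<in> hom (slice A) b c" for a b c f g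
  proof -
    obtain h where h: "f = (a, h, b)" "a \<in> Ob (slice A)" "b \<in> Ob (slice A)" "hm (fst a) h (fst b)" "snd b \<odot> h = snd a"
      using fg(1) by (rule slice_homE)
    obtain k where k: "g = (b, k, c)" "b \<in> Ob (slice A)" "c \<in> Ob (slice A)" "hm (fst b) k (fst c)" "snd c \<odot> k = snd b"
      using fg(2) by (rule slice_homE)
    show ?thesis unfolding h(1) k(1) slice_sel
      using comp_assoc[OF C hm_hom[OF h(4)] hm_hom[OF k(4)] hm_hom[OF slice_ob(4)[OF k(3)]]] h(5) k(5)
      by (intro slice_homI[OF h(2) k(3) hm_comp[OF slice_ob(3)[OF h(2)] h(4) k(4)]]) simp
  qed
  show "Comp (slice A) f (Id (slice A) a) = f \<and> Comp (slice A) (Id (slice A) b) f = f"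
    if "f \<in> hom (slice A) a b" for a b f
    using that by (elim slice_homE) (simp add: slice_sel(2,3) comp_id[OF C hm_hom] id_comp[OF C hm_hom])
  show "Comp (slice A) h (Comp (slice A) g f) = Comp (slice A) (Comp (slice A) h g) f"
    if "f \<in> hom (slice A) a b" "g \<in> hom (slice A) b c" "h \<in> hom (slice A) c d" for a b c d f g h
    using that by (elim slice_homE) (simp add: slice_sel(2) comp_assoc[OF C hm_hom hm_hom hm_hom])
qed

lemma slice_functor: "is_functor (slice A) Alg slice_fun"
proof (rule is_functorI)
  show "omap slice_fun a \<in> Ob Alg" if "a \<in> Ob (slice A)" for a
    using slice_ob(2)[OF that] by (simp add: slice_sel(4))
  show "amap slice_fun f \<in> hom Alg (omap slice_fun a) (omap slice_fun b)" if "f \<in> hom (slice A) a b" for a b f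
    using that by (rule slice_homE) (simp add: slice_sel(4,5) Alg_homI slice_ob(2))
  show "amap slice_fun (Comp (slice A) g f) = Comp Alg (amap slice_fun g) (amap slice_fun f)"
    if "f \<in> hom (slice A) a b" "g \<in> hom (slice A) b c" for a b c f g
    using that by (elim slice_homE) (simp add: slice_sel(2,5))
qed (simp add: slice_sel(3-5))

lemma slice_small: "small_category U (slice A)"
proof -
  have ob: "small U (Ob (slice A))"
  proof (rule small_mono)
    show "small U (SIGMA G:\<Gamma>. hom K (fst G) (fst A))" by (intro small_Sigma[OF U] \<Gamma>_small small_hom_K)
    show "Ob (slice A) \<subseteq> (SIGMA G:\<Gamma>. hom K (fst G) (fst A))" by (auto simp: slice_def dest: hm_hom)
  qed
  have "small U (Arr (slice A))"
  proof (rule small_mono)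
    show "small U (Ob (slice A) \<times> (\<Union>a\<in>Ob (slice A). \<Union>b\<in>Ob (slice A). hom K (fst (fst a)) (fst (fst b))) \<times> Ob (slice A))"
      by (intro small_Sigma[OF U] small_UNION[OF U] ob small_hom_K)
    show "Arr (slice A) \<subseteq> Ob (slice A) \<times> (\<Union>a\<in>Ob (slice A). \<Union>b\<in>Ob (slice A). hom K (fst (fst a)) (fst (fst b))) \<times> Ob (slice A)"
    proof
      fix f assume "f \<in> Arr (slice A)"
      then obtain a h b where "f = (a, h, b)" "a \<in> Ob (slice A)" "b \<in> Ob (slice A)" "hm (fst a) h (fst b)"
        by (auto simp: slice_def)
      then show "f \<in> Ob (slice A) \<times> (\<Union>a\<in>Ob (slice A). \<Union>b\<in>Ob (slice A). hom K (fst (fst a)) (fst (fst b))) \<times> Ob (slice A)"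
        using hm_hom[of "fst a" h "fst b"] by blast
    qed
  qed
  with ob show ?thesis by (simp add: small_category_def slice_category)
qed

text \<open>Bounds and coequalizing arrows come from the closure of \<open>\<Gamma>\<close>; the
  morphism from the new object to \<open>A\<close> is the copairing, respectively the factorization,
  of those already given.\<close>

lemma slice_filt:
  assumes A: "A \<in> algs"
  shows "filt r (slice A)"
  unfolding filt_def
proof (intro conjI allI impI)
  show "category (slice A)" by (rule slice_category)
  fix T assume T: "T \<subseteq> Ob (slice A)" "|T| <o r"
  \<comment> \<open>\<open>T\<close> is re-indexed by a subset of \<open>Field r\<close>, since
    \<open>sum\<close> only accepts such index sets.\<close>
  have "|T| \<le>o |Field r|"
    using T(2) card_of_Field_ordIso[OF regular_cardinalD(3)[OF r]] ordLess_imp_ordLeq ordLeq_ordIso_trans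
      ordIso_symmetric by blast
  then obtain e where e: "inj_on e T" "e ` T \<subseteq> Field r" using card_of_ordLeq[of T "Field r"] by blast
  define N where "N = e ` T"
  define d where "d = (\<lambda>n\<in>N. fst (inv_into T e n))"
  have N: "N \<subseteq> Field r" "|N| <o r" using e T(2) by (simp_all add: N_def lt_image)
  have inv: "inv_into T e n \<in> T" if "n \<in> N" for n using that by (simp add: N_def inv_into_into)
  have d\<Gamma>: "d n \<in> \<Gamma>" if "n \<in> N" for n
    using that inv[OF that] T(1) by (auto simp: d_def slice_sel(1))
  have d_e: "e t \<in> N" "d (e t) = fst t" if "t \<in> T" for t using that e by (simp_all add: d_def N_def)
  obtain \<iota> where \<iota>: "coproduct Alg N d (acop N d) \<iota>" using acop(1)[where d = d, OF N(2) \<Gamma>_presentable[OF d\<Gamma>]] by blast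
  have "ggen (d ` N) (acop N d)" by (rule ggen.sum[OF N]) (simp add: d_def)
  then have G: "acop N d \<in> \<Gamma>" by (rule \<Gamma>I) (use d\<Gamma> in blast)
  have "(d n, snd (inv_into T e n), A) \<in> hom Alg (d n) A" if n: "n \<in> N" for n
    using slice_ob(4)[OF subsetD[OF T(1) inv[OF n]]] n
    by (intro Alg_homI \<Gamma>_algs[OF d\<Gamma>[OF n]] A) (simp add: d_def)
  then obtain h where h: "h \<in> hom Alg (acop N d) A"
    "\<forall>n\<in>N. Comp Alg h (\<iota> n) = (d n, snd (inv_into T e n), A)"
    using coproductD(2)[OF \<iota>, of A "\<lambda>n. (d n, snd (inv_into T e n), A)"] A by auto
  obtain x where x: "h = (acop N d, x, A)" "hm (acop N d) x A" using h(1) by (rule Alg_homE)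
  have ob: "(acop N d, x) \<in> Ob (slice A)" using G x(2) by (simp add: slice_sel(1))
  have "hom (slice A) t (acop N d, x) \<noteq> {}" if t: "t \<in> T" for t
  proof -
    obtain k where k: "\<iota> (e t) = (d (e t), k, acop N d)" "hm (d (e t)) k (acop N d)"
      using coproductD(1)[OF \<iota> d_e(1)[OF t]] by (rule Alg_homE)
    have "x \<odot> k = snd t"
      using h(2)[rule_format, OF d_e(1)[OF t]] e(1) t by (simp add: k(1) x(1))
    then have "(t, k, (acop N d, x)) \<in> hom (slice A) t (acop N d, x)"
      using t T(1) ob k(2) d_e(2)[OF t] by (intro slice_homI) auto
    then show ?thesis by blast
  qed
  then show "\<exists>k\<in>Ob (slice A). \<forall>i\<in>T. hom (slice A) i k \<noteq> {}" using ob by blast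
next
  fix a b H assume H: "H \<subseteq> hom (slice A) a b" "|H| <o r" and b: "b \<in> Ob (slice A)"
  show "\<exists>k z. z \<in> hom (slice A) b k \<and> (\<forall>f\<in>H. \<forall>g\<in>H. Comp (slice A) z f = Comp (slice A) z g)"
  proof (cases "H = {}")
    case True
    then show ?thesis using id_in[OF slice_category b] by blast
  next
    case False
    then have a: "a \<in> Ob (slice A)" using H(1) hom_ob[OF slice_category] by blast
    define H' where "H' = amap slice_fun ` H"
    have f: "\<exists>h. f = (a, h, b) \<and> amap slice_fun f = (fst a, h, fst b) \<and> hm (fst a) h (fst b) \<and> snd b \<odot> h = snd a"
      if "f \<in> H" for f
    proof -
      have "f \<in> hom (slice A) a b" using H(1) that by blast
      then show ?thesis by (rule slice_homE) (simp add: slice_sel(5))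
    qed
    have H': "|H'| <o r" "H' \<subseteq> hom Alg (fst a) (fst b)" "H' \<noteq> {}"
    proof -
      show "|H'| <o r" "H' \<noteq> {}" unfolding H'_def using lt_image[OF H(2)] False by blast+
      show "H' \<subseteq> hom Alg (fst a) (fst b)"
        unfolding H'_def using f Alg_homI[OF slice_ob(2)[OF a] slice_ob(2)[OF b]] by fastforce
    qed
    note ab = slice_ob(1)[OF a] slice_ob(1)[OF b]
    define c where "c = acoeq (fst a) (fst b) H'"
    obtain q where q: "coequalizer Alg (fst b) H' c q"
      using acoeq(1)[OF H'(1,2) \<Gamma>_presentable[OF ab(1)] \<Gamma>_presentable[OF ab(2)] H'(3)] by (auto simp: c_def)
    have "ggen {fst a, fst b} c" unfolding c_def by (rule ggen.coeq[OF H'(1,2)])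
    then have c: "c \<in> \<Gamma>" by (rule \<Gamma>I) (use ab in simp)
    obtain q' where q': "q = (fst b, q', c)" "hm (fst b) q' c" using coequalizerD(1)[OF q] by (rule Alg_homE)
    have xb: "(fst b, snd b, A) \<in> hom Alg (fst b) A"
      by (rule Alg_homI[OF slice_ob(2)[OF b] A slice_ob(4)[OF b]])
    \<comment> \<open>Arrows of the slice commute with the morphisms to \<open>A\<close>, so the
      morphism from \<open>b\<close> to \<open>A\<close> coequalizes \<open>H'\<close>.\<close>
    have eq: "Comp Alg (fst b, snd b, A) h = (fst a, snd a, A)" if h: "h \<in> H'" for h
    proof -
      obtain f0 where "f0 \<in> H" "h = amap slice_fun f0" using h unfolding H'_def by blast
      with f[of f0] show ?thesis by auto
    qed
    have "\<exists>k\<in>hom Alg c A. Comp Alg k q = (fst b, snd b, A)"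
      by (rule coequalizerD(3)[OF q xb]) (simp only: eq)
    then obtain k where k: "k \<in> hom Alg c A" "Comp Alg k q = (fst b, snd b, A)" by blast
    obtain x where x: "k = (c, x, A)" "hm c x A" using k(1) by (rule Alg_homE)
    have ob: "(c, x) \<in> Ob (slice A)" using c x(2) by (simp add: slice_sel(1))
    have z: "(b, q', (c, x)) \<in> hom (slice A) b (c, x)"
      by (rule slice_homI[OF b ob]) (use q' k(2) in \<open>simp_all add: x(1)\<close>)
    have "Comp (slice A) (b, q', (c, x)) f1 = Comp (slice A) (b, q', (c, x)) f2" if f12: "f1 \<in> H" "f2 \<in> H" for f1 f2
    proof -
      obtain h1 where h1: "f1 = (a, h1, b)" "amap slice_fun f1 = (fst a, h1, fst b)" using f[OF f12(1)] by blast
      obtain h2 where h2: "f2 = (a, h2, b)" "amap slice_fun f2 = (fst a, h2, fst b)" using f[OF f12(2)] by blast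
      have "Comp Alg q (amap slice_fun f1) = Comp Alg q (amap slice_fun f2)"
        by (rule coequalizerD(2)[OF q]) (use f12 in \<open>simp_all add: H'_def\<close>)
      then have "q' \<odot> h1 = q' \<odot> h2" by (simp add: q'(1) h1(2) h2(2))
      then show ?thesis by (simp add: h1(1) h2(1) slice_sel(2))
    qed
    then show ?thesis using z by (intro exI[of _ "(c, x)"] exI[of _ "(b, q', (c, x))"] conjI ballI)
  qed
qed

text \<open>Free algebras on \<open>P\<close> belong to the diagram, so every element of
  \<open>A\<close> with arity in \<open>P\<close> gives an object of it. A cocone can thereby be
  evaluated on elements, and density of \<open>P\<close> turns these values into a morphism.\<close>

lemma slice_colimit:
  assumes A: "A \<in> algs"
  shows "colimit Alg (slice A) slice_fun A (\<lambda>a. (fst a, snd a, A))"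
proof -
  have A_ob: "fst A \<in> Ob K" by (rule alg_ob[OF algs_type[OF A]])
  have Fr\<Gamma>: "Fr X \<in> \<Gamma>" if "X \<in> P" for X by (rule \<Gamma>I[OF ggen.free[OF that]]) simp
  have free_ob: "(Fr X, ext X A x) \<in> Ob (slice A)" if "X \<in> P" "x \<in> hom K X (fst A)" for X x
    using Fr\<Gamma>[OF that(1)] ext(1)[OF P_ob[OF that(1)] A that(2)] by (simp add: slice_sel(1))
  \<comment> \<open>An element \<open>g\<close> of a member \<open>b\<close> of the slice is an
    arrow to \<open>b\<close> from the free object on its image in \<open>A\<close>; cocones are
    thus determined by their legs at free objects.\<close>
  have free_arr: "((Fr X, ext X A (y \<odot> g)), ext X (fst b) g, b) \<in> hom (slice A) (Fr X, ext X A (y \<odot> g)) b"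
    if X: "X \<in> P" and b: "b \<in> Ob (slice A)" "snd b = y" and g: "g \<in> hom K X (fst (fst b))" for X b y g
  proof -
    note X_ob = P_ob[OF X]
    have y: "hm (fst b) y A" using slice_ob(4)[OF b(1)] b(2) by simp
    note yg = comp_in[OF C g hm_hom[OF y]]
    note e = ext[OF X_ob slice_ob(2)[OF b(1)] g] and e' = ext[OF X_ob A yg]
    show ?thesis
    proof (rule slice_homI[OF free_ob[OF X yg] b(1)])
      show "hm (fst (Fr X, ext X A (y \<odot> g))) (ext X (fst b) g) (fst b)" using e(1) by simp
      have "y \<odot> ext X (fst b) g = ext X A (y \<odot> g)"
        by (rule Fr_eqI[OF X_ob hm_comp[OF Fr_type[OF X_ob] e(1) y] e'(1)])
          (simp add: comp_assoc[OF C \<eta>[OF X_ob] hm_hom[OF e(1)] hm_hom[OF y]] e(2) e'(2))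
      then show "snd b \<odot> ext X (fst b) g = snd (Fr X, ext X A (y \<odot> g))" by (simp add: b(2))
    qed
  qed
  show ?thesis
  proof (rule colimitI)
    show "cocone Alg (slice A) slice_fun A (\<lambda>a. (fst a, snd a, A))"
    proof (rule coconeI)
      show "A \<in> Ob Alg" using A by simp
      show "(fst a, snd a, A) \<in> hom Alg (omap slice_fun a) A" if "a \<in> Ob (slice A)" for a
        unfolding slice_sel(4) by (rule Alg_homI[OF slice_ob(2)[OF that] A slice_ob(4)[OF that]])
      show "Comp Alg (fst b, snd b, A) (amap slice_fun f) = (fst a, snd a, A)" if "f \<in> hom (slice A) a b" for a b f
        using that by (rule slice_homE) (simp add: slice_sel(5))
    qed
  next
    fix B \<sigma> assume co: "cocone Alg (slice A) slice_fun B \<sigma>"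
    have B: "B \<in> algs" using cocone_ob[OF co] by simp
    have B_ob: "fst B \<in> Ob K" by (rule alg_ob[OF algs_type[OF B]])
    define s where "s a = amap alg_forget (\<sigma> a)" for a
    have \<sigma>: "\<sigma> a = (fst a, s a, B)" "hm (fst a) (s a) B" if "a \<in> Ob (slice A)" for a
      using cocone_hom[OF co that] by (auto simp: Alg_hom s_def slice_sel(4))
    have s_comp: "s b \<odot> h = s a" if "(a, h, b) \<in> hom (slice A) a b" for a b h
    proof -
      have ob: "a \<in> Ob (slice A)" "b \<in> Ob (slice A)" using hom_ob[OF slice_category that] by auto
      show ?thesis using cocone_comp[OF co that] by (simp add: slice_sel(5) \<sigma>(1)[OF ob(1)] \<sigma>(1)[OF ob(2)])
    qed
    \<comment> \<open>The leg at the free object belonging to \<open>x\<close>, evaluated at the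
      generic element \<open>\<eta> X\<close>.\<close>
    define \<phi> where "\<phi> X x = s (Fr X, ext X A x) \<odot> \<eta> X" for X x
    have s_\<eta>: "s b \<odot> g = \<phi> X (snd b \<odot> g)"
      if X: "X \<in> P" and b: "b \<in> Ob (slice A)" and g: "g \<in> hom K X (fst (fst b))" for X b g
    proof -
      note X_ob = P_ob[OF X]
      note e = ext[OF X_ob slice_ob(2)[OF b] g]
      have "\<phi> X (snd b \<odot> g) = (s b \<odot> ext X (fst b) g) \<odot> \<eta> X"
        using s_comp[OF free_arr[OF X b HOL.refl g]] by (simp add: \<phi>_def)
      also have "\<dots> = s b \<odot> g"
        using comp_assoc[OF C \<eta>[OF X_ob] hm_hom[OF e(1)] hm_hom[OF \<sigma>(2)[OF b]]] e(2) by simp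
      finally show ?thesis by simp
    qed
    have \<phi>_in: "\<phi> X x \<in> hom K X (fst B)" if "X \<in> P" "x \<in> hom K X (fst A)" for X x
      using comp_in[OF C \<eta>[OF P_ob[OF that(1)]]] hm_hom[OF \<sigma>(2)[OF free_ob[OF that]]] by (simp add: \<phi>_def)
    have ext_\<eta>: "snd (Fr X, ext X A x) \<odot> \<eta> X = x" if "X \<in> P" "x \<in> hom K X (fst A)" for X x
      using ext(2)[OF P_ob[OF that(1)] A that(2)] by simp
    have nat: "\<phi> Y (x \<odot> u) = \<phi> X x \<odot> u"
      if X: "X \<in> P" and Y: "Y \<in> P" and u: "u \<in> hom K Y X" and x: "x \<in> hom K X (fst A)" for X Y u x
    proof -
      note X_ob = P_ob[OF X] and b = free_ob[OF X x]
      note e = hm_hom[OF ext(1)[OF X_ob A x]]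
      have \<eta>u: "\<eta> X \<odot> u \<in> hom K Y (fst (fst (Fr X, ext X A x)))" using comp_in[OF C u \<eta>[OF X_ob]] by simp
      have "snd (Fr X, ext X A x) \<odot> \<eta> X \<odot> u = x \<odot> u"
        using comp_assoc[OF C u \<eta>[OF X_ob] e] ext_\<eta>[OF X x] by simp
      then have "\<phi> Y (x \<odot> u) = s (Fr X, ext X A x) \<odot> \<eta> X \<odot> u" using s_\<eta>[OF Y b \<eta>u] by simp
      also have "\<dots> = \<phi> X x \<odot> u"
        unfolding \<phi>_def by (rule comp_assoc[OF C u \<eta>[OF X_ob], symmetric]) (use hm_hom[OF \<sigma>(2)[OF b]] in simp)
      finally show ?thesis .
    qed
    obtain h where h: "h \<in> hom K (fst A) (fst B)" and h\<phi>': "\<forall>X\<in>P. \<forall>x\<in>hom K X (fst A). h \<odot> x = \<phi> X x"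
      using P_extend[where \<phi> = \<phi>, OF A_ob B_ob \<phi>_in nat] .
    have h\<phi>: "h \<odot> x = \<phi> X x" if "X \<in> P" "x \<in> hom K X (fst A)" for X x using h\<phi>' that by blast
    \<comment> \<open>The operation is applied to the generic element inside
      \<open>Fr (src w)\<close>. The result is an element of a member of the slice, so
      \<open>s_\<eta>\<close> applies to it, and the leg there is a homomorphism.\<close>
    have hh: "hm A h B"
    proof (rule hmI[OF h])
      fix w g assume w: "w \<in> ops E" and g: "g \<in> hom K (src w) (fst A)"
      have X: "src w \<in> P" and Y: "tgt w \<in> P" using arity[OF w] by auto
      note X_ob = P_ob[OF X] and b = free_ob[OF X g]
      note \<eta>X = \<eta>[OF X_ob] and e = ext[OF X_ob A g]
      have o: "snd (Fr (src w)) w (\<eta> (src w)) \<in> hom K (tgt w) (fst (fst (Fr (src w), ext (src w) A g)))"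
        using op_in[OF Fr_type[OF X_ob] w \<eta>X] by simp
      have "snd (Fr (src w), ext (src w) A g) \<odot> snd (Fr (src w)) w (\<eta> (src w)) = snd A w g"
        using hm_op[OF e(1) w \<eta>X] e(2) by simp
      then have "h \<odot> snd A w g = s (Fr (src w), ext (src w) A g) \<odot> snd (Fr (src w)) w (\<eta> (src w))"
        using s_\<eta>[OF Y b o] h\<phi>[OF Y op_in[OF algs_type[OF A] w g]] by simp
      also have "\<dots> = snd B w (\<phi> (src w) g)"
        unfolding \<phi>_def by (rule hm_op[OF _ w \<eta>X]) (use \<sigma>(2)[OF b] in simp)
      finally show "h \<odot> snd A w g = snd B w (h \<odot> g)" using h\<phi>[OF X g] by simp
    qed
    have hs: "h \<odot> snd a = s a" if a: "a \<in> Ob (slice A)" for a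
    proof (rule P_separate)
      note xa = hm_hom[OF slice_ob(4)[OF a]]
      show "h \<odot> snd a \<in> hom K (fst (fst a)) (fst B)" by (rule comp_in[OF C xa h])
      show "s a \<in> hom K (fst (fst a)) (fst B)" by (rule hm_hom[OF \<sigma>(2)[OF a]])
      fix X p assume X: "X \<in> P" and p: "p \<in> hom K X (fst (fst a))"
      show "(h \<odot> snd a) \<odot> p = s a \<odot> p"
        using comp_assoc[OF C p xa h] h\<phi>[OF X comp_in[OF C p xa]] s_\<eta>[OF X a p] by simp
    qed
    show "\<exists>k\<in>hom Alg A B. \<forall>a\<in>Ob (slice A). Comp Alg k (fst a, snd a, A) = \<sigma> a"
    proof (intro bexI[of _ "(A, h, B)"] Alg_homI[OF A B hh] ballI)
      fix a assume a: "a \<in> Ob (slice A)"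
      show "Comp Alg (A, h, B) (fst a, snd a, A) = \<sigma> a"
        unfolding \<sigma>(1)[OF a] Alg_sel(2) hs[OF a] ..
    qed
  next
    fix B h k assume h: "h \<in> hom Alg A B" and k: "k \<in> hom Alg A B"
      and eq: "\<And>a. a \<in> Ob (slice A) \<Longrightarrow> Comp Alg h (fst a, snd a, A) = Comp Alg k (fst a, snd a, A)"
    obtain h' where h': "h = (A, h', B)" "hm A h' B" using h by (rule Alg_homE)
    obtain k' where k': "k = (A, k', B)" "hm A k' B" using k by (rule Alg_homE)
    have "h' = k'"
    proof (rule P_separate[OF hm_hom[OF h'(2)] hm_hom[OF k'(2)]])
      fix X x assume X: "X \<in> P" and x: "x \<in> hom K X (fst A)"
      note X_ob = P_ob[OF X]
      note e = ext[OF X_ob A x]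
      have "h' \<odot> ext X A x = k' \<odot> ext X A x" using eq[OF free_ob[OF X x]] by (simp add: h'(1) k'(1))
      then show "h' \<odot> x = k' \<odot> x"
        using comp_assoc[OF C \<eta>[OF X_ob] hm_hom[OF e(1)] hm_hom[OF h'(2)]]
          comp_assoc[OF C \<eta>[OF X_ob] hm_hom[OF e(1)] hm_hom[OF k'(2)]] e(2) by simp
    qed
    then show "h = k" by (simp add: h'(1) k'(1))
  qed
qed

text \<open>The canonical diagram lives on types of its own, so its scheme is renamed into the
  universe type to meet the definition.\<close>

lemma Alg_locally_presentable: "locally_presentable U r Alg"
  unfolding locally_presentable_def
proof (intro conjI exI[of _ \<Gamma>] ballI)
  show "category Alg" "locally_small U Alg" "cocomplete U Alg" "small U \<Gamma>"
    by (rule Alg_category Alg_locally_small Alg_cocomplete \<Gamma>_small)+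
  show "presentable U r Alg G" if "G \<in> \<Gamma>" for G by (rule \<Gamma>_presentable[OF that])
  fix A assume "A \<in> Ob Alg"
  then have A: "A \<in> algs" by simp
  let ?S = "slice A"
  have sm: "small U (Ob ?S)" "small U (Arr ?S)" using slice_small[of A] by (simp_all add: small_category_def)
  obtain e :: "_ \<Rightarrow> 'u" where e: "inj_on e (Ob ?S)" using small_embed[OF sm(1)] .
  obtain e' :: "_ \<Rightarrow> 'u" where e': "inj_on e' (Arr ?S)" using small_embed[OF sm(2)] .
  note tr = slice_category[of A] e e'
  have 1: "small_category U (transport_cat e e' ?S)"
    using sm transport_category[OF tr] by (simp add: small_category_def transport_sel[OF tr] small_image)
  have 2: "filtered r (transport_cat e e' ?S)"
    by (rule filt_filtered[OF filt_transport[OF slice_filt[OF A] r e e'] r])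
  have 3: "\<forall>i\<in>Ob (transport_cat e e' ?S). omap (transport_functor e e' ?S slice_fun) i \<in> \<Gamma>"
    unfolding transport_sel(1)[OF tr]
    by (intro ballI, erule imageE) (simp add: transport_sel[OF tr] slice_sel(4) slice_ob(1))
  show "\<exists>(J :: ('u, 'u) cat) D \<tau>. small_category U J \<and> filtered r J \<and> is_functor J Alg D \<and>
      (\<forall>i\<in>Ob J. omap D i \<in> \<Gamma>) \<and> colimit Alg J D A \<tau>"
    by (rule exI, rule exI, rule exI, intro conjI, rule 1, rule 2, rule transport_is_functor[OF tr slice_functor],
      rule 3, rule transport_colimit'[OF tr slice_colimit[OF A]])
qed

end

theorem theorem3p8:
  fixes r :: "'l rel"
    and K :: "('o, 'm) cat"
    and P :: "'o set"
    and E :: "('o, 'm, 'w) eq_theory"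
  assumes "universe TYPE('u)"
    and "regular_cardinal r" and "small TYPE('u) (Field r)"
    and "locally_presentable TYPE('u) r K"
    and "representative_presentables TYPE('u) r K P"
    and "equational_theory TYPE('u) K P E"
  shows "locally_presentable TYPE('u) r (alg_cat K P E) \<and>
    monadic (alg_cat K P E) K alg_forget \<and>
    preserves_filtered_colimits TYPE('u) r (alg_cat K P E) K alg_forget"
proof -
  interpret theory_on "TYPE('u)" r K P E
    by (intro theory_on.intro lp_catI[OF assms(1-5)] theory_on_axioms.intro assms(6))
  show ?thesis using Alg_locally_presentable monadic preserves by simp
qed

end
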